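(* Let $\mathcal{T}$ be a triangulated category, let $\mathcal{P}=\operatorname{add}\mathcal{P}$ be a presilting subcategory of $\mathcal{T}$ satisfying conditions (P1) and (P2) (stated in the context), and let $\rho:\mathcal{T}\to\mathcal{U}:=\mathcal{T}/\operatorname{thick}\mathcal{P}$ be the canonical projection functor to the triangle quotient. Then the bijection $\operatorname{silt}_{\mathcal{P}}\mathcal{T}\to\operatorname{silt}\mathcal{U}$, $\mathcal{M}\mapsto\rho(\mathcal{M})$, is an isomorphism of partially ordered sets.
   Context: All subcategories are full. $[1]$ is the shift functor. $\operatorname{add}\mathcal{S}$ is the smallest full subcategory containing $\mathcal{S}$ and closed under isomorphisms, finite direct sums and direct summands; $\operatorname{thick}\mathcal{S}$ is the smallest triangulated subcategory containing $\mathcal{S}$ and closed under direct summands. A subcategory $\mathcal{M}$ of a triangulated category $\mathcal{T}$ is presilting if $\operatorname{Hom}_{\mathcal{T}}(\mathcal{M},\mathcal{M}[i])=0$ for all $i>0$, and silting if in addition $\mathcal{T}=\operatorname{thick}\mathcal{M}$. $\operatorname{silt}\mathcal{T}$ is the class of silting subcategories of $\mathcal{T}$, where $\mathcal{M}$ and $\mathcal{N}$ are identified when $\operatorname{add}\mathcal{M}=\operatorname{add}\mathcal{N}$; $\operatorname{silt}_{\mathcal{P}}\mathcal{T}$ is the class of silting subcategories containing $\mathcal{P}$. Partial order on $\operatorname{silt}\mathcal{T}$ (and similarly on $\operatorname{silt}\mathcal{U}$, and restricted to $\operatorname{silt}_{\mathcal{P}}\mathcal{T}$): $\mathcal{M}\ge\mathcal{N}$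 if $\operatorname{Hom}_{\mathcal{T}}(\mathcal{M},\mathcal{N}[i])=0$ for all $i>0$. That $\rho$ induces a bijection $\operatorname{silt}_{\mathcal{P}}\mathcal{T}\to\operatorname{silt}\mathcal{U}$ under the present hypotheses is a theorem of the paper. ${}^{\perp}\mathcal{P}[>0]=\{X\in\mathcal{T}\mid\operatorname{Hom}_{\mathcal{T}}(X,\mathcal{P}[i])=0\ \forall i>0\}$ and $\mathcal{P}[<0]^{\perp}=\{X\in\mathcal{T}\mid\operatorname{Hom}_{\mathcal{T}}(\mathcal{P}[i],X)=0\ \forall i<0\}$. $\mathcal{S}$ is contravariantly finite in a category if every object $X$ of it has a right $\mathcal{S}$-approximation, i.e. a morphism $f:S\to X$ with $S\in\mathcal{S}$ such that $\operatorname{Hom}(S',f)$ is surjective for all $S'\in\mathcal{S}$; covariantly finite is defined dually via left approximations. (P1) $\mathcal{P}$ is covariantly finite in ${}^{\perp}\mathcal{P}[>0]$ and contravariantly finite in $\mathcal{P}[<0]^{\perp}$. (P2) For any $X\in\mathcal{T}$, $\operatorname{Hom}_{\mathcal{T}}(X,\mathcal{P}[\ell])=0=\operatorname{Hom}_{\mathcal{T}}(\mathcal{P},X[\ell])$ for all $\ell\gg0$. *)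

theory Defs
  imports "HOL-Algebra.Group"
begin

section \<open>Triangulated categories\<close>

record ('o, 'a) shift_cat =
  obj :: "'o set"
  arr :: "'a set"
  src :: "'a \<Rightarrow> 'o"
  tgt :: "'a \<Rightarrow> 'o"
  idt :: "'o \<Rightarrow> 'a"
  comp :: "'a \<Rightarrow> 'a \<Rightarrow> 'a" (infixr \<open>\<cdot>\<index>\<close> 75)  \<comment> \<open>\<open>g \<cdot> f\<close> is first \<open>f\<close>, then \<open>g\<close>\<close>
  madd :: "'a \<Rightarrow> 'a \<Rightarrow> 'a"
  mzero :: "'o \<Rightarrow> 'o \<Rightarrow> 'a"
  sho :: "'o \<Rightarrow> 'o"
  sha :: "'a \<Rightarrow> 'a"

record ('o, 'a) tri_cat = "('o, 'a) shift_cat" +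
  dist :: "('a \<times> 'a \<times> 'a) set"

definition Hom :: "('o, 'a, 'b) shift_cat_scheme \<Rightarrow> 'o \<Rightarrow> 'o \<Rightarrow> 'a set" where
  "Hom T X Y = {f \<in> arr T. src T f = X \<and> tgt T f = Y}"

definition hom_group :: "('o, 'a, 'b) shift_cat_scheme \<Rightarrow> 'o \<Rightarrow> 'o \<Rightarrow> 'a monoid" where
  "hom_group T X Y = \<lparr>carrier = Hom T X Y, mult = madd T, one = mzero T X Y\<rparr>"

definition mneg :: "('o, 'a, 'b) shift_cat_scheme \<Rightarrow> 'a \<Rightarrow> 'a" where
  "mneg T f = m_inv (hom_group T (src T f) (tgt T f)) f"

definition is_iso :: "('o, 'a, 'b) shift_cat_scheme \<Rightarrow> 'a \<Rightarrow> bool" where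
  "is_iso T f \<longleftrightarrow> f \<in> arr T \<and>
     (\<exists>g \<in> Hom T (tgt T f) (src T f).
        g \<cdot>\<^bsub>T\<^esub> f = idt T (src T f) \<and> f \<cdot>\<^bsub>T\<^esub> g = idt T (tgt T f))"

definition isomorphic :: "('o, 'a, 'b) shift_cat_scheme \<Rightarrow> 'o \<Rightarrow> 'o \<Rightarrow> bool" where
  "isomorphic T X Y \<longleftrightarrow> (\<exists>f \<in> Hom T X Y. is_iso T f)"

definition zero_object :: "('o, 'a, 'b) shift_cat_scheme \<Rightarrow> 'o \<Rightarrow> bool" where
  "zero_object T Z \<longleftrightarrow> Z \<in> obj T \<and>
     (\<forall>X \<in> obj T. Hom T X Z = {mzero T X Z} \<and> Hom T Z X = {mzero T Z X})"

definition direct_sum :: "('o, 'a, 'b) shift_cat_scheme \<Rightarrow> 'o \<Rightarrow> 'o \<Rightarrow> 'o \<Rightarrow> bool" where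
  "direct_sum T X Y S \<longleftrightarrow>
     (\<exists>i \<in> Hom T X S. \<exists>j \<in> Hom T Y S. \<exists>p \<in> Hom T S X. \<exists>q \<in> Hom T S Y.
        p \<cdot>\<^bsub>T\<^esub> i = idt T X \<and> q \<cdot>\<^bsub>T\<^esub> j = idt T Y \<and>
        q \<cdot>\<^bsub>T\<^esub> i = mzero T X Y \<and> p \<cdot>\<^bsub>T\<^esub> j = mzero T Y X \<and>
        madd T (i \<cdot>\<^bsub>T\<^esub> p) (j \<cdot>\<^bsub>T\<^esub> q) = idt T S)"

text \<open>A triangle \<open>X \<rightarrow> Y \<rightarrow> Z \<rightarrow> X[1]\<close> is the triple of its three arrows.\<close>

fun triangle :: "('o, 'a, 'b) shift_cat_scheme \<Rightarrow> 'a \<times> 'a \<times> 'a \<Rightarrow> bool" where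
  "triangle T (u, v, w) \<longleftrightarrow> u \<in> arr T \<and> v \<in> arr T \<and> w \<in> arr T \<and>
     src T v = tgt T u \<and> src T w = tgt T v \<and> tgt T w = sho T (src T u)"

fun triangle_mor ::
  "('o, 'a, 'b) shift_cat_scheme \<Rightarrow> 'a \<Rightarrow> 'a \<Rightarrow> 'a \<Rightarrow> 'a \<times> 'a \<times> 'a \<Rightarrow> 'a \<times> 'a \<times> 'a \<Rightarrow> bool" where
  "triangle_mor T a b c (u, v, w) (u', v', w') \<longleftrightarrow>
     a \<in> Hom T (src T u) (src T u') \<and> b \<in> Hom T (tgt T u) (tgt T u') \<and>
     c \<in> Hom T (tgt T v) (tgt T v') \<and>
     b \<cdot>\<^bsub>T\<^esub> u = u' \<cdot>\<^bsub>T\<^esub> a \<and> c \<cdot>\<^bsub>T\<^esub> v = v' \<cdot>\<^bsub>T\<^esub> b \<and> sha T a \<cdot>\<^bsub>T\<^esub> w = w' \<cdot>\<^bsub>T\<^esub> c"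

definition triangle_iso ::
  "('o, 'a, 'b) shift_cat_scheme \<Rightarrow> 'a \<times> 'a \<times> 'a \<Rightarrow> 'a \<times> 'a \<times> 'a \<Rightarrow> bool" where
  "triangle_iso T s t \<longleftrightarrow> triangle T s \<and> triangle T t \<and>
     (\<exists>a b c. is_iso T a \<and> is_iso T b \<and> is_iso T c \<and> triangle_mor T a b c s t)"

locale additive_category =
  fixes T :: "('o, 'a, 'b) shift_cat_scheme" (structure)
  assumes src_tgt_obj: "f \<in> arr T \<Longrightarrow> src T f \<in> obj T \<and> tgt T f \<in> obj T"
    and idt_hom: "X \<in> obj T \<Longrightarrow> idt T X \<in> Hom T X X"
    and comp_hom: "\<lbrakk>f \<in> Hom T X Y; g \<in> Hom T Y Z\<rbrakk> \<Longrightarrow> g \<cdot> f \<in> Hom T X Z"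
    and comp_assoc: "\<lbrakk>f \<in> Hom T W X; g \<in> Hom T X Y; h \<in> Hom T Y Z\<rbrakk> \<Longrightarrow> h \<cdot> (g \<cdot> f) = (h \<cdot> g) \<cdot> f"
    and comp_idt: "f \<in> Hom T X Y \<Longrightarrow> f \<cdot> idt T X = f \<and> idt T Y \<cdot> f = f"
    and hom_comm_group: "\<lbrakk>X \<in> obj T; Y \<in> obj T\<rbrakk> \<Longrightarrow> comm_group (hom_group T X Y)"
    and comp_add_right: "\<lbrakk>f \<in> Hom T X Y; f' \<in> Hom T X Y; g \<in> Hom T Y Z\<rbrakk>
           \<Longrightarrow> g \<cdot> madd T f f' = madd T (g \<cdot> f) (g \<cdot> f')"
    and comp_add_left: "\<lbrakk>f \<in> Hom T X Y; g \<in> Hom T Y Z; g' \<in> Hom T Y Z\<rbrakk>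
           \<Longrightarrow> madd T g g' \<cdot> f = madd T (g \<cdot> f) (g' \<cdot> f)"
    and zero_object_exists: "\<exists>Z. zero_object T Z"
    and direct_sum_exists: "\<lbrakk>X \<in> obj T; Y \<in> obj T\<rbrakk> \<Longrightarrow> \<exists>S. direct_sum T X Y S"

text \<open>The shift is an additive automorphism: bijective on objects and fully faithful.\<close>

locale triangulated_category = additive_category T
  for T :: "('o, 'a, 'b) tri_cat_scheme" (structure) +
  assumes sho_bij: "bij_betw (sho T) (obj T) (obj T)"
    and sha_bij: "\<lbrakk>X \<in> obj T; Y \<in> obj T\<rbrakk>
           \<Longrightarrow> bij_betw (sha T) (Hom T X Y) (Hom T (sho T X) (sho T Y))"
    and sha_idt: "X \<in> obj T \<Longrightarrow> sha T (idt T X) = idt T (sho T X)"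
    and sha_comp: "\<lbrakk>f \<in> Hom T X Y; g \<in> Hom T Y Z\<rbrakk> \<Longrightarrow> sha T (g \<cdot> f) = sha T g \<cdot> sha T f"
    and sha_add: "\<lbrakk>f \<in> Hom T X Y; g \<in> Hom T X Y\<rbrakk>
           \<Longrightarrow> sha T (madd T f g) = madd T (sha T f) (sha T g)"
    and dist_triangle: "t \<in> dist T \<Longrightarrow> triangle T t"
    and dist_iso: "\<lbrakk>s \<in> dist T; triangle_iso T s t\<rbrakk> \<Longrightarrow> t \<in> dist T"
    and dist_idt: "\<lbrakk>X \<in> obj T; zero_object T Z\<rbrakk>
           \<Longrightarrow> (idt T X, mzero T X Z, mzero T Z (sho T X)) \<in> dist T"
    and dist_complete: "u \<in> arr T \<Longrightarrow> \<exists>v w. (u, v, w) \<in> dist T"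
    and dist_rotate: "triangle T (u, v, w)
           \<Longrightarrow> (u, v, w) \<in> dist T \<longleftrightarrow> (v, w, mneg T (sha T u)) \<in> dist T"
    and dist_mor: "\<lbrakk>(u, v, w) \<in> dist T; (u', v', w') \<in> dist T;
             a \<in> Hom T (src T u) (src T u'); b \<in> Hom T (tgt T u) (tgt T u'); b \<cdot> u = u' \<cdot> a\<rbrakk>
           \<Longrightarrow> \<exists>c. triangle_mor T a b c (u, v, w) (u', v', w')"
    and octahedral: "\<lbrakk>(u, j, k) \<in> dist T; (v, l, i) \<in> dist T; (v \<cdot> u, m, n) \<in> dist T; tgt T u = src T v\<rbrakk>
           \<Longrightarrow> \<exists>f g. f \<in> Hom T (tgt T j) (tgt T m) \<and> g \<in> Hom T (tgt T m) (tgt T l) \<and>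
                 (f, g, sha T j \<cdot> i) \<in> dist T \<and>
                 f \<cdot> j = m \<cdot> v \<and> n \<cdot> f = k \<and> g \<cdot> m = l \<and> i \<cdot> g = sha T u \<cdot> n"


section \<open>Subcategories\<close>

text \<open>A full subcategory is represented by its set of objects; it need not be closed under
  isomorphisms.\<close>

definition shift :: "('o, 'a, 'b) shift_cat_scheme \<Rightarrow> int \<Rightarrow> 'o \<Rightarrow> 'o" where
  "shift T i X = (if 0 \<le> i then (sho T ^^ nat i) X
                  else (inv_into (obj T) (sho T) ^^ nat (- i)) X)"

definition hom_vanish :: "('o, 'a, 'b) shift_cat_scheme \<Rightarrow> 'o set \<Rightarrow> 'o set \<Rightarrow> bool" where
  "hom_vanish T A B \<longleftrightarrow> (\<forall>X \<in> A. \<forall>Y \<in> B. Hom T X Y = {mzero T X Y})"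

definition iso_closed :: "('o, 'a, 'b) shift_cat_scheme \<Rightarrow> 'o set \<Rightarrow> bool" where
  "iso_closed T N \<longleftrightarrow> (\<forall>X \<in> N. \<forall>Y \<in> obj T. isomorphic T X Y \<longrightarrow> Y \<in> N)"

definition sum_closed :: "('o, 'a, 'b) shift_cat_scheme \<Rightarrow> 'o set \<Rightarrow> bool" where
  "sum_closed T N \<longleftrightarrow> (\<forall>Z. zero_object T Z \<longrightarrow> Z \<in> N) \<and>
     (\<forall>X \<in> N. \<forall>Y \<in> N. \<forall>S \<in> obj T. direct_sum T X Y S \<longrightarrow> S \<in> N)"

definition summand_closed :: "('o, 'a, 'b) shift_cat_scheme \<Rightarrow> 'o set \<Rightarrow> bool" where
  "summand_closed T N \<longleftrightarrow>
     (\<forall>S \<in> N. \<forall>X \<in> obj T. \<forall>Y \<in> obj T. direct_sum T X Y S \<longrightarrow> X \<in> N)"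

definition add_hull :: "('o, 'a, 'b) shift_cat_scheme \<Rightarrow> 'o set \<Rightarrow> 'o set" where
  "add_hull T S = \<Inter>{N. S \<subseteq> N \<and> N \<subseteq> obj T \<and> iso_closed T N \<and> sum_closed T N \<and> summand_closed T N}"

definition triangulated_subcategory :: "('o, 'a, 'b) tri_cat_scheme \<Rightarrow> 'o set \<Rightarrow> bool" where
  "triangulated_subcategory T N \<longleftrightarrow> N \<subseteq> obj T \<and> N \<noteq> {} \<and> iso_closed T N \<and>
     (\<forall>X \<in> obj T. sho T X \<in> N \<longleftrightarrow> X \<in> N) \<and>
     (\<forall>(u, v, w) \<in> dist T. src T u \<in> N \<and> tgt T u \<in> N \<longrightarrow> tgt T v \<in> N)"

definition thick :: "('o, 'a, 'b) tri_cat_scheme \<Rightarrow> 'o set \<Rightarrow> 'o set" where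
  "thick T S = \<Inter>{N. S \<subseteq> N \<and> triangulated_subcategory T N \<and> summand_closed T N}"

definition left_perp_pos :: "('o, 'a, 'b) shift_cat_scheme \<Rightarrow> 'o set \<Rightarrow> 'o set" where
  "left_perp_pos T P = {X \<in> obj T. \<forall>i>0. hom_vanish T {X} (shift T i ` P)}"

definition right_perp_neg :: "('o, 'a, 'b) shift_cat_scheme \<Rightarrow> 'o set \<Rightarrow> 'o set" where
  "right_perp_neg T P = {X \<in> obj T. \<forall>i<0. hom_vanish T (shift T i ` P) {X}}"

definition contravariantly_finite_in ::
  "('o, 'a, 'b) shift_cat_scheme \<Rightarrow> 'o set \<Rightarrow> 'o set \<Rightarrow> bool" where
  "contravariantly_finite_in T S C \<longleftrightarrow> S \<subseteq> C \<and>
     (\<forall>X \<in> C. \<exists>S0 \<in> S. \<exists>f \<in> Hom T S0 X.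
        \<forall>S' \<in> S. (\<lambda>h. f \<cdot>\<^bsub>T\<^esub> h) ` Hom T S' S0 = Hom T S' X)"

definition covariantly_finite_in ::
  "('o, 'a, 'b) shift_cat_scheme \<Rightarrow> 'o set \<Rightarrow> 'o set \<Rightarrow> bool" where
  "covariantly_finite_in T S C \<longleftrightarrow> S \<subseteq> C \<and>
     (\<forall>X \<in> C. \<exists>S0 \<in> S. \<exists>f \<in> Hom T X S0.
        \<forall>S' \<in> S. (\<lambda>h. h \<cdot>\<^bsub>T\<^esub> f) ` Hom T S0 S' = Hom T X S')"

definition P1 :: "('o, 'a, 'b) shift_cat_scheme \<Rightarrow> 'o set \<Rightarrow> bool" where
  "P1 T P \<longleftrightarrow> covariantly_finite_in T P (left_perp_pos T P) \<and>
     contravariantly_finite_in T P (right_perp_neg T P)"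

definition P2 :: "('o, 'a, 'b) shift_cat_scheme \<Rightarrow> 'o set \<Rightarrow> bool" where
  "P2 T P \<longleftrightarrow> (\<forall>X \<in> obj T. \<exists>l0. \<forall>l \<ge> l0.
     hom_vanish T {X} (shift T l ` P) \<and> hom_vanish T P {shift T l X})"


section \<open>Silting subcategories\<close>

definition presilting :: "('o, 'a, 'b) shift_cat_scheme \<Rightarrow> 'o set \<Rightarrow> bool" where
  "presilting T M \<longleftrightarrow> M \<subseteq> obj T \<and> (\<forall>i>0. hom_vanish T M (shift T i ` M))"

definition silting :: "('o, 'a, 'b) tri_cat_scheme \<Rightarrow> 'o set \<Rightarrow> bool" where
  "silting T M \<longleftrightarrow> presilting T M \<and> thick T M = obj T"

definition silting_equiv :: "('o, 'a, 'b) tri_cat_scheme \<Rightarrow> ('o set \<times> 'o set) set" where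
  "silting_equiv T = {(M, N). silting T M \<and> silting T N \<and> add_hull T M = add_hull T N}"

definition silt_class :: "('o, 'a, 'b) tri_cat_scheme \<Rightarrow> 'o set \<Rightarrow> 'o set set" where
  "silt_class T M = silting_equiv T `` {M}"

definition silt :: "('o, 'a, 'b) tri_cat_scheme \<Rightarrow> 'o set set set" where
  "silt T = silt_class T ` {M. silting T M}"

definition silt_over :: "('o, 'a, 'b) tri_cat_scheme \<Rightarrow> 'o set \<Rightarrow> 'o set set set" where
  "silt_over T P = silt_class T ` {M. silting T M \<and> P \<subseteq> M}"

text \<open>The pair \<open>(C, D)\<close> lies in the relation iff \<open>C \<ge> D\<close>.\<close>

definition silt_ge :: "('o, 'a, 'b) tri_cat_scheme \<Rightarrow> 'o set set rel" where
  "silt_ge T = {(C, D). C \<in> silt T \<and> D \<in> silt T \<and>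
     (\<exists>M \<in> C. \<exists>N \<in> D. \<forall>i>0. hom_vanish T M (shift T i ` N))}"

definition poset_isomorphism :: "'x set \<Rightarrow> 'x rel \<Rightarrow> 'y set \<Rightarrow> 'y rel \<Rightarrow> ('x \<Rightarrow> 'y) \<Rightarrow> bool" where
  "poset_isomorphism A r B s f \<longleftrightarrow> partial_order_on A r \<and> partial_order_on B s \<and>
     bij_betw f A B \<and> (\<forall>x \<in> A. \<forall>y \<in> A. (x, y) \<in> r \<longleftrightarrow> (f x, f y) \<in> s)"


section \<open>The triangle quotient\<close>

text \<open>For a thick subcategory \<open>N\<close>, the quotient \<open>T/N\<close> is the localization of \<open>T\<close> at the arrows
  whose cone lies in \<open>N\<close>. It has the objects of \<open>T\<close>; its arrows \<open>X \<rightarrow> Y\<close> are equivalence classes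
  of roofs \<open>(s, f)\<close>, that is, \<open>X \<leftarrow>s\<midarrow> Z \<midarrow>f\<rightarrow> Y\<close> with \<open>s\<close> to be inverted.\<close>

type_synonym 'a roof = "'a \<times> 'a"

definition cone_in :: "('o, 'a, 'b) tri_cat_scheme \<Rightarrow> 'o set \<Rightarrow> 'a set" where
  "cone_in T N = {s \<in> arr T. \<exists>v w. (s, v, w) \<in> dist T \<and> tgt T v \<in> N}"

definition roofs :: "('o, 'a, 'b) tri_cat_scheme \<Rightarrow> 'o set \<Rightarrow> 'a roof set" where
  "roofs T N = {(s, f). s \<in> cone_in T N \<and> f \<in> arr T \<and> src T s = src T f}"

definition roof_equiv :: "('o, 'a, 'b) tri_cat_scheme \<Rightarrow> 'o set \<Rightarrow> 'a roof rel" where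
  "roof_equiv T N = {((s, f), (t, g)). (s, f) \<in> roofs T N \<and> (t, g) \<in> roofs T N \<and>
     tgt T s = tgt T t \<and> tgt T f = tgt T g \<and>
     (\<exists>W. \<exists>a \<in> Hom T W (src T s). \<exists>b \<in> Hom T W (src T t).
        s \<cdot>\<^bsub>T\<^esub> a = t \<cdot>\<^bsub>T\<^esub> b \<and> f \<cdot>\<^bsub>T\<^esub> a = g \<cdot>\<^bsub>T\<^esub> b \<and> s \<cdot>\<^bsub>T\<^esub> a \<in> cone_in T N)}"

definition fraction :: "('o, 'a, 'b) tri_cat_scheme \<Rightarrow> 'o set \<Rightarrow> 'a \<Rightarrow> 'a \<Rightarrow> 'a roof set" where
  "fraction T N s f = roof_equiv T N `` {(s, f)}"

definition proj_arr :: "('o, 'a, 'b) tri_cat_scheme \<Rightarrow> 'o set \<Rightarrow> 'a \<Rightarrow> 'a roof set" where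
  "proj_arr T N f = fraction T N (idt T (src T f)) f"

definition proj_obj :: "('o, 'a, 'b) tri_cat_scheme \<Rightarrow> 'o set \<Rightarrow> 'o \<Rightarrow> 'o" where
  "proj_obj T N X = X"

text \<open>Two roofs are composed through any completion \<open>f \<cdot> t' = t \<cdot> f'\<close> with \<open>t'\<close> inverted, and added
  over a common denominator. The unions below are over all such choices; each contributes the
  same class.\<close>

definition localization ::
  "('o, 'a, 'b) tri_cat_scheme \<Rightarrow> 'o set \<Rightarrow> ('o, 'a roof set) shift_cat" where
  "localization T N = \<lparr>
     obj = obj T,
     arr = roofs T N // roof_equiv T N,
     src = (\<lambda>A. the_elem ((\<lambda>(s, f). tgt T s) ` A)),
     tgt = (\<lambda>A. the_elem ((\<lambda>(s, f). tgt T f) ` A)),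
     idt = (\<lambda>X. proj_arr T N (idt T X)),
     comp = (\<lambda>B A. \<Union>{fraction T N (s \<cdot>\<^bsub>T\<^esub> t') (g \<cdot>\<^bsub>T\<^esub> f') | s f t g t' f'.
        (s, f) \<in> A \<and> (t, g) \<in> B \<and> t' \<in> cone_in T N \<and> f' \<in> arr T \<and>
        src T t' = src T f' \<and> tgt T t' = src T f \<and> tgt T f' = src T t \<and>
        f \<cdot>\<^bsub>T\<^esub> t' = t \<cdot>\<^bsub>T\<^esub> f'}),
     madd = (\<lambda>A B. \<Union>{fraction T N s (madd T f g) | s f g. (s, f) \<in> A \<and> (s, g) \<in> B}),
     mzero = (\<lambda>X Y. proj_arr T N (mzero T X Y)),
     sho = sho T,
     sha = (\<lambda>A. map_prod (sha T) (sha T) ` A)\<rparr>"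

definition triangle_quotient ::
  "('o, 'a, 'b) tri_cat_scheme \<Rightarrow> 'o set \<Rightarrow> ('o, 'a roof set) tri_cat" where
  "triangle_quotient T N = shift_cat.extend (localization T N) (tri_cat.fields
     {t. \<exists>(u, v, w) \<in> dist T.
           triangle_iso (localization T N) (proj_arr T N u, proj_arr T N v, proj_arr T N w) t})"

end

theory Submission
  imports Defs
begin

text \<open>
  Let \<open>S = thick P\<close>. By (P1) and (P2), an object \<open>X\<close> with \<open>Hom(X, P[j]) = 0\<close> for \<open>j > l\<close> can be truncated by
  left \<open>P[l]\<close>-approximations, so that the cone of \<open>X' \<rightarrow> X\<close> is an iterated extension of shifts of \<open>P\<close>; dually
  on the other side. Hence every object becomes isomorphic in \<open>T/S\<close> to an object of
  \<open>Z = {X. Hom(X, P[>0]) = 0 = Hom(P, X[>0])}\<close>. Truncating the cone of a denominator shows that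
  \<open>Hom_T(X, Y[i]) = 0\<close> iff \<open>Hom_U(X, Y[i]) = 0\<close> for \<open>X, Y \<in> Z\<close> and \<open>i > 0\<close>. As silting subcategories of \<open>T\<close>
  containing \<open>P\<close> lie in \<open>Z\<close>, this gives the presilting condition in both directions and the
  comparison of the orders; generation is compared through the correspondence between thick
  subcategories of \<open>T\<close> containing \<open>S\<close> and those of \<open>T/S\<close>. A silting subcategory \<open>N\<close> of \<open>T/S\<close> lifts to
  the set of objects of \<open>Z\<close> that lie in \<open>add N\<close> there.

  That \<open>\<ge>\<close> is a partial order is needed only in \<open>T\<close>: it is transported along the bijection, so that
  \<open>T/S\<close> is only shown to be an additive category with shift, not a triangulated one.
\<close>

section \<open>Additive categories with shift\<close>

text \<open>The quotient keeps the objects of \<open>T\<close>, so a silting subcategory and its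
  image are one and the same set; what changes is the Hom sets, the isomorphisms and the closures
  built from them. Every comparison is between two predicates on the same sets of objects, and of
  Hom only the vanishing is compared.

  The degree makes the comparison work. If \<open>Y\<close> lies in \<open>Z\<close> and
  \<open>i > 0\<close>, then \<open>P[j]\<close> has no nonzero map to \<open>Y[i]\<close> for all
  \<open>j \<le> 0\<close>, one degree more than for \<open>Y\<close> itself. A denominator into
  \<open>X\<close> can then be refined until neither its cone nor that cone shifted by -1 has a
  nonzero map to \<open>Y[i]\<close>; the first gives faithfulness on \<open>Hom(X, Y[i])\<close>,
  the second fullness. For \<open>i = 0\<close> this must fail: nonzero objects of \<open>P\<close>
  lie in \<open>Z\<close> and become zero in \<open>U\<close>.

  Since the order is also reflected, injectivity on classes needs no description of additive hulls
  in \<open>U\<close>: it follows from antisymmetry in \<open>T\<close>.\<close>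

definition hom0 :: "('o, 'a, 'b) shift_cat_scheme \<Rightarrow> 'o \<Rightarrow> 'o \<Rightarrow> bool" where
  "hom0 T X Y \<longleftrightarrow> (\<forall>f \<in> Hom T X Y. f = mzero T X Y)"

text \<open>Summands are handled through a section and a retraction, since these compose without a
  choice of complements; in a triangulated category a complement can be recovered
  (\<open>retract_direct_sum\<close>).\<close>

definition retract :: "('o, 'a, 'b) shift_cat_scheme \<Rightarrow> 'o \<Rightarrow> 'o \<Rightarrow> bool" where
  "retract T X Y \<longleftrightarrow> (\<exists>i \<in> Hom T X Y. \<exists>p \<in> Hom T Y X. X \<in> obj T \<and> p \<cdot>\<^bsub>T\<^esub> i = idt T X)"

lemma in_Hom [simp]: "f \<in> Hom T X Y \<longleftrightarrow> f \<in> arr T \<and> src T f = X \<and> tgt T f = Y"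
  by (simp add: Hom_def)

lemma is_isoI:
  "\<lbrakk>f \<in> Hom T X Y; g \<in> Hom T Y X; g \<cdot>\<^bsub>T\<^esub> f = idt T X; f \<cdot>\<^bsub>T\<^esub> g = idt T Y\<rbrakk> \<Longrightarrow> is_iso T f"
  by (auto simp: is_iso_def)

context additive_category
begin

lemma src_obj [simp]: "f \<in> arr T \<Longrightarrow> src T f \<in> obj T"
  and tgt_obj [simp]: "f \<in> arr T \<Longrightarrow> tgt T f \<in> obj T"
  using src_tgt_obj by auto

lemma idt_arr [simp]: "X \<in> obj T \<Longrightarrow> idt T X \<in> arr T"
  and src_idt [simp]: "X \<in> obj T \<Longrightarrow> src T (idt T X) = X"
  and tgt_idt [simp]: "X \<in> obj T \<Longrightarrow> tgt T (idt T X) = X"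
  using idt_hom by auto

lemma comp_arr [simp]: "\<lbrakk>f \<in> arr T; g \<in> arr T; src T g = tgt T f\<rbrakk> \<Longrightarrow> g \<cdot> f \<in> arr T"
  and src_comp [simp]: "\<lbrakk>f \<in> arr T; g \<in> arr T; src T g = tgt T f\<rbrakk> \<Longrightarrow> src T (g \<cdot> f) = src T f"
  and tgt_comp [simp]: "\<lbrakk>f \<in> arr T; g \<in> arr T; src T g = tgt T f\<rbrakk> \<Longrightarrow> tgt T (g \<cdot> f) = tgt T g"
  using comp_hom[of f "src T f" "tgt T f" g "tgt T g"] by auto

lemma assoc [simp]:
  "\<lbrakk>f \<in> arr T; g \<in> arr T; h \<in> arr T; src T g = tgt T f; src T h = tgt T g\<rbrakk>
    \<Longrightarrow> (h \<cdot> g) \<cdot> f = h \<cdot> (g \<cdot> f)"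
  using comp_assoc[of f "src T f" "tgt T f" g "tgt T g" h "tgt T h"] by auto

lemma comp_idt_right [simp]: "\<lbrakk>f \<in> arr T; src T f = X\<rbrakk> \<Longrightarrow> f \<cdot> idt T X = f"
  and comp_idt_left [simp]: "\<lbrakk>f \<in> arr T; tgt T f = X\<rbrakk> \<Longrightarrow> idt T X \<cdot> f = f"
  using comp_idt[of f "src T f" "tgt T f"] by auto

lemma mzero_Hom: "\<lbrakk>X \<in> obj T; Y \<in> obj T\<rbrakk> \<Longrightarrow> mzero T X Y \<in> Hom T X Y"
  using monoid.one_closed[of "hom_group T X Y"] hom_comm_group[of X Y]
  by (simp add: hom_group_def comm_group_def group_def)

lemma mzero_arr [simp]: "\<lbrakk>X \<in> obj T; Y \<in> obj T\<rbrakk> \<Longrightarrow> mzero T X Y \<in> arr T"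
  and src_mzero [simp]: "\<lbrakk>X \<in> obj T; Y \<in> obj T\<rbrakk> \<Longrightarrow> src T (mzero T X Y) = X"
  and tgt_mzero [simp]: "\<lbrakk>X \<in> obj T; Y \<in> obj T\<rbrakk> \<Longrightarrow> tgt T (mzero T X Y) = Y"
  using mzero_Hom by auto

lemma madd_Hom: "\<lbrakk>f \<in> Hom T X Y; g \<in> Hom T X Y\<rbrakk> \<Longrightarrow> madd T f g \<in> Hom T X Y"
proof -
  assume *: "f \<in> Hom T X Y" "g \<in> Hom T X Y"
  then interpret comm_group "hom_group T X Y" using hom_comm_group by auto
  from * show ?thesis using m_closed[of f g] by (simp add: hom_group_def)
qed

lemma madd_arr [simp]:
    "\<lbrakk>f \<in> arr T; g \<in> arr T; src T f = src T g; tgt T f = tgt T g\<rbrakk> \<Longrightarrow> madd T f g \<in> arr T"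
  and src_madd [simp]:
    "\<lbrakk>f \<in> arr T; g \<in> arr T; src T f = src T g; tgt T f = tgt T g\<rbrakk> \<Longrightarrow> src T (madd T f g) = src T g"
  and tgt_madd [simp]:
    "\<lbrakk>f \<in> arr T; g \<in> arr T; src T f = src T g; tgt T f = tgt T g\<rbrakk> \<Longrightarrow> tgt T (madd T f g) = tgt T g"
  using madd_Hom[of f "src T g" "tgt T g" g] by auto

lemma madd_comm:
  "\<lbrakk>f \<in> arr T; g \<in> arr T; src T f = src T g; tgt T f = tgt T g\<rbrakk> \<Longrightarrow> madd T f g = madd T g f"
proof -
  assume *: "f \<in> arr T" "g \<in> arr T" "src T f = src T g" "tgt T f = tgt T g"
  then interpret comm_group "hom_group T (src T g) (tgt T g)" using hom_comm_group by auto
  from * show ?thesis using m_comm[of f g] by (simp add: hom_group_def)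
qed

lemma madd_assoc:
  "\<lbrakk>f \<in> arr T; g \<in> arr T; h \<in> arr T; src T f = src T g; tgt T f = tgt T g; src T h = src T g;
    tgt T h = tgt T g\<rbrakk> \<Longrightarrow> madd T (madd T f g) h = madd T f (madd T g h)"
proof -
  assume *: "f \<in> arr T" "g \<in> arr T" "h \<in> arr T" "src T f = src T g" "tgt T f = tgt T g"
    "src T h = src T g" "tgt T h = tgt T g"
  then interpret comm_group "hom_group T (src T g) (tgt T g)" using hom_comm_group by auto
  from * show ?thesis using m_assoc[of f g h] by (simp add: hom_group_def)
qed

lemma madd_0_left [simp]: "\<lbrakk>f \<in> arr T; src T f = X; tgt T f = Y\<rbrakk> \<Longrightarrow> madd T (mzero T X Y) f = f"
proof -
  assume *: "f \<in> arr T" "src T f = X" "tgt T f = Y"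
  then interpret comm_group "hom_group T X Y" using hom_comm_group by auto
  from * show ?thesis using l_one[of f] by (simp add: hom_group_def)
qed

lemma madd_0_right [simp]: "\<lbrakk>f \<in> arr T; src T f = X; tgt T f = Y\<rbrakk> \<Longrightarrow> madd T f (mzero T X Y) = f"
  using madd_comm[of f "mzero T X Y"] madd_0_left[of f X Y] by auto

lemma mneg_aux:
  assumes "f \<in> arr T"
  shows "mneg T f \<in> Hom T (src T f) (tgt T f)" "madd T f (mneg T f) = mzero T (src T f) (tgt T f)"
proof -
  interpret comm_group "hom_group T (src T f) (tgt T f)" using hom_comm_group assms by auto
  have f: "f \<in> carrier (hom_group T (src T f) (tgt T f))" using assms by (simp add: hom_group_def)
  show "mneg T f \<in> Hom T (src T f) (tgt T f)"
    using inv_closed[OF f] by (simp add: hom_group_def mneg_def)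
  show "madd T f (mneg T f) = mzero T (src T f) (tgt T f)"
    using r_inv[OF f] by (simp add: hom_group_def mneg_def)
qed

lemma mneg_arr [simp]: "f \<in> arr T \<Longrightarrow> mneg T f \<in> arr T"
  and src_mneg [simp]: "f \<in> arr T \<Longrightarrow> src T (mneg T f) = src T f"
  and tgt_mneg [simp]: "f \<in> arr T \<Longrightarrow> tgt T (mneg T f) = tgt T f"
  using mneg_aux by auto

lemma madd_mneg [simp]: "f \<in> arr T \<Longrightarrow> madd T f (mneg T f) = mzero T (src T f) (tgt T f)"
  using mneg_aux by auto

lemma mneg_madd [simp]: "f \<in> arr T \<Longrightarrow> madd T (mneg T f) f = mzero T (src T f) (tgt T f)"
  using madd_comm[of f "mneg T f"] by simp

lemma mneg_unique:
  assumes "f \<in> arr T" "g \<in> arr T" "src T g = src T f" "tgt T g = tgt T f"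
    "madd T f g = mzero T (src T f) (tgt T f)"
  shows "g = mneg T f"
proof -
  have "g = madd T (madd T (mneg T f) f) g" using assms by simp
  also have "\<dots> = madd T (mneg T f) (madd T f g)" using assms by (subst madd_assoc) auto
  also have "\<dots> = mneg T f" using assms by simp
  finally show ?thesis .
qed

lemma mneg_mneg [simp]: "f \<in> arr T \<Longrightarrow> mneg T (mneg T f) = f"
  using mneg_unique[of "mneg T f" f] by simp

lemma eq_if_diff_0:
  assumes "f \<in> arr T" "g \<in> arr T" "src T g = src T f" "tgt T g = tgt T f"
    "madd T f (mneg T g) = mzero T (src T f) (tgt T f)"
  shows "f = g"
proof -
  have "mneg T g = mneg T f" using assms by (intro mneg_unique) auto
  then show ?thesis using assms mneg_mneg by metis
qed

lemma comp_madd_right: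
  "\<lbrakk>f \<in> arr T; f' \<in> arr T; g \<in> arr T; src T f = src T f'; tgt T f = tgt T f'; src T g = tgt T f'\<rbrakk>
    \<Longrightarrow> g \<cdot> madd T f f' = madd T (g \<cdot> f) (g \<cdot> f')"
  using comp_add_right[of f "src T f" "tgt T f" f' g "tgt T g"] by auto

lemma comp_madd_left:
  "\<lbrakk>g \<in> arr T; g' \<in> arr T; f \<in> arr T; src T g = src T g'; tgt T g = tgt T g'; src T g' = tgt T f\<rbrakk>
    \<Longrightarrow> madd T g g' \<cdot> f = madd T (g \<cdot> f) (g' \<cdot> f)"
  using comp_add_left[of f "src T f" "tgt T f" g "tgt T g" g'] by auto

text \<open>An additive operation sends \<open>0 = 0 + 0\<close> to an idempotent of a Hom group;
  this turns additivity of composition, and later of the shift, into preservation of zero.\<close>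

lemma madd_idem_0:
  assumes "f \<in> arr T" "madd T f f = f" shows "f = mzero T (src T f) (tgt T f)"
proof -
  have "f = madd T f (madd T f (mneg T f))" using assms by simp
  also have "\<dots> = madd T (madd T f f) (mneg T f)" using assms by (subst madd_assoc) auto
  also have "\<dots> = mzero T (src T f) (tgt T f)" using assms by simp
  finally show ?thesis .
qed

lemma comp_0_right [simp]:
  "\<lbrakk>X \<in> obj T; g \<in> arr T; src T g = Y\<rbrakk> \<Longrightarrow> g \<cdot> mzero T X Y = mzero T X (tgt T g)"
  using madd_idem_0[of "g \<cdot> mzero T X Y"] comp_madd_right[of "mzero T X Y" "mzero T X Y" g] by auto

lemma comp_0_left [simp]:
  "\<lbrakk>Z \<in> obj T; f \<in> arr T; tgt T f = Y\<rbrakk> \<Longrightarrow> mzero T Y Z \<cdot> f = mzero T (src T f) Z"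
  using madd_idem_0[of "mzero T Y Z \<cdot> f"] comp_madd_left[of "mzero T Y Z" "mzero T Y Z" f] by auto

lemma comp_mneg_right [simp]:
  assumes "f \<in> arr T" "g \<in> arr T" "src T g = tgt T f"
  shows "g \<cdot> mneg T f = mneg T (g \<cdot> f)"
  using mneg_unique[of "g \<cdot> f" "g \<cdot> mneg T f"] comp_madd_right[of f "mneg T f" g] assms by auto

lemma comp_mneg_left [simp]:
  assumes "f \<in> arr T" "g \<in> arr T" "src T g = tgt T f"
  shows "mneg T g \<cdot> f = mneg T (g \<cdot> f)"
  using mneg_unique[of "g \<cdot> f" "mneg T g \<cdot> f"] comp_madd_left[of g "mneg T g" f] assms by auto

lemma mneg_0 [simp]: "\<lbrakk>X \<in> obj T; Y \<in> obj T\<rbrakk> \<Longrightarrow> mneg T (mzero T X Y) = mzero T X Y"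
  using mneg_unique[of "mzero T X Y" "mzero T X Y"] by auto

section \<open>Isomorphisms, retracts, direct sums and additive hulls\<close>

lemma isomorphicI:
  "\<lbrakk>f \<in> Hom T X Y; g \<in> Hom T Y X; g \<cdot> f = idt T X; f \<cdot> g = idt T Y\<rbrakk> \<Longrightarrow> isomorphic T X Y"
  using is_isoI[of f T X Y g] unfolding isomorphic_def by blast

lemma isomorphicE:
  assumes "isomorphic T X Y"
  obtains f g where "f \<in> Hom T X Y" "g \<in> Hom T Y X" "g \<cdot> f = idt T X" "f \<cdot> g = idt T Y"
  using assms by (auto simp: isomorphic_def is_iso_def)

lemma isomorphic_refl: "X \<in> obj T \<Longrightarrow> isomorphic T X X"
  by (rule isomorphicI[of "idt T X" _ _ "idt T X"]) auto

lemma isomorphic_sym: "isomorphic T X Y \<Longrightarrow> isomorphic T Y X"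
  by (elim isomorphicE, rule isomorphicI) auto

lemma inverse_comp:
  assumes "f \<in> arr T" "g \<in> arr T" "f' \<in> arr T" "g' \<in> arr T" "tgt T f = src T g"
    "src T f' = tgt T f" "src T g' = tgt T g" "tgt T f' = src T f" "tgt T g' = src T g"
    "f' \<cdot> f = idt T (src T f)" "g' \<cdot> g = idt T (src T g)"
  shows "(f' \<cdot> g') \<cdot> (g \<cdot> f) = idt T (src T f)"
proof -
  have "(f' \<cdot> g') \<cdot> (g \<cdot> f) = f' \<cdot> ((g' \<cdot> g) \<cdot> f)" using assms(1-9) by simp
  then show ?thesis using assms by simp
qed

lemma isomorphic_trans:
  assumes "isomorphic T X Y" "isomorphic T Y Z" shows "isomorphic T X Z"
proof -
  obtain f f' where f: "f \<in> Hom T X Y" "f' \<in> Hom T Y X" "f' \<cdot> f = idt T X" "f \<cdot> f' = idt T Y"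
    using assms(1) by (rule isomorphicE)
  obtain g g' where g: "g \<in> Hom T Y Z" "g' \<in> Hom T Z Y" "g' \<cdot> g = idt T Y" "g \<cdot> g' = idt T Z"
    using assms(2) by (rule isomorphicE)
  show ?thesis
    by (rule isomorphicI[of "g \<cdot> f" _ _ "f' \<cdot> g'"])
      (use f g inverse_comp[of f g f' g'] inverse_comp[of g' f' g f] in auto)
qed

lemma isomorphic_obj: "isomorphic T X Y \<Longrightarrow> X \<in> obj T \<and> Y \<in> obj T"
  by (auto simp: isomorphic_def)

lemma retractI: "\<lbrakk>i \<in> Hom T X Y; p \<in> Hom T Y X; p \<cdot> i = idt T X\<rbrakk> \<Longrightarrow> retract T X Y"
  unfolding retract_def by (rule bexI[of _ i], rule bexI[of _ p]) auto

lemma isomorphic_retract: "isomorphic T X Y \<Longrightarrow> retract T X Y"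
  by (elim isomorphicE) (auto intro: retractI simp del: in_Hom)

lemma retract_obj: "retract T X Y \<Longrightarrow> X \<in> obj T \<and> Y \<in> obj T"
  by (auto simp: retract_def)

lemma retract_refl: "X \<in> obj T \<Longrightarrow> retract T X X"
  using isomorphic_refl isomorphic_retract by auto

lemma retract_trans:
  assumes "retract T X Y" "retract T Y Z" shows "retract T X Z"
proof -
  obtain i p where f: "i \<in> Hom T X Y" "p \<in> Hom T Y X" "X \<in> obj T" "p \<cdot> i = idt T X"
    using assms(1) by (auto simp: retract_def)
  obtain j q where g: "j \<in> Hom T Y Z" "q \<in> Hom T Z Y" "Y \<in> obj T" "q \<cdot> j = idt T Y"
    using assms(2) by (auto simp: retract_def)
  have "j \<cdot> i \<in> Hom T X Z" "p \<cdot> q \<in> Hom T Z X" "(p \<cdot> q) \<cdot> (j \<cdot> i) = idt T X"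
    using f g inverse_comp[of i j p q] by auto
  then show ?thesis unfolding retract_def using f by blast
qed

text \<open>The inclusions guarantee that the zero arrow lies in each Hom set, so the equation with
  a singleton reduces to a statement on single arrows.\<close>

lemma hom_vanish_iff:
  "\<lbrakk>A \<subseteq> obj T; B \<subseteq> obj T\<rbrakk> \<Longrightarrow> hom_vanish T A B \<longleftrightarrow> (\<forall>X\<in>A. \<forall>Y\<in>B. hom0 T X Y)"
  by (force simp: hom_vanish_def hom0_def)

lemma hom0D: "\<lbrakk>hom0 T X Y; f \<in> arr T; src T f = X; tgt T f = Y\<rbrakk> \<Longrightarrow> f = mzero T X Y"
  by (auto simp: hom0_def)

lemma hom0_retract_left:
  assumes "retract T X X'" "hom0 T X' Y" shows "hom0 T X Y"
  unfolding hom0_def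
proof
  fix f assume f: "f \<in> Hom T X Y"
  obtain i p where i: "i \<in> Hom T X X'" "p \<in> Hom T X' X" "X \<in> obj T" "p \<cdot> i = idt T X"
    using assms(1) by (auto simp: retract_def)
  have "f \<cdot> p = mzero T X' Y" by (rule hom0D[OF assms(2)]) (use f i in auto)
  then have *: "f \<cdot> p = mzero T X' Y" .
  have "f = f \<cdot> (p \<cdot> i)" using f i by auto
  also have "\<dots> = (f \<cdot> p) \<cdot> i" using f i(1,2) by auto
  also have "\<dots> = mzero T X Y" unfolding * using f i by auto
  finally show "f = mzero T X Y" .
qed

lemma hom0_retract_right:
  assumes "retract T Y Y'" "hom0 T X Y'" shows "hom0 T X Y"
  unfolding hom0_def
proof
  fix f assume f: "f \<in> Hom T X Y"
  obtain i p where i: "i \<in> Hom T Y Y'" "p \<in> Hom T Y' Y" "Y \<in> obj T" "p \<cdot> i = idt T Y"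
    using assms(1) by (auto simp: retract_def)
  have *: "i \<cdot> f = mzero T X Y'" by (rule hom0D[OF assms(2)]) (use f i in auto)
  have "f = (p \<cdot> i) \<cdot> f" using f i by auto
  also have "\<dots> = p \<cdot> (i \<cdot> f)" using f i(1,2) by auto
  also have "\<dots> = mzero T X Y" unfolding * using f i by auto
  finally show "f = mzero T X Y" .
qed

lemma zero_objectI: "\<lbrakk>Z \<in> obj T; idt T Z = mzero T Z Z\<rbrakk> \<Longrightarrow> zero_object T Z"
  unfolding zero_object_def
proof (intro conjI ballI, assumption)
  fix X assume X: "X \<in> obj T" and Z: "Z \<in> obj T" "idt T Z = mzero T Z Z"
  have "f = mzero T X Z" if "f \<in> Hom T X Z" for f
    using that Z X comp_idt_left[of f Z] by auto
  then show "Hom T X Z = {mzero T X Z}" using X Z by (auto simp del: in_Hom intro: mzero_Hom)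
  have "f = mzero T Z X" if "f \<in> Hom T Z X" for f
    using that Z X comp_idt_right[of f Z] by auto
  then show "Hom T Z X = {mzero T Z X}" using X Z by (auto simp del: in_Hom intro: mzero_Hom)
qed

lemma zero_objectD:
  assumes "zero_object T Z"
  shows "Z \<in> obj T" "idt T Z = mzero T Z Z" "X \<in> obj T \<Longrightarrow> hom0 T X Z" "X \<in> obj T \<Longrightarrow> hom0 T Z X"
  using assms idt_hom[of Z] by (auto simp: zero_object_def hom0_def simp del: in_Hom)

lemma direct_sumE:
  assumes "direct_sum T X Y S"
  obtains i j p q where "i \<in> Hom T X S" "j \<in> Hom T Y S" "p \<in> Hom T S X" "q \<in> Hom T S Y"
    "p \<cdot> i = idt T X" "q \<cdot> j = idt T Y" "q \<cdot> i = mzero T X Y" "p \<cdot> j = mzero T Y X"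
    "madd T (i \<cdot> p) (j \<cdot> q) = idt T S"
  using assms unfolding direct_sum_def by blast

lemma direct_sumI:
  assumes "i \<in> Hom T X S" "j \<in> Hom T Y S" "p \<in> Hom T S X" "q \<in> Hom T S Y"
    "p \<cdot> i = idt T X" "q \<cdot> j = idt T Y" "q \<cdot> i = mzero T X Y" "p \<cdot> j = mzero T Y X"
    "madd T (i \<cdot> p) (j \<cdot> q) = idt T S"
  shows "direct_sum T X Y S"
  using assms unfolding direct_sum_def by blast

lemma direct_sum_commute:
  assumes "direct_sum T X Y S" shows "direct_sum T Y X S"
proof -
  obtain i j p q where *: "i \<in> Hom T X S" "j \<in> Hom T Y S" "p \<in> Hom T S X" "q \<in> Hom T S Y"
    "p \<cdot> i = idt T X" "q \<cdot> j = idt T Y" "q \<cdot> i = mzero T X Y" "p \<cdot> j = mzero T Y X"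
    "madd T (i \<cdot> p) (j \<cdot> q) = idt T S" using assms by (rule direct_sumE)
  have "madd T (j \<cdot> q) (i \<cdot> p) = idt T S"
    using * madd_comm[of "j \<cdot> q" "i \<cdot> p"] by auto
  with * show ?thesis by (intro direct_sumI[of j _ _ i _ q p]) auto
qed

lemma direct_sum_retract: "direct_sum T X Y S \<Longrightarrow> retract T X S"
  by (elim direct_sumE) (rule retractI)

lemma hom0_direct_sum_left:
  assumes "direct_sum T X Y S" "hom0 T X A" "hom0 T Y A" shows "hom0 T S A"
  unfolding hom0_def
proof
  fix f assume f: "f \<in> Hom T S A"
  obtain i j p q where *: "i \<in> Hom T X S" "j \<in> Hom T Y S" "p \<in> Hom T S X" "q \<in> Hom T S Y"
    and s: "madd T (i \<cdot> p) (j \<cdot> q) = idt T S" using assms(1) by (rule direct_sumE)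
  have 1: "f \<cdot> i = mzero T X A" by (rule hom0D[OF assms(2)]) (use f * in auto)
  have 2: "f \<cdot> j = mzero T Y A" by (rule hom0D[OF assms(3)]) (use f * in auto)
  have "f = f \<cdot> idt T S" using f by simp
  also have "\<dots> = madd T ((f \<cdot> i) \<cdot> p) ((f \<cdot> j) \<cdot> q)"
    unfolding s[symmetric] using f * by (auto simp: comp_madd_right)
  also have "\<dots> = mzero T S A" unfolding 1 2 using f * by auto
  finally show "f = mzero T S A" .
qed

lemma hom0_direct_sum_right:
  assumes "direct_sum T X Y S" "hom0 T A X" "hom0 T A Y" shows "hom0 T A S"
  unfolding hom0_def
proof
  fix f assume f: "f \<in> Hom T A S"
  obtain i j p q where *: "i \<in> Hom T X S" "j \<in> Hom T Y S" "p \<in> Hom T S X" "q \<in> Hom T S Y"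
    and s: "madd T (i \<cdot> p) (j \<cdot> q) = idt T S" using assms(1) by (rule direct_sumE)
  have 1: "p \<cdot> f = mzero T A X" by (rule hom0D[OF assms(2)]) (use f * in auto)
  have 2: "q \<cdot> f = mzero T A Y" by (rule hom0D[OF assms(3)]) (use f * in auto)
  have "f = idt T S \<cdot> f" using f by simp
  also have "\<dots> = madd T (i \<cdot> (p \<cdot> f)) (j \<cdot> (q \<cdot> f))"
    unfolding s[symmetric] using f * by (auto simp: comp_madd_left)
  also have "\<dots> = mzero T A S" unfolding 1 2 using f * by auto
  finally show "f = mzero T A S" .
qed

text \<open>The comparison maps go through the summands and are mutually inverse by the biproduct
  equations. Needed in the quotient, where a direct sum of two objects is matched with one that
  already exists in \<open>T\<close>.\<close>

lemma direct_sum_unique: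
  assumes "direct_sum T X Y S" "direct_sum T X Y S'" shows "isomorphic T S S'"
proof -
  obtain i j p q where 1: "i \<in> Hom T X S" "j \<in> Hom T Y S" "p \<in> Hom T S X" "q \<in> Hom T S Y"
    and e1: "p \<cdot> i = idt T X" "q \<cdot> j = idt T Y" "q \<cdot> i = mzero T X Y" "p \<cdot> j = mzero T Y X"
    "madd T (i \<cdot> p) (j \<cdot> q) = idt T S" using assms(1) by (rule direct_sumE)
  obtain i' j' p' q' where 2: "i' \<in> Hom T X S'" "j' \<in> Hom T Y S'" "p' \<in> Hom T S' X" "q' \<in> Hom T S' Y"
    and e2: "p' \<cdot> i' = idt T X" "q' \<cdot> j' = idt T Y" "q' \<cdot> i' = mzero T X Y" "p' \<cdot> j' = mzero T Y X"
    "madd T (i' \<cdot> p') (j' \<cdot> q') = idt T S'" using assms(2) by (rule direct_sumE)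
  \<comment> \<open>Formulated for two arbitrary diagrams, so that one computation yields both
    composites with the roles exchanged.\<close>
  have aux: "madd T (k \<cdot> r') (l \<cdot> s') \<cdot> madd T (k' \<cdot> r) (l' \<cdot> s) = idt T V"
    if 1: "k \<in> Hom T X V" "l \<in> Hom T Y V" "r \<in> Hom T V X" "s \<in> Hom T V Y"
      and e: "madd T (k \<cdot> r) (l \<cdot> s) = idt T V"
      and 2: "k' \<in> Hom T X V'" "l' \<in> Hom T Y V'" "r' \<in> Hom T V' X" "s' \<in> Hom T V' Y"
      and e': "r' \<cdot> k' = idt T X" "s' \<cdot> l' = idt T Y" "s' \<cdot> k' = mzero T X Y" "r' \<cdot> l' = mzero T Y X"
    for k l r s V k' l' r' s' V'
  proof -
    have "r' \<cdot> madd T (k' \<cdot> r) (l' \<cdot> s) = madd T ((r' \<cdot> k') \<cdot> r) ((r' \<cdot> l') \<cdot> s)"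
      using 1 2 by (auto simp: comp_madd_right)
    then have a: "r' \<cdot> madd T (k' \<cdot> r) (l' \<cdot> s) = r" unfolding e' using 1 2 by auto
    have "s' \<cdot> madd T (k' \<cdot> r) (l' \<cdot> s) = madd T ((s' \<cdot> k') \<cdot> r) ((s' \<cdot> l') \<cdot> s)"
      using 1 2 by (auto simp: comp_madd_right)
    then have b: "s' \<cdot> madd T (k' \<cdot> r) (l' \<cdot> s) = s" unfolding e' using 1 2 by auto
    have "madd T (k \<cdot> r') (l \<cdot> s') \<cdot> madd T (k' \<cdot> r) (l' \<cdot> s)
      = madd T (k \<cdot> (r' \<cdot> madd T (k' \<cdot> r) (l' \<cdot> s))) (l \<cdot> (s' \<cdot> madd T (k' \<cdot> r) (l' \<cdot> s)))"
      using 1 2 by (auto simp: comp_madd_left)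
    then show ?thesis unfolding a b e .
  qed
  show ?thesis
    by (rule isomorphicI[of "madd T (i' \<cdot> p) (j' \<cdot> q)" _ _ "madd T (i \<cdot> p') (j \<cdot> q')"])
      (use 1 2 aux[OF 1 e1(5) 2 e2(1-4)] aux[OF 2 e2(5) 1 e1(1-4)] in auto)
qed

lemma add_hull_superset: "A \<subseteq> add_hull T A"
  by (auto simp: add_hull_def)

lemma add_hull_least:
  "\<lbrakk>A \<subseteq> N; N \<subseteq> obj T; iso_closed T N; sum_closed T N; summand_closed T N\<rbrakk> \<Longrightarrow> add_hull T A \<subseteq> N"
  by (auto simp: add_hull_def)

lemma add_hull_obj: "A \<subseteq> obj T \<Longrightarrow> add_hull T A \<subseteq> obj T"
  by (rule add_hull_least) (auto simp: iso_closed_def sum_closed_def summand_closed_def zero_object_def)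

lemma add_hull_closed:
  "iso_closed T (add_hull T A)" "sum_closed T (add_hull T A)" "summand_closed T (add_hull T A)"
  unfolding iso_closed_def sum_closed_def summand_closed_def add_hull_def by blast+

lemma add_hull_iso: "\<lbrakk>X \<in> add_hull T A; isomorphic T X Y\<rbrakk> \<Longrightarrow> Y \<in> add_hull T A"
  using add_hull_closed(1)[of A] isomorphic_obj unfolding iso_closed_def by blast

lemma add_hull_subset: "\<lbrakk>B \<subseteq> obj T; A \<subseteq> add_hull T B\<rbrakk> \<Longrightarrow> add_hull T A \<subseteq> add_hull T B"
  by (intro add_hull_least add_hull_closed add_hull_obj)

text \<open>The objects without nonzero maps to \<open>Y\<close> are closed under isomorphisms,
  finite sums and summands.\<close>

lemma hom0_add_hull_left:
  assumes "A \<subseteq> obj T" "Y \<in> obj T" "\<And>X. X \<in> A \<Longrightarrow> hom0 T X Y" "X \<in> add_hull T A"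
  shows "hom0 T X Y"
proof -
  have "add_hull T A \<subseteq> {X \<in> obj T. hom0 T X Y}"
    by (rule add_hull_least)
      (use assms(1-3) in \<open>auto simp: iso_closed_def sum_closed_def summand_closed_def zero_objectD
        intro: hom0_retract_left hom0_direct_sum_left isomorphic_retract isomorphic_sym
        direct_sum_retract\<close>)
  then show ?thesis using assms by auto
qed

lemma hom0_add_hull_right:
  assumes "A \<subseteq> obj T" "Y \<in> obj T" "\<And>X. X \<in> A \<Longrightarrow> hom0 T Y X" "X \<in> add_hull T A"
  shows "hom0 T Y X"
proof -
  have "add_hull T A \<subseteq> {X \<in> obj T. hom0 T Y X}"
    by (rule add_hull_least)
      (use assms(1-3) in \<open>auto simp: iso_closed_def sum_closed_def summand_closed_def zero_objectD
        intro: hom0_retract_right hom0_direct_sum_right isomorphic_retract isomorphic_sym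
        direct_sum_retract\<close>)
  then show ?thesis using assms by auto
qed

end

text \<open>The common ground of \<open>T\<close> and its quotient: hulls, shifts and vanishing of
  Hom are treated here once and used for both. Bijectivity of the shift on objects and on Hom sets
  suffices to move vanishing of Hom along shifts.\<close>

locale shift_additive_category = additive_category +
  assumes shift_sho_bij: "bij_betw (sho T) (obj T) (obj T)"
    and shift_sha_bij: "\<lbrakk>X \<in> obj T; Y \<in> obj T\<rbrakk>
           \<Longrightarrow> bij_betw (sha T) (Hom T X Y) (Hom T (sho T X) (sho T Y))"
begin

lemma sho_obj [simp]: "X \<in> obj T \<Longrightarrow> sho T X \<in> obj T"
  using shift_sho_bij by (auto simp: bij_betw_def)

lemma sho_inj: "\<lbrakk>X \<in> obj T; Y \<in> obj T; sho T X = sho T Y\<rbrakk> \<Longrightarrow> X = Y"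
  using shift_sho_bij by (auto simp: bij_betw_def inj_on_def)

lemma sho_surj: "Y \<in> obj T \<Longrightarrow> \<exists>X \<in> obj T. sho T X = Y"
  using shift_sho_bij unfolding bij_betw_def by (metis imageE)

lemma sha_Hom: "f \<in> Hom T X Y \<Longrightarrow> sha T f \<in> Hom T (sho T X) (sho T Y)"
proof -
  assume f: "f \<in> Hom T X Y"
  then have "X \<in> obj T" "Y \<in> obj T" by auto
  then show ?thesis using f bij_betw_apply[OF shift_sha_bij] by blast
qed

lemma sha_arr [simp]: "f \<in> arr T \<Longrightarrow> sha T f \<in> arr T"
  and src_sha [simp]: "f \<in> arr T \<Longrightarrow> src T (sha T f) = sho T (src T f)"
  and tgt_sha [simp]: "f \<in> arr T \<Longrightarrow> tgt T (sha T f) = sho T (tgt T f)"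
  using sha_Hom[of f "src T f" "tgt T f"] by auto

lemma sha_full:
  "\<lbrakk>f \<in> Hom T (sho T X) (sho T Y); X \<in> obj T; Y \<in> obj T\<rbrakk> \<Longrightarrow> \<exists>g \<in> Hom T X Y. f = sha T g"
  using shift_sha_bij[of X Y] unfolding bij_betw_def by blast

lemma sha_faithful: "\<lbrakk>f \<in> arr T; g \<in> arr T; sha T f = sha T g\<rbrakk> \<Longrightarrow> f = g"
proof -
  assume *: "f \<in> arr T" "g \<in> arr T" "sha T f = sha T g"
  have "src T f = src T g" using * src_sha[of f] src_sha[of g] sho_inj[of "src T f" "src T g"] by simp
  moreover have "tgt T f = tgt T g" using * tgt_sha[of f] tgt_sha[of g] sho_inj[of "tgt T f" "tgt T g"] by simp
  ultimately show ?thesis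
    using * shift_sha_bij[of "src T g" "tgt T g"] by (auto simp: bij_betw_def inj_on_def)
qed

lemma sha_full':
  assumes "f \<in> arr T" shows "\<exists>g \<in> arr T. f = sha T g"
proof -
  obtain X where X: "X \<in> obj T" "sho T X = src T f" using sho_surj[of "src T f"] assms by auto
  obtain Y where Y: "Y \<in> obj T" "sho T Y = tgt T f" using sho_surj[of "tgt T f"] assms by auto
  have "f \<in> Hom T (sho T X) (sho T Y)" using assms X Y by auto
  from sha_full[OF this X(1) Y(1)] show ?thesis by auto
qed

text \<open>Vanishing as having at most one element: in this form it passes along any bijection of
  Hom sets, whether or not zero is known to be preserved.\<close>

lemma hom0_card: "\<lbrakk>X \<in> obj T; Y \<in> obj T\<rbrakk> \<Longrightarrow> hom0 T X Y \<longleftrightarrow> (\<forall>f\<in>Hom T X Y. \<forall>g\<in>Hom T X Y. f = g)"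
  using mzero_Hom[of X Y] unfolding hom0_def by metis

lemma hom0_sho:
  assumes "X \<in> obj T" "Y \<in> obj T"
  shows "hom0 T (sho T X) (sho T Y) \<longleftrightarrow> hom0 T X Y"
proof -
  have b: "bij_betw (sha T) (Hom T X Y) (Hom T (sho T X) (sho T Y))"
    using assms by (rule shift_sha_bij)
  show ?thesis
    unfolding hom0_card[OF assms] hom0_card[OF sho_obj[OF assms(1)] sho_obj[OF assms(2)]]
    using b unfolding bij_betw_def inj_on_def by (smt (verit) image_iff)
qed

section \<open>Integer shifts\<close>

abbreviation sh :: "int \<Rightarrow> 'a \<Rightarrow> 'a" where "sh \<equiv> shift T"

lemma sh_0 [simp]: "sh 0 X = X"
  by (simp add: shift_def)

lemma sho_inv [simp]: "X \<in> obj T \<Longrightarrow> inv_into (obj T) (sho T) X \<in> obj T"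
  using inv_into_into[of X "sho T" "obj T"] shift_sho_bij by (simp add: bij_betw_def)

lemma sho_sho_inv: "X \<in> obj T \<Longrightarrow> sho T (inv_into (obj T) (sho T) X) = X"
  using shift_sho_bij by (intro f_inv_into_f) (simp add: bij_betw_def)

lemma sh_obj [simp]: "X \<in> obj T \<Longrightarrow> sh i X \<in> obj T"
proof -
  have "X \<in> obj T \<Longrightarrow> (sho T ^^ n) X \<in> obj T" for n by (induction n) auto
  moreover have "X \<in> obj T \<Longrightarrow> (inv_into (obj T) (sho T) ^^ n) X \<in> obj T" for n by (induction n) auto
  ultimately show "X \<in> obj T \<Longrightarrow> sh i X \<in> obj T" by (simp add: shift_def)
qed

lemma sh_Suc: assumes "X \<in> obj T" shows "sh (i + 1) X = sho T (sh i X)"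
proof (cases "0 \<le> i")
  case True
  then show ?thesis by (simp add: shift_def nat_add_distrib)
next
  case False
  then obtain n where n: "nat (- i) = Suc n" by (metis neg_0_less_iff_less not_le not0_implies_Suc zero_less_nat_eq less_numeral_extra(3))
  have o: "(inv_into (obj T) (sho T) ^^ n) X \<in> obj T" for n by (induction n) (use assms in auto)
  \<comment> \<open>For \<open>i = -1\<close> the left side already falls into the nonnegative
    branch of \<open>shift\<close>; there \<open>n = 0\<close>, and both branches give
    \<open>X\<close>.\<close>
  have "nat (- (i + 1)) = n" using n by auto
  then have "sh (i + 1) X = (inv_into (obj T) (sho T) ^^ n) X"
    using n False by (auto simp: shift_def)
  moreover have "sh i X = inv_into (obj T) (sho T) ((inv_into (obj T) (sho T) ^^ n) X)"
    using n False by (simp add: shift_def)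
  ultimately show ?thesis using sho_sho_inv[OF o] by simp
qed

lemma sh_1 [simp]: "X \<in> obj T \<Longrightarrow> sh 1 X = sho T X"
  using sh_Suc[of X 0] by simp

lemma sh_add: assumes "X \<in> obj T" shows "sh i (sh j X) = sh (i + j) X"
proof (induction i rule: int_induct[where k = 0])
  case (step1 i)
  have "sh (i + 1) (sh j X) = sho T (sh (i + j) X)" using step1 sh_Suc assms by simp
  also have "\<dots> = sh (i + j + 1) X" using sh_Suc assms by simp
  finally show ?case by (simp add: algebra_simps)
next
  case (step2 i)
  \<comment> \<open>Downwards, \<open>sho T\<close> is applied to both sides and cancelled by
    injectivity.\<close>
  have "sho T (sh (i - 1) (sh j X)) = sho T (sh (i - 1 + j) X)"
    using step2 sh_Suc[of "sh j X" "i - 1"] sh_Suc[of X "i - 1 + j"] assms by (simp add: algebra_simps)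
  then show ?case by (rule sho_inj[rotated 2]) (use assms in auto)
qed simp

lemma sho_sh: "X \<in> obj T \<Longrightarrow> sho T (sh i X) = sh (i + 1) X"
  by (simp add: sh_Suc)

lemma sh_sho: "X \<in> obj T \<Longrightarrow> sh i (sho T X) = sh (i + 1) X"
  using sh_add[of X i 1] by simp

lemma hom0_sh: assumes "X \<in> obj T" "Y \<in> obj T" shows "hom0 T (sh k X) (sh k Y) \<longleftrightarrow> hom0 T X Y"
proof (induction k rule: int_induct[where k = 0])
  case (step1 i)
  then show ?case using assms by (simp add: sh_Suc hom0_sho)
next
  case (step2 i)
  then show ?case using assms hom0_sho[of "sh (i - 1) X" "sh (i - 1) Y"] by (simp add: sho_sh)
qed simp

lemma hom0_shift: assumes "X \<in> obj T" "Y \<in> obj T"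
  shows "hom0 T (sh k X) (sh l Y) \<longleftrightarrow> hom0 T X (sh (l - k) Y)"
    "hom0 T (sh k X) (sh l Y) \<longleftrightarrow> hom0 T (sh (k - l) X) Y"
  using hom0_sh[of "sh (-k) (sh k X)" "sh (-k) (sh l Y)" k] hom0_sh[of "sh (-l) (sh k X)" "sh (-l) (sh l Y)" l]
  assms by (auto simp: sh_add algebra_simps)

lemma hom0_shift_right: "\<lbrakk>X \<in> obj T; Y \<in> obj T\<rbrakk> \<Longrightarrow> hom0 T X (sh l Y) \<longleftrightarrow> hom0 T (sh (- l) X) Y"
  using hom0_shift(2)[of X Y 0 l] by simp

lemma hom_vanish_shift_iff:
  "\<lbrakk>A \<subseteq> obj T; B \<subseteq> obj T\<rbrakk> \<Longrightarrow> hom_vanish T A (sh i ` B) \<longleftrightarrow> (\<forall>X\<in>A. \<forall>Y\<in>B. hom0 T X (sh i Y))"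
  by (subst hom_vanish_iff) auto

text \<open>The shift is moved to the first argument before the second one ranges over the hull: the
  hull of \<open>B\<close> itself is then the relevant one, and hulls need not be compared with
  their shifts.\<close>

lemma hom_vanish_add_hull:
  assumes "A \<subseteq> obj T" "B \<subseteq> obj T" "hom_vanish T A (sh i ` B)" "A' \<subseteq> add_hull T A" "B' \<subseteq> add_hull T B"
  shows "hom_vanish T A' (sh i ` B')"
proof -
  have obj: "A' \<subseteq> obj T" "B' \<subseteq> obj T" using assms add_hull_obj by blast+
  have 1: "hom0 T X (sh i Y)" if "X \<in> A'" "Y \<in> B" for X Y
    by (rule hom0_add_hull_left[OF assms(1)])
      (use that assms hom_vanish_shift_iff[OF assms(1,2)] in auto)
  have 2: "hom0 T (sh (- i) X) Y" if "X \<in> A'" "Y \<in> B" for X Y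
    using 1[OF that] hom0_shift_right[of X Y i] that obj assms(2) by auto
  have "hom0 T (sh (- i) X) Y" if "X \<in> A'" "Y \<in> B'" for X Y
    by (rule hom0_add_hull_right[OF assms(2)])
      (use that assms(4,5) obj 2 in auto)
  then have "hom0 T X (sh i Y)" if "X \<in> A'" "Y \<in> B'" for X Y
    using hom0_shift_right[of X Y i] that obj by blast
  then show ?thesis unfolding hom_vanish_shift_iff[OF obj] by blast
qed

end

section \<open>Triangles and extension closures\<close>

text \<open>Triangles seen through their three objects. Extension arguments use no more than this,
  and the signs produced by rotation disappear.\<close>

definition tri :: "('o, 'a, 'b) tri_cat_scheme \<Rightarrow> 'o \<Rightarrow> 'o \<Rightarrow> 'o \<Rightarrow> bool" where
  "tri T X Y Z \<longleftrightarrow> (\<exists>u v w. (u, v, w) \<in> dist T \<and> src T u = X \<and> tgt T u = Y \<and> tgt T v = Z)"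

text \<open>The extension closure of \<open>S\<close>; isomorphic copies enter through triangles
  with a zero term.\<close>

inductive_set ext :: "('o, 'a, 'b) tri_cat_scheme \<Rightarrow> 'o set \<Rightarrow> 'o set" for T S where
  ext_zero: "zero_object T Z \<Longrightarrow> Z \<in> ext T S"
| ext_base: "X \<in> S \<Longrightarrow> X \<in> ext T S"
| ext_step: "\<lbrakk>X \<in> ext T S; Z \<in> ext T S; tri T X Y Z\<rbrakk> \<Longrightarrow> Y \<in> ext T S"

definition shs :: "('o, 'a, 'b) shift_cat_scheme \<Rightarrow> 'o set \<Rightarrow> int set \<Rightarrow> 'o set" where
  "shs T M I = (\<Union>i\<in>I. shift T i ` M)"

lemma ext_mono: "A \<subseteq> B \<Longrightarrow> ext T A \<subseteq> ext T B"
proof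
  fix X assume "A \<subseteq> B" "X \<in> ext T A"
  from this(2,1) show "X \<in> ext T B" by induction (auto intro: ext.intros)
qed

lemma shs_mono: "I \<subseteq> J \<Longrightarrow> shs T M I \<subseteq> shs T M J"
  by (auto simp: shs_def)

lemma shs_Un: "shs T M (I \<union> J) = shs T M I \<union> shs T M J"
  by (auto simp: shs_def)

sublocale triangulated_category \<subseteq> shift_additive_category
  by unfold_locales (fact sho_bij, fact sha_bij)

context triangulated_category
begin

lemma sha_comp' [simp]: "\<lbrakk>f \<in> arr T; g \<in> arr T; src T g = tgt T f\<rbrakk> \<Longrightarrow> sha T (g \<cdot> f) = sha T g \<cdot> sha T f"
  using sha_comp[of f "src T f" "tgt T f" g "tgt T g"] by simp

lemma sha_idt' [simp]: "X \<in> obj T \<Longrightarrow> sha T (idt T X) = idt T (sho T X)"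
  by (rule sha_idt)

lemma sha_madd' [simp]: "\<lbrakk>f \<in> arr T; g \<in> arr T; src T f = src T g; tgt T f = tgt T g\<rbrakk>
    \<Longrightarrow> sha T (madd T f g) = madd T (sha T f) (sha T g)"
  using sha_add[of f "src T g" "tgt T g" g] by simp

lemma sha_0 [simp]: assumes "X \<in> obj T" "Y \<in> obj T"
  shows "sha T (mzero T X Y) = mzero T (sho T X) (sho T Y)"
  using madd_idem_0[of "sha T (mzero T X Y)"] sha_madd'[of "mzero T X Y" "mzero T X Y"] assms by simp

lemma sha_mneg [simp]: assumes "f \<in> arr T" shows "sha T (mneg T f) = mneg T (sha T f)"
  by (rule mneg_unique) (use assms sha_madd'[of f "mneg T f"] in auto)

lemma distD:
  assumes "(u, v, w) \<in> dist T"
  shows "u \<in> arr T" "v \<in> arr T" "w \<in> arr T" "src T v = tgt T u" "src T w = tgt T v"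
    "tgt T w = sho T (src T u)"
  using dist_triangle[OF assms] by auto

lemma rotate: "(u, v, w) \<in> dist T \<Longrightarrow> (v, w, mneg T (sha T u)) \<in> dist T"
  using dist_rotate dist_triangle by blast

text \<open>The rotation axiom presupposes the arrow \<open>u\<close>; here it is recovered from
  fullness of the shift, the sign of the axiom passing to \<open>x\<close>.\<close>

lemma unrotate:
  assumes "(v, w, x) \<in> dist T"
  obtains u where "u \<in> arr T" "sha T u = mneg T x" "tgt T u = src T v" "sho T (src T u) = tgt T w"
    "(u, v, w) \<in> dist T"
proof -
  note D = distD[OF assms]
  obtain u where u: "u \<in> arr T" "mneg T x = sha T u" using sha_full'[of "mneg T x"] D by auto
  have s: "sho T (src T u) = tgt T w" 
    using src_sha[OF u(1)] src_mneg[OF D(3)] u(2) D(5) by metis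
  have t: "tgt T u = src T v" 
    using tgt_sha[OF u(1)] tgt_mneg[OF D(3)] u D sho_inj[of "tgt T u" "src T v"] by (metis src_obj tgt_obj)
  have "x = mneg T (sha T u)" using u D mneg_mneg[of x] by simp
  then have "(u, v, w) \<in> dist T" using assms dist_rotate[of u v w] u s t D by simp
  with u s t show ?thesis using that by simp
qed

lemma zero_sho: assumes "zero_object T Z" shows "zero_object T (sho T Z)"
  using zero_objectD(1,2)[OF assms] sha_idt'[of Z] by (intro zero_objectI) auto

lemma zero_unsho: assumes "zero_object T (sho T Z)" "Z \<in> obj T" shows "zero_object T Z"
  using zero_objectD(1,2)[OF assms(1)] sha_faithful[of "idt T Z" "mzero T Z Z"] assms(2)
  by (intro zero_objectI) auto

lemma dist_zero_right:
  assumes "X \<in> obj T"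
  obtains Z where "zero_object T Z" "(idt T X, mzero T X Z, mzero T Z (sho T X)) \<in> dist T"
  using dist_idt[OF assms] zero_object_exists by blast

lemma dist_zero_left:
  assumes "X \<in> obj T"
  obtains Z where "zero_object T Z" "(mzero T Z X, idt T X, mzero T X (sho T Z)) \<in> dist T"
proof -
  obtain Z where Z: "zero_object T Z" "(idt T X, mzero T X Z, mzero T Z (sho T X)) \<in> dist T"
    using dist_zero_right[OF assms] .
  note o = zero_objectD(1)[OF Z(1)]
  obtain u where u: "u \<in> arr T" "sha T u = mneg T (mzero T Z (sho T X))" "tgt T u = src T (idt T X)"
    "sho T (src T u) = tgt T (mzero T X Z)" "(u, idt T X, mzero T X Z) \<in> dist T"
    using unrotate[OF Z(2)] .
  \<comment> \<open>Unrotation replaces \<open>Z\<close> by an object whose shift is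
    \<open>Z\<close>, so the zero object delivered is a different one.\<close>
  have z: "zero_object T (src T u)" by (rule zero_unsho) (use u o assms Z(1) in auto)
  have "u = mzero T (src T u) X" using sha_faithful[of u "mzero T (src T u) X"] u o assms by auto
  then show ?thesis using that[OF z] u o assms by simp
qed

text \<open>Comparison with the triangle on the identity of \<open>src T u\<close>, whose third
  object is zero: the fill-in makes \<open>v \<cdot> u\<close> factor through zero.\<close>

lemma dist_comp_0:
  assumes "(u, v, w) \<in> dist T"
  shows "v \<cdot> u = mzero T (src T u) (tgt T v)"
proof -
  note D = distD[OF assms]
  obtain Z where Z: "zero_object T Z"
    "(idt T (src T u), mzero T (src T u) Z, mzero T Z (sho T (src T u))) \<in> dist T"
    using dist_zero_right[of "src T u"] D by auto
  note o = zero_objectD(1)[OF Z(1)]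
  obtain c where "triangle_mor T (idt T (src T u)) u c
      (idt T (src T u), mzero T (src T u) Z, mzero T Z (sho T (src T u))) (u, v, w)"
    using dist_mor[OF Z(2) assms, of "idt T (src T u)" u] D by auto
  then show ?thesis using D o by auto
qed

lemma dist_comp_0': "(u, v, w) \<in> dist T \<Longrightarrow> w \<cdot> v = mzero T (tgt T u) (sho T (src T u))"
  using dist_comp_0[OF rotate, of u v w] distD[of u v w] by simp

lemma dist_comp_0'': "(u, v, w) \<in> dist T \<Longrightarrow> sha T u \<cdot> w = mzero T (tgt T v) (sho T (tgt T u))"
proof -
  assume a: "(u, v, w) \<in> dist T"
  note D = distD[OF a]
  have "mneg T (sha T u \<cdot> w) = mzero T (tgt T v) (sho T (tgt T u))"
    using dist_comp_0'[OF rotate[OF a]] D by simp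
  then have "mneg T (mneg T (sha T u \<cdot> w)) = mzero T (tgt T v) (sho T (tgt T u))" using D by simp
  then show ?thesis using D by simp
qed

text \<open>The arrow \<open>v\<close> is a weak cokernel of \<open>u\<close>: the pair
  \<open>(0, g)\<close> extends to a morphism into the triangle on the identity of the target of
  \<open>g\<close>, and its third component is the factor.\<close>

lemma dist_factor_right:
  assumes "(u, v, w) \<in> dist T" "g \<in> arr T" "src T g = tgt T u" "g \<cdot> u = mzero T (src T u) (tgt T g)"
  obtains h where "h \<in> Hom T (tgt T v) (tgt T g)" "g = h \<cdot> v"
proof -
  note D = distD[OF assms(1)]
  obtain Z where Z: "zero_object T Z"
    "(mzero T Z (tgt T g), idt T (tgt T g), mzero T (tgt T g) (sho T Z)) \<in> dist T"
    using dist_zero_left[of "tgt T g"] assms by auto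
  note o = zero_objectD(1)[OF Z(1)]
  obtain c where "triangle_mor T (mzero T (src T u) Z) g c (u, v, w)
      (mzero T Z (tgt T g), idt T (tgt T g), mzero T (tgt T g) (sho T Z))"
    using dist_mor[OF assms(1) Z(2), of "mzero T (src T u) Z" g] D o assms by auto
  then have "c \<in> Hom T (tgt T v) (tgt T g)" "g = c \<cdot> v" using o assms(2) by simp_all
  then show ?thesis using that by blast
qed

lemma dist_factor_left:
  assumes "(u, v, w) \<in> dist T" "f \<in> arr T" "tgt T f = tgt T u" "v \<cdot> f = mzero T (src T f) (tgt T v)"
  obtains g where "g \<in> Hom T (src T f) (src T u)" "f = u \<cdot> g"
proof -
  note D = distD[OF assms(1)]
  define A where "A = src T f"
  have A: "A \<in> obj T" using assms A_def by simp
  obtain Z where Z: "zero_object T Z" "(idt T A, mzero T A Z, mzero T Z (sho T A)) \<in> dist T"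
    using dist_zero_right[OF A] .
  note o = zero_objectD(1)[OF Z(1)]
  \<comment> \<open>Morphisms of triangles are only completed at the third place, so both triangles
    are rotated once to bring the missing factor there. It comes out shifted, and fullness and
    faithfulness of the shift bring it back.\<close>
  have r: "(mzero T A Z, mzero T Z (sho T A), mneg T (idt T (sho T A))) \<in> dist T"
    using rotate[OF Z(2)] A by simp
  obtain c where c: "triangle_mor T f (mzero T Z (tgt T v)) c
      (mzero T A Z, mzero T Z (sho T A), mneg T (idt T (sho T A))) (v, w, mneg T (sha T u))"
    using dist_mor[OF r rotate[OF assms(1)], of f "mzero T Z (tgt T v)"] D o assms A A_def by auto
  then have c': "c \<in> Hom T (sho T A) (sho T (src T u))" using D o A by auto
  then obtain g where g: "g \<in> Hom T A (src T u)" "c = sha T g"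
    using sha_full[OF c' A src_obj[OF D(1)]] by blast
  have "mneg T (sha T f) = mneg T (sha T (u \<cdot> g))"
    using c g c' D o A A_def assms by auto
  then have "sha T f = sha T (u \<cdot> g)"
    using mneg_mneg[of "sha T f"] mneg_mneg[of "sha T (u \<cdot> g)"] assms g D by auto
  then have "f = u \<cdot> g" using sha_faithful[of f "u \<cdot> g"] assms g D by auto
  then show ?thesis using that[of g] g A_def by auto
qed

lemma dist_extend:
  assumes "(u, v, w) \<in> dist T" "u \<in> Hom T X Y" "v \<in> Hom T Y Z" "g \<in> Hom T Y A" "g \<cdot> u = mzero T X A"
  shows "\<exists>h \<in> Hom T Z A. g = h \<cdot> v"
proof -
  have *: "g \<in> arr T" "src T g = tgt T u" "g \<cdot> u = mzero T (src T u) (tgt T g)" using assms by simp_all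
  obtain h where "h \<in> Hom T (tgt T v) (tgt T g)" "g = h \<cdot> v"
    by (rule dist_factor_right[OF assms(1) *])
  moreover have "tgt T v = Z" "tgt T g = A" using assms by simp_all
  ultimately show ?thesis by auto
qed

lemma dist_lift:
  assumes "(u, v, w) \<in> dist T" "u \<in> Hom T X Y" "v \<in> Hom T Y Z" "f \<in> Hom T A Y" "v \<cdot> f = mzero T A Z"
  shows "\<exists>g \<in> Hom T A X. f = u \<cdot> g"
proof -
  have *: "f \<in> arr T" "tgt T f = tgt T u" "v \<cdot> f = mzero T (src T f) (tgt T v)" using assms by simp_all
  obtain g where "g \<in> Hom T (src T f) (src T u)" "f = u \<cdot> g"
    by (rule dist_factor_left[OF assms(1) *])
  moreover have "src T u = X" "src T f = A" using assms by simp_all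
  ultimately show ?thesis by auto
qed

section \<open>Triangles through their three objects\<close>

lemma triI: "(u, v, w) \<in> dist T \<Longrightarrow> tri T (src T u) (tgt T u) (tgt T v)"
  by (auto simp: tri_def)

lemma triE:
  assumes "tri T X Y Z"
  obtains u v w where "(u, v, w) \<in> dist T" "u \<in> Hom T X Y" "v \<in> Hom T Y Z" "w \<in> Hom T Z (sho T X)"
  using assms distD unfolding tri_def by fastforce

lemma tri_obj: "tri T X Y Z \<Longrightarrow> X \<in> obj T \<and> Y \<in> obj T \<and> Z \<in> obj T"
  by (elim triE) auto

lemma tri_rotate: assumes "tri T X Y Z" shows "tri T Y Z (sho T X)"
proof -
  obtain u v w where d: "(u, v, w) \<in> dist T" "u \<in> Hom T X Y" "v \<in> Hom T Y Z" "w \<in> Hom T Z (sho T X)"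
    using assms by (rule triE)
  show ?thesis using triI[OF rotate[OF d(1)]] d by auto
qed

lemma tri_unrotate: assumes "tri T Y Z A" obtains X where "X \<in> obj T" "sho T X = A" "tri T X Y Z"
proof -
  obtain u v w where d: "(u, v, w) \<in> dist T" "u \<in> Hom T Y Z" "v \<in> Hom T Z A" "w \<in> Hom T A (sho T Y)"
    using assms by (rule triE)
  obtain x where x: "x \<in> arr T" "sha T x = mneg T w" "tgt T x = src T u" "sho T (src T x) = tgt T v"
    "(x, u, v) \<in> dist T" using unrotate[OF d(1)] .
  show ?thesis using that[of "src T x"] triI[OF x(5)] x d by auto
qed

lemma tri_unrotate': assumes "tri T Y Z (sho T X)" "X \<in> obj T" shows "tri T X Y Z"
proof -
  obtain X' where "X' \<in> obj T" "sho T X' = sho T X" "tri T X' Y Z" using tri_unrotate[OF assms(1)] .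
  then show ?thesis using sho_inj[of X' X] assms by auto
qed

lemma tri_sho: assumes "tri T X Y Z" shows "tri T (sho T X) (sho T Y) (sho T Z)"
  using assms by (intro tri_rotate)

lemma tri_unsho:
  assumes "tri T (sho T X) (sho T Y) (sho T Z)" "X \<in> obj T" "Y \<in> obj T" "Z \<in> obj T"
  shows "tri T X Y Z"
  using tri_unrotate'[OF tri_unrotate'[OF tri_unrotate'[OF assms(1)]]] assms by simp

lemma tri_sh: assumes "tri T X Y Z" shows "tri T (sh k X) (sh k Y) (sh k Z)"
proof (induction k rule: int_induct[where k = 0])
  case (step1 i)
  then show ?case using tri_sho[OF step1(2)] tri_obj[OF assms] by (simp add: sho_sh)
next
  case (step2 i)
  then show ?case
    using tri_unsho[of "sh (i - 1) X" "sh (i - 1) Y" "sh (i - 1) Z"] tri_obj[OF assms] by (simp add: sho_sh)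
qed (use assms in simp)

lemma tri_complete_left: assumes "v \<in> Hom T Y Z"
  obtains u w where "(u, v, w) \<in> dist T"
proof -
  obtain w x where "(v, w, x) \<in> dist T" using dist_complete[of v] assms by auto
  then show ?thesis using unrotate that by metis
qed

lemma tri_iso:
  assumes "tri T X Y Z" "isomorphic T X X'" "isomorphic T Y Y'" "isomorphic T Z Z'"
  shows "tri T X' Y' Z'"
proof -
  obtain u v w where d: "(u, v, w) \<in> dist T" "u \<in> Hom T X Y" "v \<in> Hom T Y Z" "w \<in> Hom T Z (sho T X)"
    using assms(1) by (rule triE)
  obtain a a' where a: "a \<in> Hom T X X'" "a' \<in> Hom T X' X" "a' \<cdot> a = idt T X" "a \<cdot> a' = idt T X'"
    using assms(2) by (rule isomorphicE)
  obtain b b' where b: "b \<in> Hom T Y Y'" "b' \<in> Hom T Y' Y" "b' \<cdot> b = idt T Y" "b \<cdot> b' = idt T Y'"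
    using assms(3) by (rule isomorphicE)
  obtain c c' where c: "c \<in> Hom T Z Z'" "c' \<in> Hom T Z' Z" "c' \<cdot> c = idt T Z" "c \<cdot> c' = idt T Z'"
    using assms(4) by (rule isomorphicE)
  have isos: "is_iso T a" "is_iso T b" "is_iso T c"
    using is_isoI[OF a] is_isoI[OF b] is_isoI[OF c] by auto
  have "triangle_mor T a b c (u, v, w) (b \<cdot> (u \<cdot> a'), c \<cdot> (v \<cdot> b'), sha T a \<cdot> (w \<cdot> c'))"
    using a b c d by auto
  moreover have "triangle T (b \<cdot> (u \<cdot> a'), c \<cdot> (v \<cdot> b'), sha T a \<cdot> (w \<cdot> c'))"
    using a b c d by auto
  ultimately have "(b \<cdot> (u \<cdot> a'), c \<cdot> (v \<cdot> b'), sha T a \<cdot> (w \<cdot> c')) \<in> dist T"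
    using dist_iso[OF d(1)] dist_triangle[OF d(1)] isos unfolding triangle_iso_def by blast
  from triI[OF this] show ?thesis using a b c d by auto
qed

text \<open>The octahedral axiom as one half of the associativity of extensions: from
  \<open>(A * B) * Z\<close> to \<open>A * (B * Z)\<close>. The other half is
  \<open>tri_oct2\<close>.\<close>

lemma tri_oct1:
  assumes "tri T X Y Z" "tri T A X B"
  obtains W where "tri T A Y W" "tri T B W Z"
proof -
  obtain v l i where v: "(v, l, i) \<in> dist T" "v \<in> Hom T X Y" "l \<in> Hom T Y Z" "i \<in> Hom T Z (sho T X)"
    using assms(1) by (rule triE)
  obtain u j k where u: "(u, j, k) \<in> dist T" "u \<in> Hom T A X" "j \<in> Hom T X B" "k \<in> Hom T B (sho T A)"
    using assms(2) by (rule triE)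
  obtain m n where m: "(v \<cdot> u, m, n) \<in> dist T" using dist_complete[of "v \<cdot> u"] u v by auto
  obtain f g where f: "f \<in> Hom T (tgt T j) (tgt T m)" "g \<in> Hom T (tgt T m) (tgt T l)"
    "(f, g, sha T j \<cdot> i) \<in> dist T" using octahedral[OF u(1) v(1) m] u v by auto
  show ?thesis using that[of "tgt T m"] triI[OF m] triI[OF f(3)] f u v by auto
qed

text \<open>The octahedron is taken on the composite of \<open>Y -> Z\<close> and
  \<open>Z -> B\<close>; \<open>W\<close> is the cone of this composite shifted back by one.\<close>

lemma tri_oct2:
  assumes "tri T X Y Z" "tri T A Z B"
  obtains W where "tri T X W A" "tri T W Y B"
proof -
  have o: "X \<in> obj T" "A \<in> obj T" using assms tri_obj by auto
  obtain V where V: "tri T Y B V" "tri T (sho T X) V (sho T A)"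
    using tri_oct1[OF tri_rotate[OF assms(2)] tri_rotate[OF assms(1)]] .
  obtain W where W: "W \<in> obj T" "sho T W = V" "tri T W Y B" using tri_unrotate[OF V(1)] .
  show ?thesis using that[of W] W V o tri_unsho by auto
qed

lemma tri_hom0_left: assumes "tri T X Y Z" "hom0 T X A" "hom0 T Z A" shows "hom0 T Y A"
  unfolding hom0_def
proof
  fix f assume f: "f \<in> Hom T Y A"
  then have A: "A \<in> obj T" by auto
  obtain u v w where d: "(u, v, w) \<in> dist T" "u \<in> Hom T X Y" "v \<in> Hom T Y Z" "w \<in> Hom T Z (sho T X)"
    using assms(1) by (rule triE)
  have "f \<cdot> u = mzero T X A" by (rule hom0D[OF assms(2)]) (use f d in auto)
  then obtain h where h: "h \<in> Hom T Z A" "f = h \<cdot> v"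
    using dist_factor_right[OF d(1), of f] f d by auto
  have "h = mzero T Z A" by (rule hom0D[OF assms(3)]) (use h in auto)
  then show "f = mzero T Y A" using h(2) d(3) A by auto
qed

lemma tri_hom0_right: assumes "tri T X Y Z" "hom0 T A X" "hom0 T A Z" shows "hom0 T A Y"
  unfolding hom0_def
proof
  fix f assume f: "f \<in> Hom T A Y"
  then have A: "A \<in> obj T" by auto
  obtain u v w where d: "(u, v, w) \<in> dist T" "u \<in> Hom T X Y" "v \<in> Hom T Y Z" "w \<in> Hom T Z (sho T X)"
    using assms(1) by (rule triE)
  have "v \<cdot> f = mzero T A Z" by (rule hom0D[OF assms(3)]) (use f d in auto)
  then obtain h where h: "h \<in> Hom T A X" "f = u \<cdot> h"
    using dist_factor_left[OF d(1), of f] f d by auto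
  have "h = mzero T A X" by (rule hom0D[OF assms(2)]) (use h in auto)
  then show "f = mzero T A Y" using h(2) d(2) A by auto
qed

lemma dist_split_epi:
  assumes "(u, v, w) \<in> dist T" "w = mzero T (tgt T v) (sho T (src T u))"
  obtains j where "j \<in> Hom T (tgt T v) (tgt T u)" "v \<cdot> j = idt T (tgt T v)"
proof -
  note D = distD[OF assms(1)]
  have e: "w \<cdot> idt T (tgt T v) = mzero T (src T (idt T (tgt T v))) (tgt T w)"
    using assms(2) D by simp
  obtain j where j: "j \<in> Hom T (src T (idt T (tgt T v))) (src T v)" "idt T (tgt T v) = v \<cdot> j"
    by (rule dist_factor_left[OF rotate[OF assms(1)] _ _ e]) (use D in simp_all)
  show ?thesis by (rule that[OF _ j(2)[symmetric]]) (use j(1) D in simp)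
qed

lemma dist_split_mono:
  assumes "(u, v, w) \<in> dist T" "w = mzero T (tgt T v) (sho T (src T u))"
  obtains p where "p \<in> Hom T (tgt T u) (src T u)" "p \<cdot> u = idt T (src T u)"
proof -
  note D = distD[OF assms(1)]
  obtain x where x: "x \<in> arr T" "sha T x = mneg T w" "tgt T x = src T u" "sho T (src T x) = tgt T v"
    "(x, u, v) \<in> dist T" using unrotate[OF assms(1)] .
  have "sha T x = mzero T (sho T (src T x)) (sho T (src T u))"
    unfolding x(2) assms(2) x(4) using D by simp
  then have "sha T x = sha T (mzero T (src T x) (src T u))" using x D by simp
  then have x0: "x = mzero T (src T x) (src T u)"
    using sha_faithful[of x "mzero T (src T x) (src T u)"] x D by auto
  have "idt T (src T u) \<cdot> x = x" using x by simp
  then have e: "idt T (src T u) \<cdot> x = mzero T (src T x) (tgt T (idt T (src T u)))"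
    using x0 D(1) by (metis src_obj tgt_idt)
  obtain p where p: "p \<in> Hom T (tgt T u) (tgt T (idt T (src T u)))" "idt T (src T u) = p \<cdot> u"
    by (rule dist_factor_right[OF x(5) _ _ e]) (use D x(3) in simp_all)
  show ?thesis by (rule that[OF _ p(2)[symmetric]]) (use p(1) D in simp)
qed

text \<open>Since \<open>i\<close> is split, \<open>w = 0\<close> and \<open>v\<close> has a section
  \<open>j0\<close>. Subtracting \<open>i \<cdot> p \<cdot> j0\<close> gives a section
  \<open>j\<close> killed by \<open>p\<close>. The difference of the identity and
  \<open>i \<cdot> p + j \<cdot> v\<close> is killed by \<open>v\<close>, hence equals some
  \<open>i \<cdot> k\<close>, and composing with \<open>p\<close> gives
  \<open>k = 0\<close>.\<close>

lemma dist_complement: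
  assumes d: "(i, v, w) \<in> dist T" and i: "i \<in> Hom T X Y" and p: "p \<in> Hom T Y X" and pi: "p \<cdot> i = idt T X"
  obtains j where "j \<in> Hom T (tgt T v) Y" "v \<cdot> j = idt T (tgt T v)"
    "p \<cdot> j = mzero T (tgt T v) X" "madd T (i \<cdot> p) (j \<cdot> v) = idt T Y"
proof -
  note D = distD[OF d]
  define Z where "Z = tgt T v"
  have Z: "Z \<in> obj T" "v \<in> Hom T Y Z" using D Z_def i by auto
  have X: "X \<in> obj T" "Y \<in> obj T" using i by auto
  have "w = sha T (p \<cdot> i) \<cdot> w" unfolding pi using D i X by simp
  also have "\<dots> = sha T p \<cdot> (sha T i \<cdot> w)" using D i p by auto
  also have "\<dots> = mzero T (tgt T v) (sho T (src T i))"
    using dist_comp_0''[OF d] p i D by auto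
  finally have w: "w = mzero T (tgt T v) (sho T (src T i))" .
  obtain j0 where j0: "j0 \<in> Hom T Z Y" "v \<cdot> j0 = idt T Z"
    using dist_split_epi[OF d w] i Z_def by auto
  have vi: "v \<cdot> i = mzero T X Z" using dist_comp_0[OF d] i Z_def by simp
  define j where "j = madd T j0 (mneg T (i \<cdot> (p \<cdot> j0)))"
  have j: "j \<in> Hom T Z Y" using j0 i p by (auto simp: j_def)
  have "p \<cdot> (i \<cdot> (p \<cdot> j0)) = (p \<cdot> i) \<cdot> (p \<cdot> j0)" using j0 i p by (auto simp del: pi)
  then have "p \<cdot> (i \<cdot> (p \<cdot> j0)) = p \<cdot> j0" unfolding pi using j0 i p by auto
  then have pj: "p \<cdot> j = mzero T Z X"
    using j0 i p by (auto simp: j_def comp_madd_right)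
  have "v \<cdot> (i \<cdot> (p \<cdot> j0)) = (v \<cdot> i) \<cdot> (p \<cdot> j0)" using j0 i p D by auto
  then have "v \<cdot> (i \<cdot> (p \<cdot> j0)) = mzero T Z Z" unfolding vi using j0 i p Z by auto
  then have vj: "v \<cdot> j = idt T Z"
    using j0 i p Z by (auto simp: j_def comp_madd_right)
  define e where "e = madd T (i \<cdot> p) (j \<cdot> v)"
  define d' where "d' = madd T (idt T Y) (mneg T e)"
  have e: "e \<in> Hom T Y Y" "d' \<in> Hom T Y Y" using i p j Z X by (auto simp: e_def d'_def)
  have "v \<cdot> e = madd T ((v \<cdot> i) \<cdot> p) ((v \<cdot> j) \<cdot> v)"
    using i p j Z by (auto simp: e_def comp_madd_right)
  then have "v \<cdot> e = v" unfolding vi vj using p Z by auto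
  then have vd: "v \<cdot> d' = mzero T Y Z" using Z e X by (auto simp: d'_def comp_madd_right)
  obtain k where k: "k \<in> Hom T Y X" "d' = i \<cdot> k"
    using dist_lift[OF d i Z(2) e(2) vd] by blast
  have "p \<cdot> e = madd T ((p \<cdot> i) \<cdot> p) ((p \<cdot> j) \<cdot> v)"
    using i p j Z by (auto simp: e_def comp_madd_right)
  then have "p \<cdot> e = p" unfolding pi pj using p Z X by auto
  then have "p \<cdot> d' = mzero T Y X" using p e X by (auto simp: d'_def comp_madd_right)
  moreover have "p \<cdot> d' = (p \<cdot> i) \<cdot> k" using k p i by (auto simp del: pi)
  ultimately have "k = mzero T Y X" unfolding pi using k by auto
  then have "d' = mzero T Y Y" using k i X by auto
  then have "idt T Y = e" using eq_if_diff_0[of "idt T Y" e] e X unfolding d'_def by auto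
  then show ?thesis using that[of j] j vj pj unfolding e_def Z_def by simp
qed

lemma dist_direct_sum:
  assumes d: "(i, v, w) \<in> dist T" and i: "i \<in> Hom T X Y" and p: "p \<in> Hom T Y X" and pi: "p \<cdot> i = idt T X"
  shows "direct_sum T X (tgt T v) Y"
proof -
  obtain j where j: "j \<in> Hom T (tgt T v) Y" "v \<cdot> j = idt T (tgt T v)"
    "p \<cdot> j = mzero T (tgt T v) X" "madd T (i \<cdot> p) (j \<cdot> v) = idt T Y"
    using dist_complement[OF assms] .
  show ?thesis
    by (rule direct_sumI[of i _ _ j _ p v]) (use j i p pi distD[OF d] dist_comp_0[OF d] in auto)
qed

lemma retract_direct_sum:
  assumes "retract T X Y" obtains Z where "direct_sum T X Z Y" "Z \<in> obj T"
proof -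
  obtain i p where i: "i \<in> Hom T X Y" "p \<in> Hom T Y X" "p \<cdot> i = idt T X"
    using assms by (auto simp: retract_def)
  obtain v w where d: "(i, v, w) \<in> dist T" using dist_complete[of i] i by auto
  show ?thesis using that dist_direct_sum[OF d i] distD[OF d] by auto
qed

lemma summand_closed_retract:
  "\<lbrakk>summand_closed T N; retract T X Y; Y \<in> N\<rbrakk> \<Longrightarrow> X \<in> N"
  using retract_direct_sum[of X Y] retract_obj[of X Y] unfolding summand_closed_def by metis

text \<open>The cone of \<open>i\<close> carries a second complement \<open>j'\<close> of
  \<open>X\<close> in \<open>S\<close>; \<open>q \<cdot> j'\<close> and \<open>v \<cdot> j\<close>
  identify it with \<open>Y\<close>, as seen by inserting the two decompositions of the identity of
  \<open>S\<close>.\<close>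

lemma direct_sum_tri: assumes "direct_sum T X Y S" shows "tri T X S Y"
proof -
  obtain i j p q where *: "i \<in> Hom T X S" "j \<in> Hom T Y S" "p \<in> Hom T S X" "q \<in> Hom T S Y"
    and e: "p \<cdot> i = idt T X" "q \<cdot> j = idt T Y" "q \<cdot> i = mzero T X Y" "p \<cdot> j = mzero T Y X"
    "madd T (i \<cdot> p) (j \<cdot> q) = idt T S" using assms by (rule direct_sumE)
  obtain v w where d: "(i, v, w) \<in> dist T" using dist_complete[of i] * by auto
  obtain j' where j': "j' \<in> Hom T (tgt T v) S" "v \<cdot> j' = idt T (tgt T v)"
    "p \<cdot> j' = mzero T (tgt T v) X" "madd T (i \<cdot> p) (j' \<cdot> v) = idt T S"
    using dist_complement[OF d *(1,3) e(1)] .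
  have v: "v \<in> Hom T S (tgt T v)" using distD[OF d] * by auto
  have vi: "v \<cdot> i = mzero T X (tgt T v)" using dist_comp_0[OF d] * by simp
  have "v \<cdot> j' = v \<cdot> (madd T (i \<cdot> p) (j \<cdot> q) \<cdot> j')" unfolding e using j' * by auto
  also have "\<dots> = madd T ((v \<cdot> i) \<cdot> (p \<cdot> j')) (v \<cdot> (j \<cdot> (q \<cdot> j')))"
    using * v j'(1) by (auto simp: comp_madd_left comp_madd_right)
  also have "\<dots> = (v \<cdot> j) \<cdot> (q \<cdot> j')" unfolding vi j'(3) using * v j'(1) by auto
  finally have 1: "(v \<cdot> j) \<cdot> (q \<cdot> j') = idt T (tgt T v)" using j' by simp
  have "q \<cdot> j = q \<cdot> (madd T (i \<cdot> p) (j' \<cdot> v) \<cdot> j)" unfolding j' using * by auto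
  also have "\<dots> = madd T ((q \<cdot> i) \<cdot> (p \<cdot> j)) (q \<cdot> (j' \<cdot> (v \<cdot> j)))"
    using * v j'(1) by (auto simp: comp_madd_left comp_madd_right)
  also have "\<dots> = (q \<cdot> j') \<cdot> (v \<cdot> j)" unfolding e using * v j'(1) by auto
  finally have 2: "(q \<cdot> j') \<cdot> (v \<cdot> j) = idt T Y" using e by simp
  have "isomorphic T (tgt T v) Y"
    by (rule isomorphicI[of "q \<cdot> j'" _ _ "v \<cdot> j"]) (use 1 2 * v j'(1) in auto)
  then show ?thesis
    using tri_iso[OF triI[OF d], of X S Y] * isomorphic_refl by auto
qed

text \<open>A vanishing connecting map splits the triangle, so its outer terms may trade places.
  This is the move behind the reordering of iterated extensions.\<close>

lemma tri_swap:
  assumes "tri T X Y Z" "hom0 T Z (sho T X)" shows "tri T Z Y X" "direct_sum T X Z Y"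
proof -
  obtain u v w where d: "(u, v, w) \<in> dist T" "u \<in> Hom T X Y" "v \<in> Hom T Y Z" "w \<in> Hom T Z (sho T X)"
    using assms(1) by (rule triE)
  have "w = mzero T Z (sho T X)" by (rule hom0D[OF assms(2)]) (use d in auto)
  then obtain p where "p \<in> Hom T Y X" "p \<cdot> u = idt T X" using dist_split_mono[OF d(1)] d by auto
  then show s: "direct_sum T X Z Y" using dist_direct_sum[OF d(1,2)] d by auto
  show "tri T Z Y X" by (rule direct_sum_tri[OF direct_sum_commute[OF s]])
qed

lemma tri_zero_right: "\<lbrakk>X \<in> obj T; zero_object T Z\<rbrakk> \<Longrightarrow> tri T X X Z"
  using triI[OF dist_idt[of X Z]] zero_objectD(1)[of Z] by auto

lemma tri_zero_left: assumes "X \<in> obj T" "zero_object T Z" shows "tri T Z X X"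
proof (rule tri_unrotate')
  show "tri T X X (sho T Z)" using assms by (intro tri_zero_right zero_sho)
qed (use assms zero_objectD in auto)

section \<open>Extension closures\<close>

lemma ext_obj: assumes "S \<subseteq> obj T" shows "ext T S \<subseteq> obj T"
proof
  fix X assume "X \<in> ext T S"
  then show "X \<in> obj T" by induction (use assms tri_obj zero_objectD(1) in auto)
qed

lemma ext_hom0_left:
  assumes "X \<in> ext T S" "A \<in> obj T" "\<And>X. X \<in> S \<Longrightarrow> hom0 T X A" shows "hom0 T X A"
  using assms(1) by induction (use assms(2,3) zero_objectD tri_hom0_left in auto)

lemma ext_hom0_right:
  assumes "X \<in> ext T S" "A \<in> obj T" "\<And>X. X \<in> S \<Longrightarrow> hom0 T A X" shows "hom0 T A X"
  using assms(1) by induction (use assms(2,3) zero_objectD tri_hom0_right in auto)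

lemma ext_hom0:
  assumes "A \<in> ext T S" "B \<in> ext T S'" "S \<subseteq> obj T" "S' \<subseteq> obj T" "\<And>A B. A \<in> S \<Longrightarrow> B \<in> S' \<Longrightarrow> hom0 T A B"
  shows "hom0 T A B"
  by (rule ext_hom0_left[OF assms(1)], use assms ext_obj in blast,
      rule ext_hom0_right[OF assms(2)], use assms in auto)

lemma ext_sho: "X \<in> ext T S \<Longrightarrow> sho T X \<in> ext T (sho T ` S)"
  by (induction rule: ext.induct) (auto intro: ext.intros zero_sho tri_sho)

lemma ext_unsho:
  assumes "X \<in> ext T (sho T ` S)" "S \<subseteq> obj T" shows "\<exists>X' \<in> ext T S. sho T X' = X"
  using assms(1)
proof induction
  case (ext_zero Z)
  then obtain Z' where "Z' \<in> obj T" "sho T Z' = Z" using sho_surj zero_objectD(1) by metis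
  then show ?case using zero_unsho[of Z'] ext_zero by (blast intro: ext.intros)
next
  case (ext_base X)
  then show ?case by (auto intro: ext.intros)
next
  case (ext_step X Z Y)
  then obtain X' Z' where *: "X' \<in> ext T S" "sho T X' = X" "Z' \<in> ext T S" "sho T Z' = Z" by auto
  obtain Y' where Y': "Y' \<in> obj T" "sho T Y' = Y" using sho_surj tri_obj[OF ext_step(3)] by metis
  have "tri T X' Y' Z'" by (rule tri_unsho) (use * Y' ext_step(3) ext_obj[OF assms(2)] in auto)
  then show ?case using * Y' by (blast intro: ext.intros)
qed

text \<open>Extensions in the wrong order split, so all pieces from \<open>A\<close> can be moved to the left.\<close>

lemma ext_split:
  assumes "A \<subseteq> obj T" "B \<subseteq> obj T" "\<And>X Y. X \<in> A \<Longrightarrow> Y \<in> B \<Longrightarrow> hom0 T X (sho T Y)"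
    "X \<in> ext T (A \<union> B)"
  shows "\<exists>X1 \<in> ext T A. \<exists>X2 \<in> ext T B. tri T X1 X X2"
proof -
  obtain O0 where O0: "zero_object T O0" using zero_object_exists by auto
  have o: "ext T A \<subseteq> obj T" "ext T B \<subseteq> obj T" using ext_obj assms by auto
  have h: "hom0 T X (sho T Y)" if "X \<in> ext T A" "Y \<in> ext T B" for X Y
    by (rule ext_hom0[OF that(1) ext_sho[OF that(2)]]) (use assms in auto)
  show ?thesis using assms(4)
  proof induction
    case (ext_zero Z)
    then show ?case using tri_zero_right[of Z Z] zero_objectD(1)[of Z] by (blast intro: ext.intros)
  next
    case (ext_base X)
    show ?case
    proof (cases "X \<in> A")
      case True
      then show ?thesis using tri_zero_right[of X O0] O0 assms(1) by (blast intro: ext.intros)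
    next
      case False
      then show ?thesis using ext_base tri_zero_left[of X O0] O0 assms(2) by (blast intro: ext.intros)
    qed
  next
    case (ext_step X Z Y)
    obtain A1 B1 where X: "A1 \<in> ext T A" "B1 \<in> ext T B" "tri T A1 X B1" using ext_step by auto
    obtain A2 B2 where Z: "A2 \<in> ext T A" "B2 \<in> ext T B" "tri T A2 Z B2" using ext_step by auto
    \<comment> \<open>\<open>Y\<close> is built from \<open>A1\<close>, \<open>B1\<close>,
      \<open>A2\<close>, \<open>B2\<close> in this order. The middle two are exchanged, since
      \<open>h\<close> excludes a nonzero connecting map from \<open>A2\<close> to the shift of
      \<open>B1\<close>; then the pieces are regrouped in pairs.\<close>
    obtain W where W: "tri T A1 Y W" "tri T B1 W Z" using tri_oct1[OF ext_step(3) X(3)] .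
    obtain V where V: "tri T B1 V A2" "tri T V W B2" using tri_oct2[OF W(2) Z(3)] .
    have "tri T A2 V B1" using tri_swap(1)[OF V(1) h[OF Z(1) X(2)]] .
    then obtain V' where V': "tri T A2 W V'" "tri T B1 V' B2" using tri_oct1[OF V(2)] by metis
    obtain Q where Q: "tri T A1 Q A2" "tri T Q Y V'" using tri_oct2[OF W(1) V'(1)] .
    have "Q \<in> ext T A" "V' \<in> ext T B" using Q V' X Z by (auto intro: ext.intros)
    then show ?case using Q(2) by auto
  qed
qed

text \<open>All connecting maps vanish, so every extension formed here is a direct sum.\<close>

lemma ext_subset_add_hull:
  assumes "A \<subseteq> obj T" "\<And>X Y. X \<in> A \<Longrightarrow> Y \<in> A \<Longrightarrow> hom0 T X (sho T Y)" "X \<in> ext T A"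
  shows "X \<in> add_hull T A"
  using assms(3)
proof induction
  case (ext_zero Z)
  then show ?case using add_hull_closed(2)[of A] by (auto simp: sum_closed_def)
next
  case (ext_base X)
  then show ?case using add_hull_superset[of A] by auto
next
  case (ext_step X Z Y)
  have "hom0 T Z (sho T X)"
    by (rule ext_hom0[OF ext_step(2) ext_sho[OF ext_step(1)]]) (use assms in auto)
  then have "direct_sum T X Z Y" using tri_swap(2) ext_step by auto
  moreover have "Y \<in> obj T" using ext_step tri_obj by auto
  ultimately show ?case using add_hull_closed(2)[of A] ext_step unfolding sum_closed_def by blast
qed

section \<open>Sets of shifts and thick closures\<close>

lemma shs_obj: "M \<subseteq> obj T \<Longrightarrow> shs T M I \<subseteq> obj T"
  by (auto simp: shs_def)

lemma sho_shs: assumes "M \<subseteq> obj T" shows "sho T ` shs T M I = shs T M ((\<lambda>i. i + 1) ` I)"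
  using assms unfolding shs_def image_UN image_image by (auto simp: sho_sh subset_iff image_iff)

text \<open>The definition closes under cones only; the other two corners follow by rotation,
  because membership is invariant under the shift in both directions.\<close>

lemma triangulatedD:
  assumes "triangulated_subcategory T N"
  shows "N \<subseteq> obj T" "iso_closed T N" "X \<in> obj T \<Longrightarrow> sho T X \<in> N \<longleftrightarrow> X \<in> N"
    "\<lbrakk>tri T X Y Z; X \<in> N; Y \<in> N\<rbrakk> \<Longrightarrow> Z \<in> N"
    "\<lbrakk>tri T X Y Z; X \<in> N; Z \<in> N\<rbrakk> \<Longrightarrow> Y \<in> N"
    "\<lbrakk>tri T X Y Z; Y \<in> N; Z \<in> N\<rbrakk> \<Longrightarrow> X \<in> N"
    "\<lbrakk>isomorphic T X Y; X \<in> N\<rbrakk> \<Longrightarrow> Y \<in> N"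
    "zero_object T Z \<Longrightarrow> Z \<in> N"
proof -
  show 1: "N \<subseteq> obj T" "iso_closed T N" using assms by (auto simp: triangulated_subcategory_def)
  show 2: "sho T X \<in> N \<longleftrightarrow> X \<in> N" if "X \<in> obj T" for X
    using assms that by (auto simp: triangulated_subcategory_def)
  show 3: "Z \<in> N" if t: "tri T X Y Z" "X \<in> N" "Y \<in> N" for X Y Z
  proof -
    obtain u v w where d: "(u, v, w) \<in> dist T" "u \<in> Hom T X Y" "v \<in> Hom T Y Z" "w \<in> Hom T Z (sho T X)"
      using t(1) by (rule triE)
    have "\<forall>(u, v, w) \<in> dist T. src T u \<in> N \<and> tgt T u \<in> N \<longrightarrow> tgt T v \<in> N"
      using assms by (auto simp: triangulated_subcategory_def)
    then show ?thesis using d t by fastforce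
  qed
  show 4: "X \<in> N" if "tri T X Y Z" "Y \<in> N" "Z \<in> N" for X Y Z
    using 3[OF tri_rotate[OF that(1)] that(2,3)] 2 tri_obj[OF that(1)] by auto
  show "Y \<in> N" if "tri T X Y Z" "X \<in> N" "Z \<in> N" for X Y Z
    using 4[OF tri_rotate[OF that(1)] that(3)] 2 tri_obj[OF that(1)] that(2) by auto
  show 5: "Y \<in> N" if "isomorphic T X Y" "X \<in> N" for X Y
    using 1(2) that isomorphic_obj unfolding iso_closed_def by blast
  show "Z \<in> N" if "zero_object T Z" for Z
  proof -
    obtain X where "X \<in> N" using assms by (auto simp: triangulated_subcategory_def)
    then show ?thesis using 3[OF tri_zero_right[OF _ that]] 1 by auto
  qed
qed

lemma triangulatedI:
  assumes "N \<subseteq> obj T" "N \<noteq> {}" "\<And>X Y. \<lbrakk>isomorphic T X Y; X \<in> N\<rbrakk> \<Longrightarrow> Y \<in> N"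
    "\<And>X. X \<in> obj T \<Longrightarrow> sho T X \<in> N \<longleftrightarrow> X \<in> N"
    "\<And>X Y Z. \<lbrakk>tri T X Y Z; X \<in> N; Y \<in> N\<rbrakk> \<Longrightarrow> Z \<in> N"
  shows "triangulated_subcategory T N"
  unfolding triangulated_subcategory_def iso_closed_def
  using assms triI by blast

lemma thick_superset: "S \<subseteq> thick T S"
  by (auto simp: thick_def)

lemma thick_least: "\<lbrakk>S \<subseteq> N; triangulated_subcategory T N; summand_closed T N\<rbrakk> \<Longrightarrow> thick T S \<subseteq> N"
  by (auto simp: thick_def)

lemma obj_triangulated: "triangulated_subcategory T (obj T)"
  by (rule triangulatedI) (use zero_object_exists zero_objectD(1) isomorphic_obj tri_obj sho_obj in blast)+

lemma obj_summand_closed: "summand_closed T (obj T)"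
  by (auto simp: summand_closed_def)

lemma thick_triangulated:
  assumes "S \<subseteq> obj T" shows "triangulated_subcategory T (thick T S)"
proof (rule triangulatedI)
  obtain Z where "zero_object T Z" using zero_object_exists by auto
  then have "Z \<in> thick T S" using triangulatedD(8) by (auto simp: thick_def)
  then show "thick T S \<noteq> {}" by auto
  show "thick T S \<subseteq> obj T" by (rule thick_least[OF assms obj_triangulated obj_summand_closed])
  show "Y \<in> thick T S" if "isomorphic T X Y" "X \<in> thick T S" for X Y
    using that triangulatedD(7) unfolding thick_def by blast
  show "sho T X \<in> thick T S \<longleftrightarrow> X \<in> thick T S" if "X \<in> obj T" for X
    using that triangulatedD(3) unfolding thick_def by blast
  show "Z \<in> thick T S" if "tri T X Y Z" "X \<in> thick T S" "Y \<in> thick T S" for X Y Z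
    using that triangulatedD(4) unfolding thick_def by blast
qed

lemma thick_summand_closed: "summand_closed T (thick T S)"
  unfolding summand_closed_def thick_def by blast

lemma triangulated_sh:
  assumes "triangulated_subcategory T N" "X \<in> obj T" shows "sh i X \<in> N \<longleftrightarrow> X \<in> N"
proof (induction i rule: int_induct[where k = 0])
  case (step1 i)
  then show ?case using triangulatedD(3)[OF assms(1), of "sh i X"] assms(2) by (simp add: sho_sh)
next
  case (step2 i)
  then show ?case using triangulatedD(3)[OF assms(1), of "sh (i - 1) X"] assms(2) by (simp add: sho_sh)
qed simp

lemma triangulated_ext:
  assumes "triangulated_subcategory T N" "S \<subseteq> N" "X \<in> ext T S" shows "X \<in> N"
  using assms(3) by induction (use assms(2) triangulatedD(5,8)[OF assms(1)] in auto)

text \<open>With \<open>\<pi> : W1 \<rightarrow> X1\<close> and \<open>\<iota> : X2 \<rightarrow> W2\<close> split, the octahedral axiom for \<open>u\<pi>\<close> and for \<open>\<iota>u\<pi>\<close> gives triangles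
  whose connecting maps vanish: \<open>cone u\<close> is a retract of \<open>cone (u\<pi>)\<close>, and that one of \<open>cone (\<iota>u\<pi>)\<close>.\<close>

lemma cone_retract:
  assumes t: "tri T X1 X2 C" and W: "retract T X1 W1" "retract T X2 W2"
  obtains E where "tri T W1 W2 E" "retract T C E"
proof -
  obtain u l i where u: "(u, l, i) \<in> dist T" "u \<in> Hom T X1 X2" "l \<in> Hom T X2 C" "i \<in> Hom T C (sho T X1)"
    using t by (rule triE)
  obtain s \<pi> where s: "s \<in> Hom T X1 W1" "\<pi> \<in> Hom T W1 X1" "\<pi> \<cdot> s = idt T X1"
    using W(1) by (auto simp: retract_def)
  obtain \<iota> p where p: "\<iota> \<in> Hom T X2 W2" "p \<in> Hom T W2 X2" "p \<cdot> \<iota> = idt T X2"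
    using W(2) by (auto simp: retract_def)
  obtain j k where j: "(\<pi>, j, k) \<in> dist T" using dist_complete[of \<pi>] s by auto
  obtain m n where m: "(u \<cdot> \<pi>, m, n) \<in> dist T" using dist_complete[of "u \<cdot> \<pi>"] s u by auto
  note Dj = distD[OF j] and Dm = distD[OF m]
  obtain f g where f: "f \<in> Hom T (tgt T j) (tgt T m)" "g \<in> Hom T (tgt T m) (tgt T l)"
    "(f, g, sha T j \<cdot> i) \<in> dist T" using octahedral[OF j u(1) m] s u by auto
  have "j = j \<cdot> (\<pi> \<cdot> s)" using s(2) Dj unfolding s(3) by simp
  also have "\<dots> = (j \<cdot> \<pi>) \<cdot> s" using s(1,2) Dj by simp
  also have "\<dots> = mzero T X1 (tgt T j)" unfolding dist_comp_0[OF j] using s(1,2) Dj by simp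
  finally have "sha T j = sha T (mzero T X1 (tgt T j))" by (rule arg_cong)
  then have sj: "sha T j = mzero T (sho T X1) (sho T (tgt T j))"
    using Dj(2) src_obj[of s] s(1) by auto
  have "sha T j \<cdot> i = mzero T (tgt T g) (sho T (src T f))" unfolding sj using f u Dj(2) by auto
  then obtain h where h: "h \<in> Hom T (tgt T g) (tgt T f)" "g \<cdot> h = idt T (tgt T g)"
    using dist_split_epi[OF f(3)] by auto
  have r1: "retract T C (tgt T m)" by (rule retractI[of h _ _ g]) (use h f u in auto)
  have up: "u \<cdot> \<pi> \<in> Hom T W1 X2" using u s by auto
  obtain l' i' where i': "(\<iota>, l', i') \<in> dist T" using dist_complete[of \<iota>] p by auto
  obtain m' n' where m': "(\<iota> \<cdot> (u \<cdot> \<pi>), m', n') \<in> dist T"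
    using dist_complete[of "\<iota> \<cdot> (u \<cdot> \<pi>)"] up p by auto
  note Di = distD[OF i'] and Dm' = distD[OF m']
  obtain f' g' where f': "f' \<in> Hom T (tgt T m) (tgt T m')" "g' \<in> Hom T (tgt T m') (tgt T l')"
    "(f', g', sha T m \<cdot> i') \<in> dist T" using octahedral[OF m i' m'] up p by auto
  have "i' = sha T (p \<cdot> \<iota>) \<cdot> i'" unfolding p(3) using Di p(1) by auto
  also have "\<dots> = sha T p \<cdot> (sha T \<iota> \<cdot> i')" using Di p(1,2) by auto
  also have "\<dots> = mzero T (tgt T l') (sho T X2)" unfolding dist_comp_0''[OF i'] using Di p(1,2) by auto
  finally have "sha T m \<cdot> i' = mzero T (tgt T g') (sho T (src T f'))" using f' p up Di Dm by auto
  then obtain q where q: "q \<in> Hom T (tgt T f') (src T f')" "q \<cdot> f' = idt T (src T f')"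
    using dist_split_mono[OF f'(3)] by auto
  have r2: "retract T (tgt T m) (tgt T m')" by (rule retractI[of f' _ _ q]) (use q f' in auto)
  show ?thesis using that[of "tgt T m'"] triI[OF m'] retract_trans[OF r1 r2] up p by auto
qed

text \<open>The retracts of iterated extensions of shifts of \<open>M\<close> already form a thick
  subcategory. The delicate closure is that under cones, since a map between retracts has to be
  realized between the extensions; this is \<open>cone_retract\<close>.\<close>

lemma thick_retract_ext:
  assumes "M \<subseteq> obj T" "X \<in> thick T M"
  shows "\<exists>W \<in> ext T (shs T M UNIV). retract T X W"
proof -
  define E where "E = ext T (shs T M UNIV)"
  have S: "shs T M UNIV \<subseteq> obj T" using assms shs_obj by auto
  then have E: "E \<subseteq> obj T" using ext_obj E_def by auto
  have "surj (\<lambda>i::int. i + 1)" by (rule surjI[of _ "\<lambda>i. i - 1"]) simp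
  then have sS: "sho T ` shs T M UNIV = shs T M UNIV" using sho_shs[OF assms(1), of UNIV] by simp
  have sE: "sho T X \<in> E" if "X \<in> E" for X using ext_sho[of X "shs T M UNIV"] that unfolding sS E_def .
  have uE: "\<exists>X' \<in> E. sho T X' = X" if "X \<in> E" for X
    using ext_unsho[of X "shs T M UNIV"] that S unfolding sS E_def by auto
  define N where "N = {X \<in> obj T. \<exists>W \<in> E. retract T X W}"
  have "thick T M \<subseteq> N"
  proof (rule thick_least)
    show "M \<subseteq> N"
    proof
      fix X assume X: "X \<in> M"
      then have "sh 0 X \<in> shs T M UNIV" unfolding shs_def by blast
      then have "X \<in> E" unfolding E_def by (auto intro: ext_base)
      then show "X \<in> N" using X assms retract_refl by (auto simp: N_def)
    qed
    show "summand_closed T N" unfolding summand_closed_def N_def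
      using direct_sum_retract retract_trans by blast
    show "triangulated_subcategory T N"
    proof (rule triangulatedI)
      show "N \<subseteq> obj T" by (auto simp: N_def)
      obtain Z where "zero_object T Z" using zero_object_exists by auto
      then have "Z \<in> obj T" "retract T Z Z" "Z \<in> E"
        using zero_objectD(1)[of Z] retract_refl[of Z] ext_zero[of T Z] by (auto simp: E_def)
      then have "Z \<in> N" unfolding N_def by blast
      then show "N \<noteq> {}" by auto
      show "Y \<in> N" if "isomorphic T X Y" "X \<in> N" for X Y
        using that isomorphic_obj isomorphic_sym isomorphic_retract retract_trans unfolding N_def by blast
      show "sho T X \<in> N \<longleftrightarrow> X \<in> N" if X: "X \<in> obj T" for X
      proof
        assume "X \<in> N"
        then obtain W i p where W: "W \<in> E" "i \<in> Hom T X W" "p \<in> Hom T W X" "p \<cdot> i = idt T X"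
          by (auto simp: N_def retract_def)
        have "sha T p \<cdot> sha T i = idt T (sho T X)" using W sha_comp'[of i p] X by auto
        then have "retract T (sho T X) (sho T W)"
          by (intro retractI[of "sha T i" _ _ "sha T p"]) (use W in auto)
        then show "sho T X \<in> N" using sE[OF W(1)] X by (auto simp: N_def)
      next
        assume "sho T X \<in> N"
        then obtain W i p where W: "W \<in> E" "i \<in> Hom T (sho T X) W" "p \<in> Hom T W (sho T X)"
          "p \<cdot> i = idt T (sho T X)" by (auto simp: N_def retract_def)
        obtain W' where W': "W' \<in> E" "sho T W' = W" using uE[OF W(1)] by auto
        have o: "W' \<in> obj T" using W' E by auto
        obtain i' where i': "i' \<in> Hom T X W'" "i = sha T i'" using sha_full[of i X W'] W W' X o by auto
        obtain p' where p': "p' \<in> Hom T W' X" "p = sha T p'" using sha_full[of p W' X] W W' X o by auto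
        have "p' \<cdot> i' = idt T X"
          using sha_faithful[of "p' \<cdot> i'" "idt T X"] i' p' W(4) X by auto
        then show "X \<in> N" using retractI[OF i'(1) p'(1)] W' X by (auto simp: N_def)
      qed
      show "Z \<in> N" if t: "tri T X Y Z" "X \<in> N" "Y \<in> N" for X Y Z
      proof -
        obtain W1 W2 where W: "W1 \<in> E" "W2 \<in> E" "retract T X W1" "retract T Y W2"
          using t by (auto simp: N_def)
        obtain C where C: "tri T W1 W2 C" "retract T Z C" using cone_retract[OF t(1) W(3,4)] .
        \<comment> \<open>By rotation the cone is an extension with terms \<open>W2\<close> and the
          shift of \<open>W1\<close>, and \<open>E\<close> is stable under the shift.\<close>
        have "C \<in> E" using ext_step[OF _ _ tri_rotate[OF C(1)]] W sE unfolding E_def by auto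
        then show ?thesis using C retract_obj by (auto simp: N_def)
      qed
    qed
  qed
  then show ?thesis using assms(2) by (auto simp: N_def E_def)
qed

section \<open>Silting subcategories and their order\<close>

lemma presiltingD:
  "\<lbrakk>presilting T M; i > 0; X \<in> M; Y \<in> M\<rbrakk> \<Longrightarrow> hom0 T X (sh i Y)"
  unfolding presilting_def using hom_vanish_shift_iff by blast

lemma presilting_obj: "presilting T M \<Longrightarrow> M \<subseteq> obj T"
  by (simp add: presilting_def)

lemma shs_hom0:
  assumes "A \<subseteq> obj T" "B \<subseteq> obj T" "\<And>i X Y. \<lbrakk>i > 0; X \<in> A; Y \<in> B\<rbrakk> \<Longrightarrow> hom0 T X (sh i Y)"
    "\<And>i j. \<lbrakk>i \<in> I; j \<in> J\<rbrakk> \<Longrightarrow> i < j" "X \<in> shs T A I" "Y \<in> shs T B J"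
  shows "hom0 T X Y"
proof -
  obtain i j X' Y' where *: "i \<in> I" "j \<in> J" "X' \<in> A" "Y' \<in> B" "X = sh i X'" "Y = sh j Y'"
    using assms(5,6) by (auto simp: shs_def)
  then have "hom0 T X' (sh (j - i) Y')" using assms(3,4) by auto
  then show ?thesis using * assms(1,2) hom0_shift(1)[of X' Y' i j] by auto
qed

text \<open>The weak inequality suffices because the target carries one more shift. In iterated
  extensions lower shifts can therefore be moved to the left.\<close>

lemma shs_hom0_sho:
  assumes "presilting T M" "\<And>i j. \<lbrakk>i \<in> I; j \<in> J\<rbrakk> \<Longrightarrow> i \<le> j" "X \<in> shs T M I" "Y \<in> shs T M J"
  shows "hom0 T X (sho T Y)"
proof (rule shs_hom0[of M M I "(\<lambda>i. i + 1) ` J"])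
  have M: "M \<subseteq> obj T" using assms presilting_obj by auto
  then show "sho T Y \<in> shs T M ((\<lambda>i. i + 1) ` J)" using sho_shs[OF M, of J] assms by blast
qed (use assms presilting_obj presiltingD in force)+

lemma presilting_ext_split:
  assumes M: "presilting T M" and "X \<in> ext T (shs T M (I \<union> J))"
    and "\<And>i j. \<lbrakk>i \<in> I; j \<in> J\<rbrakk> \<Longrightarrow> i \<le> j"
  obtains A B where "A \<in> ext T (shs T M I)" "B \<in> ext T (shs T M J)" "tri T A X B"
  using ext_split[of "shs T M I" "shs T M J" X] assms shs_obj[OF presilting_obj[OF M]]
    shs_hom0_sho[OF M, of I J] unfolding shs_Un by metis

text \<open>\<open>L\<close> is a retract of an extension of \<open>A \<in> ext N[<0]\<close> and \<open>B \<in> ext N[\<ge>0]\<close>, and \<open>Hom(A, L) = 0\<close>.\<close>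

lemma coaisle_retract:
  assumes N: "silting T N" and L: "L \<in> obj T" "\<And>i X. \<lbrakk>i > 0; X \<in> N\<rbrakk> \<Longrightarrow> hom0 T X (sh i L)"
  obtains B where "B \<in> ext T (shs T N {0..})" "retract T L B"
proof -
  have p: "presilting T N" "N \<subseteq> obj T" "thick T N = obj T"
    using N by (auto simp: silting_def presilting_def)
  obtain W where W: "W \<in> ext T (shs T N UNIV)" "retract T L W"
    using thick_retract_ext[OF p(2), of L] p(3) L(1) by auto
  have U: "{..<0} \<union> {0..} = (UNIV :: int set)" by auto
  obtain A B where AB: "A \<in> ext T (shs T N {..<0})" "B \<in> ext T (shs T N {0..})" "tri T A W B"
    by (rule presilting_ext_split[OF p(1), of W "{..<0}" "{0..}"], unfold U) (use W(1) in auto)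
  obtain i \<pi> where i: "i \<in> Hom T L W" "\<pi> \<in> Hom T W L" "\<pi> \<cdot> i = idt T L"
    using W(2) by (auto simp: retract_def)
  obtain u v w where d: "(u, v, w) \<in> dist T" "u \<in> Hom T A W" "v \<in> Hom T W B" "w \<in> Hom T B (sho T A)"
    using AB(3) by (rule triE)
  have "hom0 T A L"
  proof (rule ext_hom0_left[OF AB(1) L(1)])
    fix X assume "X \<in> shs T N {..<0}"
    then obtain i X' where "X = sh i X'" "i < 0" "X' \<in> N" by (auto simp: shs_def)
    then show "hom0 T X L" using L(2)[of "- i" X'] hom0_shift(1)[of X' L i 0] p(2) L(1) by auto
  qed
  then have "\<pi> \<cdot> u = mzero T A L" by (rule hom0D) (use d i in auto)
  then obtain h where h: "h \<in> Hom T B L" "\<pi> = h \<cdot> v"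
    using dist_extend[OF d(1-3) i(2)] by blast
  have "retract T L B"
    by (rule retractI[of "v \<cdot> i" _ _ h]) (use h i d in auto)
  then show ?thesis using that AB by auto
qed

text \<open>The middle term must generate: \<open>Y\<close> is then a retract of an object built
  from the shifts \<open>N[j]\<close> with \<open>j \<ge> 0\<close>, and \<open>X\<close> has no
  nonzero map to any \<open>N[i + j]\<close>.\<close>

lemma silting_ge_trans:
  assumes M: "M \<subseteq> obj T" and N: "silting T N" and L: "L \<subseteq> obj T"
    and MN: "\<And>i X Y. \<lbrakk>i > 0; X \<in> M; Y \<in> N\<rbrakk> \<Longrightarrow> hom0 T X (sh i Y)"
    and NL: "\<And>i X Y. \<lbrakk>i > 0; X \<in> N; Y \<in> L\<rbrakk> \<Longrightarrow> hom0 T X (sh i Y)"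
    and i: "i > 0" "X \<in> M" "Y \<in> L"
  shows "hom0 T X (sh i Y)"
proof -
  have No: "N \<subseteq> obj T" using N by (auto simp: silting_def presilting_def)
  obtain B where B: "B \<in> ext T (shs T N {0..})" "retract T Y B"
    using coaisle_retract[OF N, of Y] NL i L by blast
  have X: "X \<in> obj T" "Y \<in> obj T" "B \<in> obj T" using i M L ext_obj[OF shs_obj[OF No]] B by auto
  have "hom0 T (sh (- i) X) B"
  proof (rule ext_hom0_right[OF B(1)])
    fix V assume "V \<in> shs T N {0..}"
    then obtain j Z where "V = sh j Z" "j \<ge> 0" "Z \<in> N" by (auto simp: shs_def)
    then show "hom0 T (sh (- i) X) V" using MN[of "i + j" X Z] i hom0_shift(1)[of X Z "- i" j] X No
      by (auto simp: algebra_simps)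
  qed (use X in auto)
  then have "hom0 T (sh (- i) X) Y" by (rule hom0_retract_right[OF B(2)])
  then show ?thesis using hom0_shift_right X by auto
qed

text \<open>An object \<open>L\<close> of \<open>N\<close> is a retract of an extension
  \<open>W\<close> of a part \<open>A\<close> from \<open>M\<close> and a part \<open>B\<close> from
  \<open>M[>0]\<close>. As \<open>Hom(L, B) = 0\<close>, the inclusion of \<open>L\<close> into
  \<open>W\<close> factors through \<open>A\<close>, and \<open>A\<close> lies in the additive hull
  of \<open>M\<close> because self-extensions of \<open>M\<close> split.\<close>

lemma silting_ge_antisym:
  assumes M: "silting T M" and N: "N \<subseteq> obj T"
    and MN: "\<And>i X Y. \<lbrakk>i > 0; X \<in> M; Y \<in> N\<rbrakk> \<Longrightarrow> hom0 T X (sh i Y)"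
    and NM: "\<And>i X Y. \<lbrakk>i > 0; X \<in> N; Y \<in> M\<rbrakk> \<Longrightarrow> hom0 T X (sh i Y)"
  shows "N \<subseteq> add_hull T M"
proof
  fix L assume LN: "L \<in> N"
  then have L: "L \<in> obj T" using N by auto
  have p: "presilting T M" "M \<subseteq> obj T" using M by (auto simp: silting_def presilting_def)
  obtain W where W: "W \<in> ext T (shs T M {0..})" "retract T L W"
    using coaisle_retract[OF M L] MN LN by blast
  have U: "{0} \<union> {0<..} = {0 :: int..}" by auto
  obtain A B where AB: "A \<in> ext T (shs T M {0})" "B \<in> ext T (shs T M {0<..})" "tri T A W B"
    by (rule presilting_ext_split[OF p(1), of W "{0}" "{0<..}"], unfold U) (use W(1) in auto)
  obtain i \<pi> where i: "i \<in> Hom T L W" "\<pi> \<in> Hom T W L" "\<pi> \<cdot> i = idt T L"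
    using W(2) by (auto simp: retract_def)
  obtain u v w where d: "(u, v, w) \<in> dist T" "u \<in> Hom T A W" "v \<in> Hom T W B" "w \<in> Hom T B (sho T A)"
    using AB(3) by (rule triE)
  have "hom0 T L B"
    by (rule ext_hom0_right[OF AB(2) L]) (use NM LN in \<open>auto simp: shs_def\<close>)
  then have "v \<cdot> i = mzero T L B" by (rule hom0D) (use d i in auto)
  then obtain h where h: "h \<in> Hom T L A" "i = u \<cdot> h"
    using dist_lift[OF d(1-3) i(1)] by blast
  have r: "retract T L A"
    by (rule retractI[of h _ _ "\<pi> \<cdot> u"]) (use h i d in auto)
  have "shs T M {0} = M" by (auto simp: shs_def)
  moreover have "hom0 T X (sho T Y)" if "X \<in> M" "Y \<in> M" for X Y
    using presiltingD[OF p(1), of 1 X Y] sh_1[of Y] that p(2) by auto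
  ultimately have "A \<in> add_hull T M"
    using ext_subset_add_hull[of M A] p AB(1) by simp
  then show "L \<in> add_hull T M" using summand_closed_retract[OF add_hull_closed(3) r] by auto
qed

end

context additive_category
begin

text \<open>Composites are normalized to right-nested form, where an equation between composites of
  two arrows no longer matches. This applies such an equation at the head of a longer
  composite.\<close>

lemma comp_eq_extend:
  "\<lbrakk>s \<cdot> a = t \<cdot> b; s \<in> arr T; a \<in> arr T; t \<in> arr T; b \<in> arr T; x \<in> arr T; src T s = tgt T a;
    src T t = tgt T b; src T a = tgt T x; src T b = tgt T x\<rbrakk> \<Longrightarrow> s \<cdot> (a \<cdot> x) = t \<cdot> (b \<cdot> x)"
  by (metis assoc)

end

section \<open>Calculus of fractions\<close>

locale verdier_quotient = triangulated_category T
  for T :: "('o, 'a, 'b) tri_cat_scheme" (structure) and N :: "'o set" +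
  assumes N_triangulated: "triangulated_subcategory T N"
    and N_summand_closed: "summand_closed T N"
begin

abbreviation W :: "'a set" where "W \<equiv> cone_in T N"

lemma W_arr [simp]: "s \<in> W \<Longrightarrow> s \<in> arr T"
  by (simp add: cone_in_def)

lemma W_I: "\<lbrakk>(s, v, w) \<in> dist T; tgt T v \<in> N\<rbrakk> \<Longrightarrow> s \<in> W"
  using distD(1)[of s v w] unfolding cone_in_def by blast

lemma W_E:
  assumes "s \<in> W"
  obtains C v w where "C \<in> N" "(s, v, w) \<in> dist T" "v \<in> Hom T (tgt T s) C"
    "w \<in> Hom T C (sho T (src T s))"
  using assms distD unfolding cone_in_def by fastforce

lemma W_zero_cone: "zero_object T Z \<Longrightarrow> (s, mzero T (tgt T s) Z, w) \<in> dist T \<Longrightarrow> s \<in> W"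
  by (rule W_I) (use distD(1) zero_objectD(1) triangulatedD(8)[OF N_triangulated] in auto)

lemma W_idt [simp]: "X \<in> obj T \<Longrightarrow> idt T X \<in> W"
  by (rule dist_zero_right[of X]) (auto intro: W_zero_cone)

lemma W_comp [simp]: assumes "s \<in> W" "t \<in> W" "src T t = tgt T s" shows "t \<cdot> s \<in> W"
proof -
  obtain C j k where C: "C \<in> N" "(s, j, k) \<in> dist T" "j \<in> Hom T (tgt T s) C" using assms(1) by (rule W_E)
  obtain D l i where D: "D \<in> N" "(t, l, i) \<in> dist T" "l \<in> Hom T (tgt T t) D" using assms(2) by (rule W_E)
  obtain m n where m: "(t \<cdot> s, m, n) \<in> dist T" using dist_complete[of "t \<cdot> s"] assms by auto
  obtain f g where f: "f \<in> Hom T (tgt T j) (tgt T m)" "g \<in> Hom T (tgt T m) (tgt T l)"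
    "(f, g, sha T j \<cdot> i) \<in> dist T" using octahedral[OF C(2) D(2) m] assms by auto
  have "tri T C (tgt T m) D" using triI[OF f(3)] f C D by auto
  then show ?thesis using triangulatedD(5)[OF N_triangulated] C D W_I[OF m] by blast
qed

text \<open>The first arrow of a triangle whose second arrow is \<open>g\<close> has cone
  \<open>C\<close>. Both conditions for the calculus of fractions rest on killing a map into
  \<open>N\<close> in this way.\<close>

lemma W_cocone:
  assumes "g \<in> Hom T X C" "C \<in> N"
  obtains t where "t \<in> W" "tgt T t = X" "g \<cdot> t = mzero T (src T t) C"
proof -
  obtain t w where t: "(t, g, w) \<in> dist T" using tri_complete_left[OF assms(1)] .
  then show ?thesis using that[of t] W_I[OF t] distD[OF t] dist_comp_0[OF t] assms by auto
qed

text \<open>The obstruction to factoring \<open>f\<close> through \<open>s\<close> is its image in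
  the cone of \<open>s\<close>, a map into \<open>N\<close>; \<open>t\<close> kills it.\<close>

lemma ore:
  assumes "f \<in> arr T" "s \<in> W" "tgt T f = tgt T s"
  obtains t g where "t \<in> W" "g \<in> arr T" "tgt T t = src T f" "src T g = src T t" "tgt T g = src T s"
    "f \<cdot> t = s \<cdot> g"
proof -
  obtain C v w where C: "C \<in> N" "(s, v, w) \<in> dist T" "v \<in> Hom T (tgt T s) C" using assms(2) by (rule W_E)
  obtain t where t: "t \<in> W" "tgt T t = src T f" "(v \<cdot> f) \<cdot> t = mzero T (src T t) C"
    by (rule W_cocone[of "v \<cdot> f" "src T f" C]) (use C assms in auto)
  obtain g where "g \<in> Hom T (src T t) (src T s)" "f \<cdot> t = s \<cdot> g"
    using dist_lift[OF C(2) _ C(3), of "src T s" "f \<cdot> t" "src T t"] t C assms by auto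
  then show ?thesis using that[of t g] t by simp
qed

text \<open>The difference of \<open>f\<close> and \<open>g\<close> is killed by \<open>s\<close>,
  hence factors through the cone of \<open>s\<close> shifted by -1, which lies in \<open>N\<close>;
  \<open>t\<close> kills the factor.\<close>

lemma W_cancel:
  assumes "s \<in> W" "f \<in> arr T" "g \<in> arr T" "src T f = src T g" "tgt T f = tgt T g" "src T s = tgt T g"
    "s \<cdot> f = s \<cdot> g"
  obtains t where "t \<in> W" "tgt T t = src T g" "f \<cdot> t = g \<cdot> t"
proof -
  define h where "h = madd T f (mneg T g)"
  have h: "h \<in> Hom T (src T g) (tgt T g)" using assms by (simp add: h_def)
  have sh: "s \<cdot> h = mzero T (src T g) (tgt T s)" using assms by (simp add: h_def comp_madd_right)
  obtain C v w where C: "C \<in> N" "(s, v, w) \<in> dist T" "v \<in> Hom T (tgt T s) C" using assms(1) by (rule W_E)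
  obtain x where x: "x \<in> arr T" "sha T x = mneg T w" "tgt T x = src T s" "sho T (src T x) = tgt T v"
    "(x, s, v) \<in> dist T" using unrotate[OF C(2)] .
  have xN: "src T x \<in> N" using triangulatedD(3)[OF N_triangulated, of "src T x"] x C by auto
  obtain k where k: "k \<in> Hom T (src T g) (src T x)" "h = x \<cdot> k"
    using dist_lift[OF x(5) _ _ h, of "src T x" "tgt T s"] sh x assms by auto
  obtain t where t: "t \<in> W" "tgt T t = src T g" "k \<cdot> t = mzero T (src T t) (src T x)"
    using W_cocone[OF k(1) xN] .
  have "h \<cdot> t = x \<cdot> (k \<cdot> t)" using k t x by auto
  then have "h \<cdot> t = mzero T (src T t) (tgt T g)" unfolding t(3) using x t assms by simp
  then have d: "madd T (f \<cdot> t) (mneg T (g \<cdot> t)) = mzero T (src T t) (tgt T g)"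
    using assms t by (simp add: h_def comp_madd_left)
  have "f \<cdot> t = g \<cdot> t" by (rule eq_if_diff_0) (use d assms(1-6) t in simp_all)
  then show ?thesis using that t by auto
qed

text \<open>Both maps at the cone vanish: \<open>w = 0\<close> gives a section of \<open>v\<close>,
  and with \<open>v = 0\<close> the identity of the cone is zero.\<close>

lemma W_iso: assumes "is_iso T s" shows "s \<in> W"
proof -
  obtain s' where s: "s \<in> arr T" "s' \<in> Hom T (tgt T s) (src T s)" "s' \<cdot> s = idt T (src T s)"
    "s \<cdot> s' = idt T (tgt T s)" using assms by (auto simp: is_iso_def)
  obtain v w where d: "(s, v, w) \<in> dist T" using dist_complete[OF s(1)] by auto
  note D = distD[OF d]
  have "v = v \<cdot> (s \<cdot> s')" unfolding s(4) using D by simp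
  also have "\<dots> = (v \<cdot> s) \<cdot> s'" using s(1,2) D by simp
  also have "\<dots> = mzero T (tgt T s) (tgt T v)" unfolding dist_comp_0[OF d] using s(1,2) D by simp
  finally have v: "v = mzero T (tgt T s) (tgt T v)" .
  have "w = sha T (s' \<cdot> s) \<cdot> w" unfolding s(3) using D by simp
  also have "\<dots> = sha T s' \<cdot> (sha T s \<cdot> w)" using s(1,2) D by simp
  also have "\<dots> = mzero T (tgt T v) (sho T (src T s))" unfolding dist_comp_0''[OF d] using s(1,2) D by simp
  finally have w: "w = mzero T (tgt T v) (sho T (src T s))" .
  obtain j where j: "j \<in> Hom T (tgt T v) (tgt T s)" "v \<cdot> j = idt T (tgt T v)"
    using dist_split_epi[OF d w] .
  have "v \<cdot> j = mzero T (tgt T v) (tgt T v)"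
    by (subst v) (use j D in simp)
  then have "zero_object T (tgt T v)" using j D by (intro zero_objectI) simp_all
  then show ?thesis using W_I[OF d] triangulatedD(8)[OF N_triangulated] by auto
qed

lemma W_mneg: assumes "s \<in> W" shows "mneg T s \<in> W"
proof -
  have "mneg T (idt T (src T s)) \<in> W"
    by (rule W_iso, rule is_isoI[of _ _ "src T s" "src T s" "mneg T (idt T (src T s))"])
      (use assms in simp_all)
  from W_comp[OF this assms] show ?thesis using assms by simp
qed

lemma W_sha: assumes "s \<in> arr T" shows "sha T s \<in> W \<longleftrightarrow> s \<in> W"
proof
  assume "s \<in> W"
  then obtain C v w where C: "C \<in> N" "(s, v, w) \<in> dist T" "v \<in> Hom T (tgt T s) C"
    "w \<in> Hom T C (sho T (src T s))" by (rule W_E)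
  moreover have "C \<in> obj T" using C(1) triangulatedD(1)[OF N_triangulated] by auto
  ultimately have "mneg T (sha T s) \<in> W"
    using W_I[OF rotate[OF rotate[OF rotate[OF C(2)]]]] C triangulatedD(3)[OF N_triangulated, of C] by simp
  then have "mneg T (mneg T (sha T s)) \<in> W" by (rule W_mneg)
  then show "sha T s \<in> W" using assms by simp
next
  assume "sha T s \<in> W"
  then obtain C v w where C: "C \<in> N" "(sha T s, v, w) \<in> dist T" "v \<in> Hom T (sho T (tgt T s)) C"
    "w \<in> Hom T C (sho T (sho T (src T s)))" using assms by (auto elim: W_E)
  \<comment> \<open>Three rotations back lower the whole triangle by one shift, up to sign: the last
    arrow found is the negative of \<open>s\<close>.\<close>
  obtain x where x: "x \<in> arr T" "sha T x = mneg T w" "tgt T x = src T (sha T s)"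
    "sho T (src T x) = tgt T v" "(x, sha T s, v) \<in> dist T" using unrotate[OF C(2)] .
  obtain y where y: "y \<in> arr T" "sha T y = mneg T v" "tgt T y = src T x"
    "sho T (src T y) = tgt T (sha T s)" "(y, x, sha T s) \<in> dist T" using unrotate[OF x(5)] .
  obtain z where z: "z \<in> arr T" "sha T z = mneg T (sha T s)" "tgt T z = src T y"
    "sho T (src T z) = tgt T x" "(z, y, x) \<in> dist T" using unrotate[OF y(5)] .
  have "tgt T y \<in> N" using triangulatedD(3)[OF N_triangulated, of "src T x"] x y C by simp
  then have "z \<in> W" using W_I[OF z(5)] by simp
  moreover have "z = mneg T s" using sha_faithful[of z "mneg T s"] z assms by simp
  ultimately have "mneg T (mneg T s) \<in> W" using W_mneg by auto
  then show "s \<in> W" using assms by simp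
qed

section \<open>Equivalence of roofs\<close>

lemma roofs_iff [simp]: "(s, f) \<in> roofs T N \<longleftrightarrow> s \<in> W \<and> f \<in> arr T \<and> src T s = src T f"
  by (simp add: roofs_def)

lemma roof_equivI:
  assumes "(s, f) \<in> roofs T N" "(t, g) \<in> roofs T N" "tgt T s = tgt T t" "tgt T f = tgt T g"
    "a \<in> arr T" "b \<in> arr T" "src T a = src T b" "tgt T a = src T f" "tgt T b = src T g"
    "s \<cdot> a = t \<cdot> b" "f \<cdot> a = g \<cdot> b" "s \<cdot> a \<in> W"
  shows "((s, f), (t, g)) \<in> roof_equiv T N"
proof -
  have "a \<in> Hom T (src T a) (src T s)" "b \<in> Hom T (src T a) (src T t)" using assms by simp_all
  then show ?thesis using assms unfolding roof_equiv_def by blast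
qed

lemma roof_equivE:
  assumes "((s, f), (t, g)) \<in> roof_equiv T N"
  obtains a b where "s \<in> W" "t \<in> W" "f \<in> arr T" "g \<in> arr T" "src T s = src T f" "src T t = src T g"
    "tgt T s = tgt T t" "tgt T f = tgt T g" "a \<in> arr T" "b \<in> arr T" "src T a = src T b"
    "tgt T a = src T f" "tgt T b = src T g" "s \<cdot> a = t \<cdot> b" "f \<cdot> a = g \<cdot> b" "s \<cdot> a \<in> W"
proof -
  obtain V a b where "a \<in> Hom T V (src T s)" "b \<in> Hom T V (src T t)"
    "s \<cdot> a = t \<cdot> b" "f \<cdot> a = g \<cdot> b" "s \<cdot> a \<in> W"
    "(s, f) \<in> roofs T N" "(t, g) \<in> roofs T N" "tgt T s = tgt T t" "tgt T f = tgt T g"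
    using assms unfolding roof_equiv_def by blast
  then show ?thesis using that[of a b] by simp
qed

text \<open>Equivalence is witnessed by one refinement, but the numerators agree after any
  refinement that equalizes the denominators, up to one more arrow of \<open>W\<close>. Transitivity
  and the independence of composition and addition from representatives all reduce to this.\<close>

lemma roof_equiv_agree:
  assumes "((t, g), (t', g')) \<in> roof_equiv T N" "x \<in> arr T" "x' \<in> arr T" "src T x = src T x'"
    "tgt T x = src T t" "tgt T x' = src T t'" "t \<cdot> x = t' \<cdot> x'"
  obtains y where "y \<in> W" "tgt T y = src T x'" "g \<cdot> (x \<cdot> y) = g' \<cdot> (x' \<cdot> y)"
proof -
  obtain b b' where b: "t \<in> W" "t' \<in> W" "g \<in> arr T" "g' \<in> arr T" "src T t = src T g" "src T t' = src T g'"
    "tgt T t = tgt T t'" "tgt T g = tgt T g'" "b \<in> arr T" "b' \<in> arr T" "src T b = src T b'"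
    "tgt T b = src T g" "tgt T b' = src T g'" and e: "t \<cdot> b = t' \<cdot> b'" "g \<cdot> b = g' \<cdot> b'" and
    W: "t \<cdot> b \<in> W"
    using assms(1) by (rule roof_equivE)
  note ty = b assms(2-6)
  obtain e e' where e1: "e \<in> W" "e' \<in> arr T" "tgt T e = src T (t \<cdot> x)" "src T e' = src T e"
    "tgt T e' = src T (t \<cdot> b)" and e2: "(t \<cdot> x) \<cdot> e = (t \<cdot> b) \<cdot> e'"
    by (rule ore[of "t \<cdot> x" "t \<cdot> b"]) (use ty W in simp_all)
  \<comment> \<open>The Ore square makes the given pair and the witnessing pair agree only after
    composition with \<open>t\<close>; \<open>q\<close> cancels \<open>t\<close>, and then
    \<open>r\<close> cancels \<open>t'\<close> on the other leg.\<close>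
  have e3: "tgt T e = src T x'" "tgt T e' = src T b'" using e1 ty by simp_all
  note ty = ty e1(1,2,4) e3
  have q0: "t \<cdot> (x \<cdot> e) = t \<cdot> (b \<cdot> e')" using e2 ty by simp
  obtain q where q: "q \<in> W" "tgt T q = src T (b \<cdot> e')" and q1: "(x \<cdot> e) \<cdot> q = (b \<cdot> e') \<cdot> q"
    by (rule W_cancel[OF _ _ _ _ _ _ q0]) (use ty in simp_all)
  have q2: "tgt T q = src T e" using q ty by simp
  note ty = ty q(1) q2
  have q3: "x \<cdot> (e \<cdot> q) = b \<cdot> (e' \<cdot> q)" using q1 ty by simp
  have "t' \<cdot> (x' \<cdot> (e \<cdot> q)) = t \<cdot> (x \<cdot> (e \<cdot> q))"
    by (rule comp_eq_extend[OF assms(7)[symmetric]]) (use ty in simp_all)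
  also have "\<dots> = t' \<cdot> (b' \<cdot> (e' \<cdot> q))"
    unfolding q3 by (rule comp_eq_extend[OF e(1)]) (use ty in simp_all)
  finally have r0: "t' \<cdot> (x' \<cdot> (e \<cdot> q)) = t' \<cdot> (b' \<cdot> (e' \<cdot> q))" .
  obtain r where r: "r \<in> W" "tgt T r = src T (b' \<cdot> (e' \<cdot> q))"
    and r1: "(x' \<cdot> (e \<cdot> q)) \<cdot> r = (b' \<cdot> (e' \<cdot> q)) \<cdot> r"
    by (rule W_cancel[OF _ _ _ _ _ _ r0]) (use ty in simp_all)
  have r2: "tgt T r = src T q" using r ty by simp
  note ty = ty r(1) r2
  have r3: "x' \<cdot> (e \<cdot> (q \<cdot> r)) = b' \<cdot> (e' \<cdot> (q \<cdot> r))" using r1 ty by simp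
  have "(x \<cdot> (e \<cdot> q)) \<cdot> r = (b \<cdot> (e' \<cdot> q)) \<cdot> r" unfolding q3 ..
  then have s3: "x \<cdot> (e \<cdot> (q \<cdot> r)) = b \<cdot> (e' \<cdot> (q \<cdot> r))" using ty by simp
  have "g \<cdot> (b \<cdot> (e' \<cdot> (q \<cdot> r))) = g' \<cdot> (b' \<cdot> (e' \<cdot> (q \<cdot> r)))"
    by (rule comp_eq_extend[OF e(2)]) (use ty in simp_all)
  then have "g \<cdot> (x \<cdot> (e \<cdot> (q \<cdot> r))) = g' \<cdot> (x' \<cdot> (e \<cdot> (q \<cdot> r)))" unfolding r3 s3 .
  then show ?thesis using that[of "e \<cdot> (q \<cdot> r)"] ty by simp
qed

lemma roof_equiv_refl: "(s, f) \<in> roofs T N \<Longrightarrow> ((s, f), (s, f)) \<in> roof_equiv T N"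
  by (rule roof_equivI[of _ _ _ _ "idt T (src T s)" "idt T (src T s)"]) auto

lemma roof_equiv_sym:
  assumes "((s, f), (t, g)) \<in> roof_equiv T N" shows "((t, g), (s, f)) \<in> roof_equiv T N"
proof -
  obtain a b where "s \<in> W" "t \<in> W" "f \<in> arr T" "g \<in> arr T" "src T s = src T f" "src T t = src T g"
    "tgt T s = tgt T t" "tgt T f = tgt T g" "a \<in> arr T" "b \<in> arr T" "src T a = src T b"
    "tgt T a = src T f" "tgt T b = src T g" "s \<cdot> a = t \<cdot> b" "f \<cdot> a = g \<cdot> b" "s \<cdot> a \<in> W"
    using assms by (rule roof_equivE)
  then show ?thesis by (intro roof_equivI[of t g s f b a]) simp_all
qed

lemma roof_equiv_trans:
  assumes "((s, f), (t, g)) \<in> roof_equiv T N" "((t, g), (u, h)) \<in> roof_equiv T N"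
  shows "((s, f), (u, h)) \<in> roof_equiv T N"
proof -
  obtain a b where 1: "s \<in> W" "t \<in> W" "f \<in> arr T" "g \<in> arr T" "src T s = src T f" "src T t = src T g"
    "tgt T s = tgt T t" "tgt T f = tgt T g" "a \<in> arr T" "b \<in> arr T" "src T a = src T b"
    "tgt T a = src T f" "tgt T b = src T g" and e1: "s \<cdot> a = t \<cdot> b" "f \<cdot> a = g \<cdot> b" and W1: "s \<cdot> a \<in> W"
    using assms(1) by (rule roof_equivE)
  obtain c d where 2: "t \<in> W" "u \<in> W" "g \<in> arr T" "h \<in> arr T" "src T t = src T g" "src T u = src T h"
    "tgt T t = tgt T u" "tgt T g = tgt T h" "c \<in> arr T" "d \<in> arr T" "src T c = src T d"
    "tgt T c = src T g" "tgt T d = src T h" and e2: "t \<cdot> c = u \<cdot> d" "g \<cdot> c = h \<cdot> d" and W2: "t \<cdot> c \<in> W"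
    using assms(2) by (rule roof_equivE)
  obtain e e' where 3: "e \<in> W" "e' \<in> arr T" "tgt T e = src T (t \<cdot> b)" "src T e' = src T e"
    "tgt T e' = src T (t \<cdot> c)" and e3: "(t \<cdot> b) \<cdot> e = (t \<cdot> c) \<cdot> e'"
    by (rule ore[of "t \<cdot> b" "t \<cdot> c"]) (use 1 2 W2 in simp_all)
  have 4: "tgt T e = src T b" "tgt T e' = src T d" using 1 2 3 by simp_all
  note ty = 1 2 3(1,2,4) 4
  have e4: "t \<cdot> (b \<cdot> e) = t \<cdot> (c \<cdot> e')" using e3 ty by simp
  \<comment> \<open>The middle roof is compared with itself: \<open>b \<cdot> e\<close> and
    \<open>c \<cdot> e'\<close> agree after \<open>t\<close>, hence also after \<open>g\<close> once
    refined by \<open>y\<close>.\<close>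
  have tt: "((t, g), (t, g)) \<in> roof_equiv T N" by (rule roof_equiv_refl) (use ty in simp)
  obtain y where y: "y \<in> W" "tgt T y = src T (c \<cdot> e')" and y1: "g \<cdot> ((b \<cdot> e) \<cdot> y) = g \<cdot> ((c \<cdot> e') \<cdot> y)"
    by (rule roof_equiv_agree[OF tt _ _ _ _ _ e4]) (use ty in simp_all)
  have y2: "tgt T y = src T e" using y ty by simp
  note ty = ty y(1) y2
  have 5: "s \<cdot> (a \<cdot> (e \<cdot> y)) = t \<cdot> (b \<cdot> (e \<cdot> y))"
    by (rule comp_eq_extend[OF e1(1)]) (use ty in simp_all)
  have "t \<cdot> (b \<cdot> (e \<cdot> y)) = (t \<cdot> (b \<cdot> e)) \<cdot> y" using ty by simp
  also have "\<dots> = t \<cdot> (c \<cdot> (e' \<cdot> y))" unfolding e4 using ty by simp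
  also have "\<dots> = u \<cdot> (d \<cdot> (e' \<cdot> y))"
    by (rule comp_eq_extend[OF e2(1)]) (use ty in simp_all)
  finally have 6: "s \<cdot> (a \<cdot> (e \<cdot> y)) = u \<cdot> (d \<cdot> (e' \<cdot> y))" using 5 by simp
  have "f \<cdot> (a \<cdot> (e \<cdot> y)) = g \<cdot> (b \<cdot> (e \<cdot> y))"
    by (rule comp_eq_extend[OF e1(2)]) (use ty in simp_all)
  also have "\<dots> = g \<cdot> (c \<cdot> (e' \<cdot> y))" using y1 ty by simp
  also have "\<dots> = h \<cdot> (d \<cdot> (e' \<cdot> y))"
    by (rule comp_eq_extend[OF e2(2)]) (use ty in simp_all)
  finally have 7: "f \<cdot> (a \<cdot> (e \<cdot> y)) = h \<cdot> (d \<cdot> (e' \<cdot> y))" .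
  have "(s \<cdot> a) \<cdot> (e \<cdot> y) \<in> W" by (rule W_comp) (use W1 ty in simp_all)
  then have "s \<cdot> (a \<cdot> (e \<cdot> y)) \<in> W" using ty by simp
  with 6 7 show ?thesis
    by (intro roof_equivI[of s f u h "a \<cdot> (e \<cdot> y)" "d \<cdot> (e' \<cdot> y)"]) (use ty in simp_all)
qed

lemma roof_equiv_equiv: "equiv (roofs T N) (roof_equiv T N)"
proof (rule equivI)
  show "roof_equiv T N \<subseteq> roofs T N \<times> roofs T N" by (auto simp: roof_equiv_def)
  show "refl_on (roofs T N) (roof_equiv T N)"
    using roof_equiv_refl by (auto simp: refl_on_def)
  show "sym (roof_equiv T N)" using roof_equiv_sym by (auto simp: sym_def)
  show "trans (roof_equiv T N)" using roof_equiv_trans unfolding trans_def by fast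
qed

section \<open>Fractions, their composition and their addition\<close>

abbreviation frac :: "'a \<Rightarrow> 'a \<Rightarrow> 'a roof set" where "frac \<equiv> fraction T N"
abbreviation U :: "('o, 'a roof set) tri_cat" where "U \<equiv> triangle_quotient T N"
abbreviation comp_U (infixr \<open>\<bullet>\<close> 75) where "B \<bullet> A \<equiv> B \<cdot>\<^bsub>U\<^esub> A"
abbreviation proj :: "'a \<Rightarrow> 'a roof set" where "proj \<equiv> proj_arr T N"

lemma frac_eq_iff:
  "\<lbrakk>(s, f) \<in> roofs T N; (t, g) \<in> roofs T N\<rbrakk> \<Longrightarrow> frac s f = frac t g \<longleftrightarrow> ((s, f), (t, g)) \<in> roof_equiv T N"
  using eq_equiv_class_iff[OF roof_equiv_equiv] by (simp add: fraction_def)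

lemma in_frac_iff: "(t, g) \<in> frac s f \<longleftrightarrow> ((s, f), (t, g)) \<in> roof_equiv T N"
  by (simp add: fraction_def)

lemma frac_eqI:
  assumes "(s, f) \<in> roofs T N" "(t, g) \<in> roofs T N" "tgt T s = tgt T t" "tgt T f = tgt T g"
    "a \<in> arr T" "b \<in> arr T" "src T a = src T b" "tgt T a = src T f" "tgt T b = src T g"
    "s \<cdot> a = t \<cdot> b" "f \<cdot> a = g \<cdot> b" "s \<cdot> a \<in> W"
  shows "frac s f = frac t g"
  using frac_eq_iff[OF assms(1,2)] roof_equivI[OF assms] by simp

lemma frac_refine:
  assumes "s \<in> W" "f \<in> arr T" "src T s = src T f" "r \<in> arr T" "tgt T r = src T f" "s \<cdot> r \<in> W"
  shows "frac s f = frac (s \<cdot> r) (f \<cdot> r)"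
  by (rule frac_eqI[of _ _ _ _ r "idt T (src T r)"]) (use assms in simp_all)

lemma U_fields [simp]:
  "obj U = obj T" "arr U = roofs T N // roof_equiv T N" "idt U X = proj (idt T X)"
  "mzero U X Y = proj (mzero T X Y)" "sho U = sho T" "sha U A = map_prod (sha T) (sha T) ` A"
  by (simp_all add: triangle_quotient_def localization_def shift_cat.extend_def tri_cat.fields_def)

text \<open>The triangles of the quotient are described in the record that does not yet carry them.
  All fields entering \<open>triangle_iso\<close> are shared, so the description can be read in
  \<open>U\<close>.\<close>

lemma triangle_iso_localization: "triangle_iso (localization T N) = triangle_iso U"
proof -
  have 1: "arr (localization T N) = arr U" "src (localization T N) = src U" "tgt (localization T N) = tgt U"
    "idt (localization T N) = idt U" "comp (localization T N) = comp U" "sho (localization T N) = sho U"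
    "sha (localization T N) = sha U"
    by (simp_all add: triangle_quotient_def localization_def shift_cat.extend_def tri_cat.fields_def)
  have 2: "Hom (localization T N) = Hom U" by (simp add: Hom_def[abs_def] 1)
  have 3: "is_iso (localization T N) = is_iso U" by (simp add: is_iso_def[abs_def] 1 2)
  have 4: "triangle (localization T N) t = triangle U t" for t by (cases t) (simp add: 1)
  have 5: "triangle_mor (localization T N) a b c s t = triangle_mor U a b c s t" for a b c s t
    by (cases s; cases t) (simp add: 1 2 del: in_Hom)
  show ?thesis by (intro ext) (simp add: triangle_iso_def 3 4 5)
qed

lemma dist_U_iff:
  "t \<in> dist U \<longleftrightarrow> (\<exists>u v w. (u, v, w) \<in> dist T \<and> triangle_iso U (proj u, proj v, proj w) t)"
  unfolding triangle_iso_localization[symmetric]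
  by (auto simp: triangle_quotient_def shift_cat.extend_def tri_cat.fields_def)

lemma frac_arr [simp]: "\<lbrakk>s \<in> W; f \<in> arr T; src T s = src T f\<rbrakk> \<Longrightarrow> frac s f \<in> roofs T N // roof_equiv T N"
  unfolding fraction_def by (intro quotientI) simp

lemma arr_U_E:
  assumes "A \<in> arr U"
  obtains s f where "s \<in> W" "f \<in> arr T" "src T s = src T f" "A = frac s f"
  using assms by (auto simp: fraction_def elim!: quotientE)

lemma src_frac [simp]:
  assumes "s \<in> W" "f \<in> arr T" "src T s = src T f" shows "src U (frac s f) = tgt T s"
proof -
  have "(s, f) \<in> frac s f" using roof_equiv_refl[of s f] assms by (simp add: in_frac_iff)
  from image_constant[OF this, of "tgt T s"] have "(\<lambda>(s, f). tgt T s) ` frac s f = {tgt T s}"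
    by (subst image_cong[OF refl, of _ _ "\<lambda>_. tgt T s"]) (auto simp: in_frac_iff roof_equiv_def)
  then show ?thesis
    by (simp add: triangle_quotient_def localization_def shift_cat.extend_def tri_cat.fields_def)
qed

lemma tgt_frac [simp]:
  assumes "s \<in> W" "f \<in> arr T" "src T s = src T f" shows "tgt U (frac s f) = tgt T f"
proof -
  have "(s, f) \<in> frac s f" using roof_equiv_refl[of s f] assms by (simp add: in_frac_iff)
  from image_constant[OF this, of "tgt T f"] have "(\<lambda>(s, f). tgt T f) ` frac s f = {tgt T f}"
    by (subst image_cong[OF refl, of _ _ "\<lambda>_. tgt T f"]) (auto simp: in_frac_iff roof_equiv_def)
  then show ?thesis
    by (simp add: triangle_quotient_def localization_def shift_cat.extend_def tri_cat.fields_def)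
qed

lemma Hom_U_E:
  assumes "A \<in> Hom U X Y"
  obtains s f where "s \<in> W" "f \<in> arr T" "src T s = src T f" "tgt T s = X" "tgt T f = Y" "A = frac s f"
proof -
  have "A \<in> arr U" using assms by simp
  then obtain s f where s: "s \<in> W" "f \<in> arr T" "src T s = src T f" "A = frac s f" by (rule arr_U_E)
  then show ?thesis using that assms by simp
qed

text \<open>Changes of both representatives and of the completion are treated at once:
  \<open>p\<close> and \<open>p1\<close> carry the witness of the first equivalence to the two
  completions, \<open>r\<close> merges them, and \<open>roof_equiv_agree\<close> for the second pair
  of roofs supplies \<open>y\<close>.\<close>

lemma comp_U_indep:
  assumes "((s, f), (s1, f1)) \<in> roof_equiv T N" "((t, g), (t1, g1)) \<in> roof_equiv T N"
    "tgt T f = tgt T t"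
    "t' \<in> W" "f' \<in> arr T" "src T t' = src T f'" "tgt T t' = src T f" "tgt T f' = src T t" "f \<cdot> t' = t \<cdot> f'"
    "t1' \<in> W" "f1' \<in> arr T" "src T t1' = src T f1'" "tgt T t1' = src T f1" "tgt T f1' = src T t1"
    "f1 \<cdot> t1' = t1 \<cdot> f1'"
  shows "frac (s \<cdot> t') (g \<cdot> f') = frac (s1 \<cdot> t1') (g1 \<cdot> f1')"
proof -
  obtain a a1 where 1: "s \<in> W" "s1 \<in> W" "f \<in> arr T" "f1 \<in> arr T" "src T s = src T f" "src T s1 = src T f1"
    "tgt T s = tgt T s1" "tgt T f = tgt T f1" "a \<in> arr T" "a1 \<in> arr T" "src T a = src T a1"
    "tgt T a = src T f" "tgt T a1 = src T f1" and e1: "s \<cdot> a = s1 \<cdot> a1" "f \<cdot> a = f1 \<cdot> a1"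
    and W1: "s \<cdot> a \<in> W"
    using assms(1) by (rule roof_equivE)
  have 2: "t \<in> W" "t1 \<in> W" "g \<in> arr T" "g1 \<in> arr T" "src T t = src T g" "src T t1 = src T g1"
    "tgt T t = tgt T t1" "tgt T g = tgt T g1"
    using assms(2) by (auto elim!: roof_equivE)
  note ty = 1 2 assms(3-8,10-14)
  obtain p p' where p: "p \<in> W" "p' \<in> arr T" "tgt T p = src T a1" "src T p' = src T p"
    "tgt T p' = src T f'" and ep: "a \<cdot> p = t' \<cdot> p'"
    by (rule ore[of a t']) (use ty in simp_all)
  obtain p1 p1' where p1: "p1 \<in> W" "p1' \<in> arr T" "tgt T p1 = src T a1" "src T p1' = src T p1"
    "tgt T p1' = src T f1'" and ep1: "a1 \<cdot> p1 = t1' \<cdot> p1'"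
    by (rule ore[of a1 t1']) (use ty in simp_all)
  obtain r r1 where r: "r \<in> W" "r1 \<in> arr T" "tgt T r = src T p" "src T r1 = src T r"
    "tgt T r1 = src T p1" and er: "p \<cdot> r = p1 \<cdot> r1"
    by (rule ore[of p p1]) (use ty p p1 in simp_all)
  note ty = ty p p1 r
  have A: "t' \<cdot> (p' \<cdot> r) = a \<cdot> (p \<cdot> r)"
    by (rule comp_eq_extend[OF ep[symmetric]]) (use ty in simp_all)
  have A1: "t1' \<cdot> (p1' \<cdot> r1) = a1 \<cdot> (p \<cdot> r)"
    unfolding er by (rule comp_eq_extend[OF ep1[symmetric]]) (use ty in simp_all)
  define x where "x = f' \<cdot> (p' \<cdot> r)"
  define x1 where "x1 = f1' \<cdot> (p1' \<cdot> r1)"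
  have x: "x \<in> arr T" "src T x = src T r" "tgt T x = src T t" "x1 \<in> arr T" "src T x1 = src T r"
    "tgt T x1 = src T t1" using ty by (simp_all add: x_def x1_def)
  have "t \<cdot> x = f \<cdot> (t' \<cdot> (p' \<cdot> r))"
    unfolding x_def by (rule comp_eq_extend[OF assms(9)[symmetric]]) (use ty in simp_all)
  also have "\<dots> = f1 \<cdot> (a1 \<cdot> (p \<cdot> r))"
    unfolding A by (rule comp_eq_extend[OF e1(2)]) (use ty in simp_all)
  also have "\<dots> = t1 \<cdot> x1"
    unfolding A1[symmetric] x1_def by (rule comp_eq_extend[OF assms(15)]) (use ty in simp_all)
  finally have tx: "t \<cdot> x = t1 \<cdot> x1" .
  obtain y where y: "y \<in> W" "tgt T y = src T x1" and ey: "g \<cdot> (x \<cdot> y) = g1 \<cdot> (x1 \<cdot> y)"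
    by (rule roof_equiv_agree[OF assms(2) _ _ _ _ _ tx]) (use x in simp_all)
  have y2: "tgt T y = src T r" using y x by simp
  note ty = ty y(1) y2
  have sa: "s \<cdot> (a \<cdot> (p \<cdot> (r \<cdot> y))) = s1 \<cdot> (a1 \<cdot> (p \<cdot> (r \<cdot> y)))"
    by (rule comp_eq_extend[OF e1(1)]) (use ty in simp_all)
  have "(t' \<cdot> (p' \<cdot> r)) \<cdot> y = (a \<cdot> (p \<cdot> r)) \<cdot> y" unfolding A ..
  then have B: "t' \<cdot> (p' \<cdot> (r \<cdot> y)) = a \<cdot> (p \<cdot> (r \<cdot> y))" using ty by simp
  have "(t1' \<cdot> (p1' \<cdot> r1)) \<cdot> y = (a1 \<cdot> (p \<cdot> r)) \<cdot> y" unfolding A1 ..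
  then have B1: "t1' \<cdot> (p1' \<cdot> (r1 \<cdot> y)) = a1 \<cdot> (p \<cdot> (r \<cdot> y))" using ty by simp
  have "(s \<cdot> a) \<cdot> (p \<cdot> (r \<cdot> y)) \<in> W" by (rule W_comp) (use W1 ty in simp_all)
  then have w: "s \<cdot> (a \<cdot> (p \<cdot> (r \<cdot> y))) \<in> W" using ty by simp
  have gx: "g \<cdot> (f' \<cdot> (p' \<cdot> (r \<cdot> y))) = g1 \<cdot> (f1' \<cdot> (p1' \<cdot> (r1 \<cdot> y)))"
    using ey ty unfolding x_def x1_def by simp
  show ?thesis
    by (rule frac_eqI[of _ _ _ _ "p' \<cdot> (r \<cdot> y)" "p1' \<cdot> (r1 \<cdot> y)"])
      (use ty w sa gx in \<open>simp_all add: B B1\<close>)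
qed

text \<open>The union defining the composite runs over a singleton. Each later computation is thus
  free to choose the completion that suits it.\<close>

lemma comp_frac:
  assumes "s \<in> W" "f \<in> arr T" "src T s = src T f" "t \<in> W" "g \<in> arr T" "src T t = src T g" "tgt T f = tgt T t"
    "t' \<in> W" "f' \<in> arr T" "src T t' = src T f'" "tgt T t' = src T f" "tgt T f' = src T t" "f \<cdot> t' = t \<cdot> f'"
  shows "frac t g \<bullet> frac s f = frac (s \<cdot> t') (g \<cdot> f')"
proof -
  have "comp U (frac t g) (frac s f) = \<Union>{frac (s1 \<cdot> t1') (g1 \<cdot> f1') | s1 f1 t1 g1 t1' f1'.
        (s1, f1) \<in> frac s f \<and> (t1, g1) \<in> frac t g \<and> t1' \<in> W \<and> f1' \<in> arr T \<and>
        src T t1' = src T f1' \<and> tgt T t1' = src T f1 \<and> tgt T f1' = src T t1 \<and>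
        f1 \<cdot> t1' = t1 \<cdot> f1'}" (is "_ = \<Union>?S")
    by (simp add: triangle_quotient_def localization_def shift_cat.extend_def tri_cat.fields_def)
  also have "?S = {frac (s \<cdot> t') (g \<cdot> f')}"
  proof (intro equalityI subsetI)
    fix A assume "A \<in> ?S"
    then obtain s1 f1 t1 g1 t1' f1' where A: "A = frac (s1 \<cdot> t1') (g1 \<cdot> f1')"
      "((s, f), (s1, f1)) \<in> roof_equiv T N" "((t, g), (t1, g1)) \<in> roof_equiv T N" "t1' \<in> W" "f1' \<in> arr T"
        "src T t1' = src T f1'" "tgt T t1' = src T f1" "tgt T f1' = src T t1"
        "f1 \<cdot> t1' = t1 \<cdot> f1'" unfolding in_frac_iff by blast
    show "A \<in> {frac (s \<cdot> t') (g \<cdot> f')}"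
      using comp_U_indep[OF A(2,3) assms(7-13) A(4-9)] A(1) by simp
  next
    fix A assume "A \<in> {frac (s \<cdot> t') (g \<cdot> f')}"
    moreover have "(s, f) \<in> frac s f" "(t, g) \<in> frac t g"
      unfolding in_frac_iff using assms by (auto intro: roof_equiv_refl)
    ultimately show "A \<in> ?S" using assms(8-13) by blast
  qed
  finally show ?thesis by simp
qed

text \<open>The two equivalences have unrelated witnesses. Over a common refinement of the
  denominators, \<open>y\<close> aligns the first numerators and \<open>z\<close> then the second
  ones.\<close>

lemma madd_U_indep:
  assumes "((s, f), (t, f')) \<in> roof_equiv T N" "((s, g), (t, g')) \<in> roof_equiv T N" "tgt T f = tgt T g"
  shows "frac s (madd T f g) = frac t (madd T f' g')"
proof -
  have ty: "s \<in> W" "t \<in> W" "f \<in> arr T" "f' \<in> arr T" "src T s = src T g" "src T f = src T g"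
    "src T t = src T g'" "src T f' = src T g'" "tgt T s = tgt T t" "tgt T f = tgt T g"
    "tgt T f' = tgt T g'" "g \<in> arr T" "g' \<in> arr T" "tgt T g = tgt T g'"
    using assms by (auto elim!: roof_equivE)
  obtain r r' where r: "r \<in> W" "r' \<in> arr T" "tgt T r = src T g" "src T r' = src T r"
    "tgt T r' = src T g'" and er: "s \<cdot> r = t \<cdot> r'"
    by (rule ore[of s t]) (use ty in simp_all)
  note ty = ty r
  obtain y where y: "y \<in> W" "tgt T y = src T r'" and ey: "f \<cdot> (r \<cdot> y) = f' \<cdot> (r' \<cdot> y)"
    by (rule roof_equiv_agree[OF assms(1) _ _ _ _ _ er]) (use ty in simp_all)
  have y2: "tgt T y = src T r" using y ty by simp
  note ty = ty y(1) y2
  have es: "s \<cdot> (r \<cdot> y) = t \<cdot> (r' \<cdot> y)"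
    by (rule comp_eq_extend[OF er]) (use ty in simp_all)
  obtain z where z: "z \<in> W" "tgt T z = src T (r' \<cdot> y)"
    and ez: "g \<cdot> ((r \<cdot> y) \<cdot> z) = g' \<cdot> ((r' \<cdot> y) \<cdot> z)"
    by (rule roof_equiv_agree[OF assms(2) _ _ _ _ _ es]) (use ty in simp_all)
  have z2: "tgt T z = src T y" using z ty by simp
  note ty = ty z(1) z2
  have ez': "g \<cdot> (r \<cdot> (y \<cdot> z)) = g' \<cdot> (r' \<cdot> (y \<cdot> z))" using ez ty by simp
  have "(f \<cdot> (r \<cdot> y)) \<cdot> z = (f' \<cdot> (r' \<cdot> y)) \<cdot> z" unfolding ey ..
  then have ey': "f \<cdot> (r \<cdot> (y \<cdot> z)) = f' \<cdot> (r' \<cdot> (y \<cdot> z))" using ty by simp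
  have er': "s \<cdot> (r \<cdot> (y \<cdot> z)) = t \<cdot> (r' \<cdot> (y \<cdot> z))"
    by (rule comp_eq_extend[OF er]) (use ty in simp_all)
  have "s \<cdot> (r \<cdot> (y \<cdot> z)) \<in> W" using ty by simp
  then show ?thesis
    by (intro frac_eqI[of _ _ _ _ "r \<cdot> (y \<cdot> z)" "r' \<cdot> (y \<cdot> z)"])
      (use ty er' ey' ez' in \<open>simp_all add: comp_madd_left\<close>)
qed

lemma madd_frac:
  assumes "s \<in> W" "f \<in> arr T" "g \<in> arr T" "src T s = src T g" "src T f = src T g" "tgt T f = tgt T g"
  shows "madd U (frac s f) (frac s g) = frac s (madd T f g)"
proof -
  have "madd U (frac s f) (frac s g) = \<Union>{frac t (madd T f' g') | t f' g'.
      (t, f') \<in> frac s f \<and> (t, g') \<in> frac s g}" (is "_ = \<Union>?S")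
    by (simp add: triangle_quotient_def localization_def shift_cat.extend_def tri_cat.fields_def)
  also have "?S = {frac s (madd T f g)}"
  proof (intro equalityI subsetI)
    fix A assume "A \<in> ?S"
    then obtain t f' g' where A: "A = frac t (madd T f' g')"
      "((s, f), (t, f')) \<in> roof_equiv T N" "((s, g), (t, g')) \<in> roof_equiv T N"
      unfolding in_frac_iff by blast
    show "A \<in> {frac s (madd T f g)}"
      using madd_U_indep[OF A(2,3) assms(6)] A(1) by simp
  next
    fix A assume "A \<in> {frac s (madd T f g)}"
    moreover have "(s, f) \<in> frac s f" "(s, g) \<in> frac s g"
      unfolding in_frac_iff using assms by (auto intro: roof_equiv_refl)
    ultimately show "A \<in> ?S" by blast
  qed
  finally show ?thesis by simp
qed

text \<open>Refines one given roof to accommodate a further arrow with the same source; used once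
  for pairs of arrows and twice for triples, as the group laws require.\<close>

lemma common_denominator:
  assumes "s \<in> W" "f \<in> arr T" "src T s = src T f" "A \<in> Hom U (tgt T s) Y"
  obtains r g where "r \<in> W" "tgt T r = src T f" "g \<in> Hom T (src T r) Y" "frac s f = frac (s \<cdot> r) (f \<cdot> r)"
    "A = frac (s \<cdot> r) g"
proof -
  obtain t g where t: "t \<in> W" "g \<in> arr T" "src T t = src T g" "tgt T t = tgt T s" "tgt T g = Y" "A = frac t g"
    using assms(4) by (rule Hom_U_E)
  obtain r r' where r: "r \<in> W" "r' \<in> arr T" "tgt T r = src T s" "src T r' = src T r"
    "tgt T r' = src T t" "s \<cdot> r = t \<cdot> r'"
    by (rule ore[of s t]) (use t assms in simp_all)
  have sr: "s \<cdot> r \<in> W" by (rule W_comp) (use r(1-5) assms in simp_all)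
  have "A = frac (t \<cdot> r') (g \<cdot> r')"
    unfolding t(6) by (rule frac_refine) (use r t(1-5) assms sr[unfolded r(6)] in simp_all)
  moreover have "frac s f = frac (s \<cdot> r) (f \<cdot> r)"
    by (rule frac_refine) (use r(1-5) assms sr in simp_all)
  ultimately show ?thesis
    by (intro that[of r "g \<cdot> r'"]) (use r t(1-5) assms(1-3) in simp_all)
qed

lemma Hom_U_pair:
  assumes "A \<in> Hom U X Y" "B \<in> Hom U X Y'"
  obtains s f g where "s \<in> W" "f \<in> arr T" "g \<in> arr T" "src T s = src T g" "src T f = src T g" "tgt T s = X"
    "tgt T f = Y" "tgt T g = Y'" "A = frac s f" "B = frac s g"
proof -
  obtain s f where s: "s \<in> W" "f \<in> arr T" "src T s = src T f" "tgt T s = X" "tgt T f = Y" "A = frac s f"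
    using assms(1) by (rule Hom_U_E)
  obtain r g where r: "r \<in> W" "tgt T r = src T f" "g \<in> Hom T (src T r) Y'" "frac s f = frac (s \<cdot> r) (f \<cdot> r)"
    "B = frac (s \<cdot> r) g"
    by (rule common_denominator[OF s(1-3)]) (use assms(2) s(4) in blast)+
  show ?thesis using that[of "s \<cdot> r" "f \<cdot> r" g] s r by simp
qed

lemma Hom_U_triple:
  assumes "A \<in> Hom U X Y" "B \<in> Hom U X Y" "C \<in> Hom U X Y"
  obtains s f g h where "s \<in> W" "f \<in> arr T" "g \<in> arr T" "h \<in> arr T" "src T s = src T h" "src T f = src T h"
    "src T g = src T h" "tgt T s = X" "tgt T f = Y" "tgt T g = Y" "tgt T h = Y" "A = frac s f"
    "B = frac s g" "C = frac s h"
proof -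
  obtain s f g where s: "s \<in> W" "f \<in> arr T" "g \<in> arr T" "src T s = src T g" "src T f = src T g" "tgt T s = X"
    "tgt T f = Y" "tgt T g = Y" "A = frac s f" "B = frac s g"
    using assms(1,2) by (rule Hom_U_pair)
  obtain r h where r: "r \<in> W" "tgt T r = src T f" "h \<in> Hom T (src T r) Y" "frac s f = frac (s \<cdot> r) (f \<cdot> r)"
    "C = frac (s \<cdot> r) h"
    by (rule common_denominator[of s f C Y]) (use assms(3) s(1-8) in \<open>simp; fail\<close>)+
  have "frac s g = frac (s \<cdot> r) (g \<cdot> r)"
    by (rule frac_refine) (use r s in simp_all)
  then show ?thesis using that[of "s \<cdot> r" "f \<cdot> r" "g \<cdot> r" h] s r by simp
qed

lemma proj_def: "proj f = frac (idt T (src T f)) f"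
  by (simp add: proj_arr_def)

lemma frac_0:
  assumes "s \<in> W" "src T s = X" "Y \<in> obj T" shows "frac s (mzero T X Y) = mzero U (tgt T s) Y"
  unfolding U_fields proj_def
  by (rule frac_eqI[of _ _ _ _ "idt T X" s]) (use assms src_obj[of s] in auto)

lemma frac_idt: assumes "s \<in> W" shows "frac s s = idt U (tgt T s)"
  unfolding U_fields proj_def
  by (rule frac_eqI[of _ _ _ _ "idt T (src T s)" s]) (use assms in auto)

lemma frac_Hom: "\<lbrakk>s \<in> W; f \<in> arr T; src T s = src T f; tgt T s = X; tgt T f = Y\<rbrakk> \<Longrightarrow> frac s f \<in> Hom U X Y"
  by simp

lemma comp_U_Hom:
  assumes "A \<in> Hom U X Y" "B \<in> Hom U Y Z"
  shows "B \<bullet> A \<in> Hom U X Z"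
proof -
  obtain s f where s: "s \<in> W" "f \<in> arr T" "src T s = src T f" "tgt T s = X" "tgt T f = Y" "A = frac s f"
    using assms(1) by (rule Hom_U_E)
  obtain t g where t: "t \<in> W" "g \<in> arr T" "src T t = src T g" "tgt T t = Y" "tgt T g = Z" "B = frac t g"
    using assms(2) by (rule Hom_U_E)
  obtain t' f' where r: "t' \<in> W" "f' \<in> arr T" "tgt T t' = src T f" "src T f' = src T t'"
    "tgt T f' = src T t" "f \<cdot> t' = t \<cdot> f'"
    by (rule ore[of f t]) (use s t in simp_all)
  have "B \<bullet> A = frac (s \<cdot> t') (g \<cdot> f')"
    unfolding s(6) t(6) by (rule comp_frac) (use s r t in simp_all)
  then show ?thesis using s t r by simp
qed

lemma comp_U_assoc:
  assumes "A \<in> Hom U X Y" "B \<in> Hom U Y Z" "C \<in> Hom U Z V"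
  shows "C \<bullet> (B \<bullet> A) = (C \<bullet> B) \<bullet> A"
proof -
  obtain s f where s: "s \<in> W" "f \<in> arr T" "src T s = src T f" "tgt T s = X" "tgt T f = Y" "A = frac s f"
    using assms(1) by (rule Hom_U_E)
  obtain t g where t: "t \<in> W" "g \<in> arr T" "src T t = src T g" "tgt T t = Y" "tgt T g = Z" "B = frac t g"
    using assms(2) by (rule Hom_U_E)
  obtain u h where u: "u \<in> W" "h \<in> arr T" "src T u = src T h" "tgt T u = Z" "tgt T h = V" "C = frac u h"
    using assms(3) by (rule Hom_U_E)
  obtain u1 g1 where 1: "u1 \<in> W" "g1 \<in> arr T" "tgt T u1 = src T g" "src T g1 = src T u1"
    "tgt T g1 = src T u" and e1: "g \<cdot> u1 = u \<cdot> g1"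
    by (rule ore[of g u]) (use u t in simp_all)
  obtain x y where 2: "x \<in> W" "y \<in> arr T" "tgt T x = src T f" "src T y = src T x"
    "tgt T y = src T (t \<cdot> u1)" and e2: "f \<cdot> x = (t \<cdot> u1) \<cdot> y"
    by (rule ore[of f "t \<cdot> u1"]) (use s t 1 in simp_all)
  have 3: "tgt T y = src T u1" using 2 1 t by simp
  note ty = s(1-5) t(1-5) u(1-5) 1 2(1-4) 3
  have e2': "f \<cdot> x = t \<cdot> (u1 \<cdot> y)" using e2 ty by simp
  have CB: "C \<bullet> B = frac (t \<cdot> u1) (h \<cdot> g1)"
    unfolding t(6) u(6) by (rule comp_frac) (use ty e1 in simp_all)
  have CBA: "(C \<bullet> B) \<bullet> A = frac (s \<cdot> x) ((h \<cdot> g1) \<cdot> y)"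
    unfolding CB s(6) by (rule comp_frac) (use ty e2 in simp_all)
  have BA: "B \<bullet> A = frac (s \<cdot> x) (g \<cdot> (u1 \<cdot> y))"
    unfolding t(6) s(6) by (rule comp_frac) (use ty e2' in simp_all)
  have e3: "g \<cdot> (u1 \<cdot> y) = u \<cdot> (g1 \<cdot> y)"
    by (rule comp_eq_extend[OF e1]) (use ty in simp_all)
  have "C \<bullet> (B \<bullet> A) = frac ((s \<cdot> x) \<cdot> idt T (src T x)) (h \<cdot> (g1 \<cdot> y))"
    unfolding BA u(6) by (rule comp_frac) (use ty e3 in simp_all)
  then show ?thesis unfolding CBA using ty by simp
qed

lemma comp_U_madd_right:
  assumes "A \<in> Hom U X Y" "A' \<in> Hom U X Y" "B \<in> Hom U Y Z"
  shows "B \<bullet> madd U A A' = madd U (B \<bullet> A) (B \<bullet> A')"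
proof -
  obtain s f f' where s: "s \<in> W" "f \<in> arr T" "f' \<in> arr T" "src T s = src T f'" "src T f = src T f'"
    "tgt T s = X" "tgt T f = Y" "tgt T f' = Y" "A = frac s f" "A' = frac s f'"
    using assms(1,2) by (rule Hom_U_pair)
  obtain t g where t: "t \<in> W" "g \<in> arr T" "src T t = src T g" "tgt T t = Y" "tgt T g = Z" "B = frac t g"
    using assms(3) by (rule Hom_U_E)
  obtain t1 k1 where 1: "t1 \<in> W" "k1 \<in> arr T" "tgt T t1 = src T f" "src T k1 = src T t1"
    "tgt T k1 = src T t" and e1: "f \<cdot> t1 = t \<cdot> k1"
    by (rule ore[of f t]) (use s t in simp_all)
  \<comment> \<open>The second square starts from \<open>f' \<cdot> t1\<close> and not from
    \<open>f'\<close>, so that \<open>t1 \<cdot> t2\<close> completes both composites at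
    once.\<close>
  obtain t2 k2 where 2: "t2 \<in> W" "k2 \<in> arr T" "tgt T t2 = src T (f' \<cdot> t1)" "src T k2 = src T t2"
    "tgt T k2 = src T t" and e2: "(f' \<cdot> t1) \<cdot> t2 = t \<cdot> k2"
    by (rule ore[of "f' \<cdot> t1" t]) (use s t 1 in simp_all)
  have 3: "tgt T t2 = src T t1" using 2 1 s by simp
  note ty = s(1-8) t(1-5) 1 2(1,2,4,5) 3
  have a: "f \<cdot> (t1 \<cdot> t2) = t \<cdot> (k1 \<cdot> t2)"
    by (rule comp_eq_extend[OF e1]) (use ty in simp_all)
  have b: "f' \<cdot> (t1 \<cdot> t2) = t \<cdot> k2" using e2 ty by simp
  have A: "B \<bullet> A = frac (s \<cdot> (t1 \<cdot> t2)) (g \<cdot> (k1 \<cdot> t2))"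
    unfolding s(9) t(6) by (rule comp_frac) (use ty a in simp_all)
  have A': "B \<bullet> A' = frac (s \<cdot> (t1 \<cdot> t2)) (g \<cdot> k2)"
    unfolding s(10) t(6) by (rule comp_frac) (use ty b in simp_all)
  have "madd U A A' = frac s (madd T f f')" unfolding s(9,10) by (rule madd_frac) (use ty in simp_all)
  also have "B \<bullet> \<dots> = frac (s \<cdot> (t1 \<cdot> t2)) (g \<cdot> madd T (k1 \<cdot> t2) k2)"
    unfolding t(6) by (rule comp_frac) (use ty a b in \<open>simp_all add: comp_madd_left comp_madd_right\<close>)
  also have "\<dots> = madd U (B \<bullet> A) (B \<bullet> A')"
    unfolding A A' by (subst madd_frac) (use ty in \<open>simp_all add: comp_madd_right\<close>)
  finally show ?thesis .
qed

lemma comp_U_madd_left: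
  assumes "A \<in> Hom U X Y" "B \<in> Hom U Y Z" "B' \<in> Hom U Y Z"
  shows "madd U B B' \<bullet> A = madd U (B \<bullet> A) (B' \<bullet> A)"
proof -
  obtain t g g' where t: "t \<in> W" "g \<in> arr T" "g' \<in> arr T" "src T t = src T g'" "src T g = src T g'"
    "tgt T t = Y" "tgt T g = Z" "tgt T g' = Z" "B = frac t g" "B' = frac t g'"
    using assms(2,3) by (rule Hom_U_pair)
  obtain s f where s: "s \<in> W" "f \<in> arr T" "src T s = src T f" "tgt T s = X" "tgt T f = Y" "A = frac s f"
    using assms(1) by (rule Hom_U_E)
  obtain t1 k1 where 1: "t1 \<in> W" "k1 \<in> arr T" "tgt T t1 = src T f" "src T k1 = src T t1"
    "tgt T k1 = src T t" and e1: "f \<cdot> t1 = t \<cdot> k1"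
    by (rule ore[of f t]) (use s t in simp_all)
  note ty = s(1-5) t(1-8) 1
  have A: "B \<bullet> A = frac (s \<cdot> t1) (g \<cdot> k1)"
    unfolding s(6) t(9) by (rule comp_frac) (use ty e1 in simp_all)
  have A': "B' \<bullet> A = frac (s \<cdot> t1) (g' \<cdot> k1)"
    unfolding s(6) t(10) by (rule comp_frac) (use ty e1 in simp_all)
  have "madd U B B' = frac t (madd T g g')" unfolding t(9,10) by (rule madd_frac) (use ty in simp_all)
  also have "\<dots> \<bullet> A = frac (s \<cdot> t1) (madd T g g' \<cdot> k1)"
    unfolding s(6) by (rule comp_frac) (use ty e1 in simp_all)
  also have "\<dots> = madd U (B \<bullet> A) (B' \<bullet> A)"
    unfolding A A' by (subst madd_frac) (use ty in \<open>simp_all add: comp_madd_left\<close>)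
  finally show ?thesis .
qed

lemma comp_U_idt:
  assumes "A \<in> Hom U X Y" shows "A \<bullet> idt U X = A" "idt U Y \<bullet> A = A"
proof -
  obtain s f where s: "s \<in> W" "f \<in> arr T" "src T s = src T f" "tgt T s = X" "tgt T f = Y" "A = frac s f"
    using assms(1) by (rule Hom_U_E)
  have X: "X \<in> obj T" "Y \<in> obj T" using s by auto
  have i: "idt U Z = frac (idt T Z) (idt T Z)" if "Z \<in> obj T" for Z
    using that by (simp add: proj_def)
  have "A \<bullet> idt U X = frac (idt T X \<cdot> s) (f \<cdot> idt T (src T s))"
    unfolding s(6) i[OF X(1)]
    by (rule comp_frac) (use s(1-5) X in simp_all)
  then show "A \<bullet> idt U X = A" using s by simp
  have "idt U Y \<bullet> A = frac (s \<cdot> idt T (src T f)) (idt T Y \<cdot> f)"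
    unfolding s(6) i[OF X(2)]
    by (rule comp_frac) (use s(1-5) X in simp_all)
  then show "idt U Y \<bullet> A = A" using s by simp
qed

lemma hom_group_U: assumes "X \<in> obj T" "Y \<in> obj T" shows "comm_group (hom_group U X Y)"
proof (rule comm_groupI, unfold hom_group_def, simp_all only: partial_object.simps monoid.simps)
  have zX: "mzero T X Y \<in> arr T" "src T (mzero T X Y) = X" using assms by auto
  show "mzero U X Y \<in> Hom U X Y" using assms by (simp add: proj_def)
  fix A B C
  assume A: "A \<in> Hom U X Y"
  {
    assume B: "B \<in> Hom U X Y"
    obtain s f g where s: "s \<in> W" "f \<in> arr T" "g \<in> arr T" "src T s = src T g" "src T f = src T g"
      "tgt T s = X" "tgt T f = Y" "tgt T g = Y" "A = frac s f" "B = frac s g"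
      using A B by (rule Hom_U_pair)
    have 1: "madd U A B = frac s (madd T f g)" unfolding s(9,10) by (rule madd_frac) (use s in simp_all)
    then show "madd U A B \<in> Hom U X Y" using s by simp
    have "madd U B A = frac s (madd T g f)" unfolding s(9,10) by (rule madd_frac) (use s in simp_all)
    then show "madd U A B = madd U B A" using 1 madd_comm[of f g] s by simp
    assume C: "C \<in> Hom U X Y"
    obtain s f g h where s: "s \<in> W" "f \<in> arr T" "g \<in> arr T" "h \<in> arr T" "src T s = src T h"
      "src T f = src T h" "src T g = src T h" "tgt T s = X" "tgt T f = Y" "tgt T g = Y" "tgt T h = Y"
      "A = frac s f" "B = frac s g" "C = frac s h"
      using A B C by (rule Hom_U_triple)
    show "madd U (madd U A B) C = madd U A (madd U B C)"
      unfolding s(12-14) using s(1-11) by (simp add: madd_frac madd_assoc)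
  }
  obtain s f where s: "s \<in> W" "f \<in> arr T" "src T s = src T f" "tgt T s = X" "tgt T f = Y" "A = frac s f"
    using A by (rule Hom_U_E)
  have 0: "mzero U X Y = frac s (mzero T (src T s) Y)" using frac_0[of s "src T s" Y] s assms by simp
  show "madd U (mzero U X Y) A = A" unfolding 0 s(6) using s(1-5) assms by (simp add: madd_frac)
  have "madd U (frac s (mneg T f)) A = mzero U X Y"
    unfolding 0 s(6) using s(1-5) assms by (simp add: madd_frac)
  moreover have "frac s (mneg T f) \<in> Hom U X Y" using s by simp
  ultimately show "\<exists>y\<in>Hom U X Y. madd U y A = mzero U X Y" by blast
qed

section \<open>The projection and the shift on fractions\<close>

lemma proj_arr [simp]: "f \<in> arr T \<Longrightarrow> proj f \<in> roofs T N // roof_equiv T N"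
  and src_proj [simp]: "f \<in> arr T \<Longrightarrow> src U (proj f) = src T f"
  and tgt_proj [simp]: "f \<in> arr T \<Longrightarrow> tgt U (proj f) = tgt T f"
  unfolding proj_def by simp_all

lemma proj_Hom: "f \<in> Hom T X Y \<Longrightarrow> proj f \<in> Hom U X Y"
  by simp

lemma proj_comp: assumes "f \<in> Hom T X Y" "g \<in> Hom T Y Z" shows "proj (g \<cdot> f) = proj g \<bullet> proj f"
proof -
  have o: "X \<in> obj T" "Y \<in> obj T" using assms by auto
  have p: "proj f = frac (idt T X) f" "proj g = frac (idt T Y) g"
    using assms by (simp_all add: proj_def)
  have "proj g \<bullet> proj f = frac (idt T X \<cdot> idt T X) (g \<cdot> f)"
    unfolding p by (rule comp_frac) (use assms o in simp_all)
  moreover have "proj (g \<cdot> f) = frac (idt T X) (g \<cdot> f)" using assms by (simp add: proj_def)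
  ultimately show ?thesis using o by simp
qed

lemma proj_madd: "\<lbrakk>f \<in> Hom T X Y; g \<in> Hom T X Y\<rbrakk> \<Longrightarrow> proj (madd T f g) = madd U (proj f) (proj g)"
  unfolding proj_def by (subst madd_frac[symmetric]) auto

lemma proj_direct_sum: assumes "direct_sum T X Y S" shows "direct_sum U X Y S"
proof -
  obtain i j p q where 1: "i \<in> Hom T X S" "j \<in> Hom T Y S" "p \<in> Hom T S X" "q \<in> Hom T S Y"
    and e: "p \<cdot> i = idt T X" "q \<cdot> j = idt T Y" "q \<cdot> i = mzero T X Y" "p \<cdot> j = mzero T Y X"
    "madd T (i \<cdot> p) (j \<cdot> q) = idt T S" using assms by (rule direct_sumE)
  have "proj p \<bullet> proj i = idt U X" using proj_comp[OF 1(1,3)] e by simp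
  moreover have "proj q \<bullet> proj j = idt U Y" using proj_comp[OF 1(2,4)] e by simp
  moreover have "proj q \<bullet> proj i = mzero U X Y" using proj_comp[OF 1(1,4)] e by simp
  moreover have "proj p \<bullet> proj j = mzero U Y X" using proj_comp[OF 1(2,3)] e by simp
  moreover have "madd U (proj i \<bullet> proj p) (proj j \<bullet> proj q) = idt U S"
    using proj_comp[OF 1(3,1)] proj_comp[OF 1(4,2)]
      proj_madd[OF comp_hom[OF 1(3,1)] comp_hom[OF 1(4,2)]] e by simp
  ultimately show ?thesis
    unfolding direct_sum_def using 1[THEN proj_Hom] by blast
qed

text \<open>Both denominators are identities, so \<open>roof_equiv_agree\<close> can be applied with
  identities and leaves the single refinement \<open>y\<close>.\<close>

lemma proj_eq_0D:
  assumes "g \<in> Hom T X Y" "proj g = mzero U X Y"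
  obtains y where "y \<in> W" "tgt T y = X" "g \<cdot> y = mzero T (src T y) Y"
proof -
  have o: "X \<in> obj T" "Y \<in> obj T" using assms by auto
  have "frac (idt T X) g = frac (idt T X) (mzero T X Y)" using assms o by (simp add: proj_def)
  then have e: "((idt T X, g), (idt T X, mzero T X Y)) \<in> roof_equiv T N"
    using frac_eq_iff[of "idt T X" g "idt T X" "mzero T X Y"] assms(1) o by simp
  obtain y where y: "y \<in> W" "tgt T y = src T (idt T X)" "g \<cdot> (idt T X \<cdot> y) = mzero T X Y \<cdot> (idt T X \<cdot> y)"
    by (rule roof_equiv_agree[OF e, of "idt T X" "idt T X"]) (use o assms(1) in simp_all)
  have yX: "tgt T y = X" using y o by simp
  then show ?thesis using that[OF y(1)] y o by simp
qed

text \<open>The shift of a class is its image under the shift of roofs, so it must be seen to be a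
  full class again: a roof equivalent to a shifted one is itself shifted, together with the witness,
  and \<open>W_sha\<close> brings the denominators back.\<close>

lemma sha_frac:
  assumes "s \<in> W" "f \<in> arr T" "src T s = src T f" shows "sha U (frac s f) = frac (sha T s) (sha T f)"
proof (intro equalityI subsetI)
  fix x assume "x \<in> sha U (frac s f)"
  then obtain t g where x: "x = (sha T t, sha T g)" "((s, f), (t, g)) \<in> roof_equiv T N"
    by (auto simp: in_frac_iff)
  obtain a b where 1: "s \<in> W" "t \<in> W" "f \<in> arr T" "g \<in> arr T" "src T s = src T f" "src T t = src T g"
    "tgt T s = tgt T t" "tgt T f = tgt T g" "a \<in> arr T" "b \<in> arr T" "src T a = src T b"
    "tgt T a = src T f" "tgt T b = src T g" and e: "s \<cdot> a = t \<cdot> b" "f \<cdot> a = g \<cdot> b" and w: "s \<cdot> a \<in> W"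
    using x(2) by (rule roof_equivE)
  have "sha T s \<cdot> sha T a = sha T t \<cdot> sha T b" "sha T f \<cdot> sha T a = sha T g \<cdot> sha T b"
    using arg_cong[OF e(1), of "sha T"] arg_cong[OF e(2), of "sha T"] 1 by simp_all
  moreover have "sha T s \<cdot> sha T a \<in> W" using W_sha[of "s \<cdot> a"] w 1 by simp
  ultimately have "((sha T s, sha T f), (sha T t, sha T g)) \<in> roof_equiv T N"
    by (intro roof_equivI[of _ _ _ _ "sha T a" "sha T b"]) (use 1 W_sha in simp_all)
  then show "x \<in> frac (sha T s) (sha T f)" by (simp add: x in_frac_iff)
next
  fix x assume "x \<in> frac (sha T s) (sha T f)"
  then obtain t g where x: "x = (t, g)" "((sha T s, sha T f), (t, g)) \<in> roof_equiv T N"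
    by (cases x) (auto simp: in_frac_iff)
  obtain a b where 1: "sha T s \<in> W" "t \<in> W" "sha T f \<in> arr T" "g \<in> arr T" "src T (sha T s) = src T (sha T f)"
    "src T t = src T g" "tgt T (sha T s) = tgt T t" "tgt T (sha T f) = tgt T g" "a \<in> arr T" "b \<in> arr T"
    "src T a = src T b" "tgt T a = src T (sha T f)" "tgt T b = src T g"
    and e: "sha T s \<cdot> a = t \<cdot> b" "sha T f \<cdot> a = g \<cdot> b" and w: "sha T s \<cdot> a \<in> W"
    using x(2) by (rule roof_equivE)
  obtain t' where t': "t' \<in> arr T" "t = sha T t'" using sha_full'[of t] 1 by auto
  obtain g' where g': "g' \<in> arr T" "g = sha T g'" using sha_full'[of g] 1 by auto
  obtain a' where a': "a' \<in> arr T" "a = sha T a'" using sha_full'[of a] 1 by auto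
  obtain b' where b': "b' \<in> arr T" "b = sha T b'" using sha_full'[of b] 1 by auto
  have i: "src T t' = src T g'" "tgt T s = tgt T t'" "tgt T f = tgt T g'" "src T a' = src T b'"
    "tgt T a' = src T f" "tgt T b' = src T g'"
    by (rule sho_inj; use 1 t' g' a' b' assms in simp)+
  note ty = assms t'(1) g'(1) a'(1) b'(1) i
  have "sha T (s \<cdot> a') = sha T (t' \<cdot> b')" "sha T (f \<cdot> a') = sha T (g' \<cdot> b')"
    using e ty t' g' a' b' by simp_all
  then have e': "s \<cdot> a' = t' \<cdot> b'" "f \<cdot> a' = g' \<cdot> b'"
    using sha_faithful[of "s \<cdot> a'" "t' \<cdot> b'"] sha_faithful[of "f \<cdot> a'" "g' \<cdot> b'"] ty by simp_all
  moreover have "s \<cdot> a' \<in> W" using W_sha[of "s \<cdot> a'"] w ty a' by simp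
  moreover have "t' \<in> W" using W_sha[of t'] 1(2) t' by simp
  ultimately have "((s, f), (t', g')) \<in> roof_equiv T N"
    by (intro roof_equivI[of _ _ _ _ a' b']) (use ty in simp_all)
  then have "(t', g') \<in> frac s f" by (simp add: in_frac_iff)
  from imageI[OF this, of "map_prod (sha T) (sha T)"] show "x \<in> sha U (frac s f)"
    unfolding U_fields x t'(2) g'(2) by simp
qed

lemma sha_U_bij:
  assumes "X \<in> obj T" "Y \<in> obj T"
  shows "bij_betw (sha U) (Hom U X Y) (Hom U (sho T X) (sho T Y))"
proof (rule bij_betw_imageI)
  have inj: "inj_on (map_prod (sha T) (sha T)) (arr T \<times> arr T)"
    using sha_faithful by (auto simp: inj_on_def)
  have sub: "A \<subseteq> arr T \<times> arr T" if "A \<in> Hom U X Y" for A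
    using that by (elim Hom_U_E) (auto simp: in_frac_iff elim!: roof_equivE)
  show "inj_on (sha U) (Hom U X Y)"
  proof (rule inj_onI)
    fix A B assume *: "A \<in> Hom U X Y" "B \<in> Hom U X Y" "sha U A = sha U B"
    then have "map_prod (sha T) (sha T) ` A = map_prod (sha T) (sha T) ` B" unfolding U_fields by simp
    then show "A = B" using inj_on_image_eq_iff[OF inj sub[OF *(1)] sub[OF *(2)]] by blast
  qed
  show "sha U ` Hom U X Y = Hom U (sho T X) (sho T Y)"
  proof (intro equalityI subsetI)
    fix B assume "B \<in> sha U ` Hom U X Y"
    then obtain A where A: "A \<in> Hom U X Y" "B = sha U A" by blast
    obtain s f where s: "s \<in> W" "f \<in> arr T" "src T s = src T f" "tgt T s = X" "tgt T f = Y" "A = frac s f"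
      using A(1) by (rule Hom_U_E)
    show "B \<in> Hom U (sho T X) (sho T Y)"
      unfolding A(2) s(6) sha_frac[OF s(1-3)] by (rule frac_Hom) (use s W_sha[of s] in simp_all)
  next
    fix B assume "B \<in> Hom U (sho T X) (sho T Y)"
    then obtain s f where s: "s \<in> W" "f \<in> arr T" "src T s = src T f" "tgt T s = sho T X"
      "tgt T f = sho T Y" "B = frac s f" by (rule Hom_U_E)
    obtain s' where s': "s' \<in> arr T" "s = sha T s'" using sha_full'[of s] s by auto
    obtain f' where f': "f' \<in> arr T" "f = sha T f'" using sha_full'[of f] s by auto
    have i: "src T s' = src T f'" "tgt T s' = X" "tgt T f' = Y"
      by (rule sho_inj; use s s' f' assms in simp)+
    have w: "s' \<in> W" using W_sha[of s'] s(1) s' by simp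
    have "B = sha U (frac s' f')" unfolding sha_frac[OF w f'(1) i(1)] s(6) s'(2) f'(2) ..
    moreover have "frac s' f' \<in> Hom U X Y" by (rule frac_Hom) (use w f' i in simp_all)
    ultimately show "B \<in> sha U ` Hom U X Y" by blast
  qed
qed

sublocale U: shift_additive_category U
proof (intro shift_additive_category.intro additive_category.intro shift_additive_category_axioms.intro)
  have *: "Hom U X Y = {mzero U X Y}"
    if z: "zero_object T Z" "Z = X \<or> Z = Y" and X: "X \<in> obj T" "Y \<in> obj T" for X Y Z
  proof -
    have "A = mzero U X Y" if A: "A \<in> Hom U X Y" for A
    proof -
      obtain s f where s: "s \<in> W" "f \<in> arr T" "src T s = src T f" "tgt T s = X" "tgt T f = Y" "A = frac s f"
        using A by (rule Hom_U_E)
      show ?thesis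
      proof (cases "Z = Y")
        case True
        then have "f = mzero T (src T f) Y"
          by (intro hom0D[OF zero_objectD(3)]) (use z s in auto)
        then show ?thesis using frac_0[of s "src T f" Y] s X by metis
      next
        \<comment> \<open>Here the source is zero, but the numerator starts at the top of the roof
          and need not vanish. Instead the identity of \<open>X\<close> equals its own double, so
          \<open>A = A + A\<close>.\<close>
        case False
        then have i: "idt T X = mzero T X X" using z zero_objectD(2) by auto
        define m where "m = mzero T X X"
        have "A = A \<bullet> idt U X" using comp_U_idt[OF A] by simp
        also have "idt U X = madd U (idt U X) (idt U X)"
        proof -
          have "madd U (proj m) (proj m) = proj (madd T m m)"
            by (rule proj_madd[symmetric]) (use X in \<open>auto simp: m_def\<close>)
          then show ?thesis using X i by (simp add: m_def)
        qed
        also have "A \<bullet> \<dots> = madd U A A"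
          using comp_U_madd_right[of "idt U X" X X "idt U X" A Y] comp_U_idt[OF A] A X by simp
        finally have AA: "madd U A A = A" by simp
        interpret comm_group "hom_group U X Y" by (rule hom_group_U[OF X])
        have "A \<otimes>\<^bsub>hom_group U X Y\<^esub> A = A" using AA by (simp add: hom_group_def)
        then have "A = \<one>\<^bsub>hom_group U X Y\<^esub>"
          using l_cancel_one'[of A A] A by (auto simp: hom_group_def)
        then show ?thesis by (simp add: hom_group_def)
      qed
    qed
    moreover have "mzero U X Y \<in> Hom U X Y" using X by simp
    ultimately show ?thesis by blast
  qed
  show "\<exists>Z. zero_object U Z"
  proof -
    obtain Z where Z: "zero_object T Z" using zero_object_exists by auto
    then show ?thesis unfolding zero_object_def[of U] using *[OF Z] zero_objectD(1)[OF Z]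
      by (metis U_fields(1))
  qed
  show "\<exists>S. direct_sum U X Y S" if "X \<in> obj U" "Y \<in> obj U" for X Y
    using that direct_sum_exists proj_direct_sum by (metis U_fields(1))
  show "src U f \<in> obj U \<and> tgt U f \<in> obj U" if "f \<in> arr U" for f
    using that by (elim arr_U_E) simp
  show "idt U X \<in> Hom U X X" if "X \<in> obj U" for X using that by simp
  show "comm_group (hom_group U X Y)" if "X \<in> obj U" "Y \<in> obj U" for X Y
    using that hom_group_U by simp
  show "f \<in> Hom U X Y \<Longrightarrow> f \<bullet> idt U X = f \<and> idt U Y \<bullet> f = f" for f X Y
    using comp_U_idt by blast
  show "bij_betw (sho U) (obj U) (obj U)" using shift_sho_bij by simp
  show "X \<in> obj U \<Longrightarrow> Y \<in> obj U \<Longrightarrow> bij_betw (sha U) (Hom U X Y) (Hom U (sho U X) (sho U Y))" for X Y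
    using sha_U_bij by (simp del: U_fields(6))
qed (rule comp_U_Hom comp_U_assoc comp_U_madd_left comp_U_madd_right; assumption)+

end

section \<open>Truncation along a presilting subcategory\<close>

locale silting_reduction = triangulated_category T
  for T :: "('o, 'a, 'b) tri_cat_scheme" (structure) and P :: "'o set" +
  assumes P_presilting: "presilting T P"
    and P_P1: "P1 T P"
    and P_P2: "P2 T P"
begin

lemma P_obj: "P \<subseteq> obj T"
  using P_presilting presilting_obj by auto

lemma P_sh [simp]: "Q \<in> P \<Longrightarrow> sh i Q \<in> obj T"
  using P_obj by auto

lemma P_hom0: "\<lbrakk>i < j; Q \<in> P; Q' \<in> P\<rbrakk> \<Longrightarrow> hom0 T (sh i Q) (sh j Q')"
  using presiltingD[OF P_presilting, of "j - i" Q Q'] hom0_shift(1)[of Q Q' i j] P_obj by auto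

sublocale verdier_quotient T "thick T P"
  by unfold_locales (use thick_triangulated[OF P_obj] thick_summand_closed in auto)

text \<open>Versions at every level of the two subcategories in (P1), which are the case of level 0.
  The intersection of \<open>left_perp 0\<close> and \<open>right_perp 0\<close> is
  \<open>Z\<close>.\<close>

definition left_perp :: "int \<Rightarrow> 'o set" where
  "left_perp l = {X \<in> obj T. \<forall>j>l. \<forall>Q\<in>P. hom0 T X (sh j Q)}"

definition right_perp :: "int \<Rightarrow> 'o set" where
  "right_perp l = {X \<in> obj T. \<forall>j<l. \<forall>Q\<in>P. hom0 T (sh j Q) X}"

lemma left_perp_0: "left_perp 0 = left_perp_pos T P"
  unfolding left_perp_def left_perp_pos_def using P_obj by (auto simp: hom_vanish_shift_iff)

lemma right_perp_0: "right_perp 0 = right_perp_neg T P"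
proof -
  have "hom_vanish T (sh j ` P) {X} \<longleftrightarrow> (\<forall>Q\<in>P. hom0 T (sh j Q) X)" if "X \<in> obj T" for j X
    using that P_obj by (subst hom_vanish_iff) auto
  then show ?thesis unfolding right_perp_def right_perp_neg_def by blast
qed

lemma left_perp_sh: "X \<in> obj T \<Longrightarrow> sh k X \<in> left_perp (l + k) \<longleftrightarrow> X \<in> left_perp l"
proof -
  assume X: "X \<in> obj T"
  have "hom0 T (sh k X) (sh j Q) \<longleftrightarrow> hom0 T X (sh (j - k) Q)" if "Q \<in> P" for j Q
    using hom0_shift(1)[OF X, of Q k j] that P_obj by auto
  then have "sh k X \<in> left_perp (l + k) \<longleftrightarrow> (\<forall>j>l + k. \<forall>Q\<in>P. hom0 T X (sh (j - k) Q))"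
    using X by (auto simp: left_perp_def)
  also have "\<dots> \<longleftrightarrow> (\<forall>j>l. \<forall>Q\<in>P. hom0 T X (sh j Q))"
  proof (intro iffI allI impI)
    fix j assume "\<forall>j>l + k. \<forall>Q\<in>P. hom0 T X (sh (j - k) Q)" "j > l"
    then show "\<forall>Q\<in>P. hom0 T X (sh j Q)" by (auto dest!: spec[of _ "j + k"])
  qed auto
  finally show ?thesis using X by (simp add: left_perp_def)
qed

lemma right_perp_sh: "X \<in> obj T \<Longrightarrow> sh k X \<in> right_perp (l + k) \<longleftrightarrow> X \<in> right_perp l"
proof -
  assume X: "X \<in> obj T"
  have "hom0 T (sh j Q) (sh k X) \<longleftrightarrow> hom0 T (sh (j - k) Q) X" if "Q \<in> P" for j Q
    using hom0_shift(2)[OF _ X, of Q j k] that P_obj by auto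
  then have "sh k X \<in> right_perp (l + k) \<longleftrightarrow> (\<forall>j<l + k. \<forall>Q\<in>P. hom0 T (sh (j - k) Q) X)"
    using X by (auto simp: right_perp_def)
  also have "\<dots> \<longleftrightarrow> (\<forall>j<l. \<forall>Q\<in>P. hom0 T (sh j Q) X)"
  proof (intro iffI allI impI)
    fix j assume "\<forall>j<l + k. \<forall>Q\<in>P. hom0 T (sh (j - k) Q) X" "j < l"
    then show "\<forall>Q\<in>P. hom0 T (sh j Q) X" by (auto dest!: spec[of _ "j + k"])
  qed auto
  finally show ?thesis using X by (simp add: right_perp_def)
qed

lemma P_left_perp: "Q \<in> P \<Longrightarrow> Q \<in> left_perp 0"
  and P_right_perp: "Q \<in> P \<Longrightarrow> Q \<in> right_perp 0"
  using P_hom0[of 0 _ Q] P_hom0[of _ 0 _ Q] P_obj by (auto simp: left_perp_def right_perp_def)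

lemma left_perp_ex: assumes "X \<in> obj T" obtains n :: nat where "X \<in> left_perp (int n)"
proof -
  obtain l0 where l0: "\<And>l. l \<ge> l0 \<Longrightarrow> hom_vanish T {X} (sh l ` P)"
    using P_P2 assms unfolding P2_def by meson
  \<comment> \<open>Rounding the bound up to a natural number only weakens the condition; the number
    then also counts the truncation steps down to level 0.\<close>
  have "X \<in> left_perp (int (nat l0))"
    using l0 assms P_obj by (auto simp: left_perp_def hom_vanish_shift_iff)
  then show ?thesis by (rule that)
qed

lemma right_perp_ex: assumes "X \<in> obj T" obtains n :: nat where "X \<in> right_perp (- int n)"
proof -
  obtain l0 where l0: "\<And>l. l \<ge> l0 \<Longrightarrow> hom_vanish T P {sh l X}"
    using P_P2 assms unfolding P2_def by meson
  have "hom0 T (sh j Q) X" if "j < - int (nat l0)" "Q \<in> P" for j Q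
  proof -
    have le: "l0 \<le> - j" using that by (cases "0 \<le> l0") auto
    have "hom0 T Q (sh (- j) X)"
      using l0[OF le] that assms hom_vanish_iff[OF P_obj, of "{sh (- j) X}"] by auto
    then show ?thesis using hom0_shift_right[of Q X "- j"] that assms P_obj by auto
  qed
  then show ?thesis using that[of "nat l0"] assms by (auto simp: right_perp_def)
qed

text \<open>\<open>X'\<close> completes a left approximation \<open>f\<close> of \<open>X\<close> to
  a triangle. A map from \<open>X'\<close> to \<open>P\<close> vanishes on \<open>Q[-1]\<close>, so
  it extends to \<open>X\<close>, factors there through \<open>f\<close>, and is zero because
  \<open>f \<cdot> u = 0\<close>.\<close>

lemma left_truncation_step_0:
  assumes "X \<in> left_perp 0"
  obtains X' Q where "Q \<in> P" "X' \<in> left_perp (- 1)" "tri T X' X Q"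
proof -
  obtain Q f where Q: "Q \<in> P" and f: "f \<in> Hom T X Q" and
    a: "\<And>Q'. Q' \<in> P \<Longrightarrow> (\<lambda>h. h \<cdot> f) ` Hom T Q Q' = Hom T X Q'"
    using P_P1 assms unfolding P1_def covariantly_finite_in_def left_perp_0 by meson
  obtain u w where d: "(u, f, w) \<in> dist T" using tri_complete_left[OF f] .
  define X' where "X' = src T u"
  have u: "u \<in> Hom T X' X" using distD[OF d] f by (simp add: X'_def)
  have t: "tri T X' X Q" using triI[OF d] u f by simp
  obtain x where x: "x \<in> arr T" "sha T x = mneg T w" "tgt T x = src T u" "sho T (src T x) = tgt T f"
    "(x, u, f) \<in> dist T" using unrotate[OF d] .
  have sx: "src T x = sh (- 1) Q" using sh_sho[of "src T x" "- 1"] x f by simp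
  have xH: "x \<in> Hom T (sh (- 1) Q) X'" using x u sx by simp
  have t': "tri T (sh (- 1) Q) X' X" using triI[OF x(5)] xH u by simp
  \<comment> \<open>The approximation property is needed in degree 0 only; for \<open>j > 0\<close>
    neither \<open>Q[-1]\<close> nor \<open>X\<close> has a nonzero map to
    \<open>P[j]\<close>.\<close>
  have "hom0 T X' (sh j Q')" if j: "j > - 1" and Q': "Q' \<in> P" for j Q'
  proof (cases "j = 0")
    case False
    then have "hom0 T X (sh j Q')" using assms j Q' by (auto simp: left_perp_def)
    moreover have "hom0 T (sh (- 1) Q) (sh j Q')" using j Q' Q P_hom0 by auto
    ultimately show ?thesis using tri_hom0_left[OF t'] by blast
  next
    case True
    have "hom0 T X' Q'" unfolding hom0_def
    proof
      fix h assume h: "h \<in> Hom T X' Q'"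
      have "hom0 T (sh (- 1) Q) Q'" using P_hom0[of "- 1" 0 Q Q'] Q Q' by simp
      then have "h \<cdot> x = mzero T (sh (- 1) Q) Q'" by (rule hom0D) (use h xH in simp_all)
      then obtain h' where h': "h' \<in> Hom T X Q'" "h = h' \<cdot> u"
        using dist_extend[OF x(5) xH u h] by blast
      obtain g where g: "g \<in> Hom T Q Q'" "h' = g \<cdot> f" using a[OF Q'] h'(1) by blast
      have fu: "f \<cdot> u = mzero T X' Q" using dist_comp_0[OF d] u f by simp
      have "h = g \<cdot> (f \<cdot> u)" using h' g f u by simp
      then show "h = mzero T X' Q'" unfolding fu using g u src_obj[of u] by auto
    qed
    then show ?thesis using True by simp
  qed
  then have "X' \<in> left_perp (- 1)" using tri_obj[OF t] by (simp add: left_perp_def)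
  then show ?thesis using that Q t by blast
qed

text \<open>Dual, with the cone of a right approximation: a map from \<open>P\<close> to
  \<open>X'\<close> lifts to \<open>X\<close> because \<open>P\<close> has no nonzero map to
  \<open>Q[1]\<close>, and the lift factors through \<open>f\<close>.\<close>

lemma right_truncation_step_0:
  assumes "X \<in> right_perp 0"
  obtains X' Q where "Q \<in> P" "X' \<in> right_perp 1" "tri T Q X X'"
proof -
  obtain Q f where Q: "Q \<in> P" and f: "f \<in> Hom T Q X" and
    a: "\<And>Q'. Q' \<in> P \<Longrightarrow> (\<lambda>h. f \<cdot> h) ` Hom T Q' Q = Hom T Q' X"
    using P_P1 assms unfolding P1_def contravariantly_finite_in_def right_perp_0 by meson
  obtain v w where d: "(f, v, w) \<in> dist T" using dist_complete[of f] f by auto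
  define X' where "X' = tgt T v"
  note D = distD[OF d]
  have v: "v \<in> Hom T X X'" using D f by (simp add: X'_def)
  have w: "w \<in> Hom T X' (sho T Q)" using D f by (simp add: X'_def)
  have t: "tri T Q X X'" using triI[OF d] v f by simp
  have Q1: "sh 1 Q = sho T Q" using Q P_obj by auto
  have "hom0 T (sh j Q') X'" if j: "j < 1" and Q': "Q' \<in> P" for j Q'
  proof (cases "j = 0")
    case False
    then have "hom0 T (sh j Q') X" using assms j Q' by (auto simp: right_perp_def)
    moreover have "hom0 T (sh j Q') (sho T Q)" using P_hom0[of j 1 Q' Q] j Q' Q Q1 by simp
    ultimately show ?thesis using tri_hom0_right[OF tri_rotate[OF t]] by blast
  next
    case True
    have "hom0 T Q' X'" unfolding hom0_def
    proof
      fix h assume h: "h \<in> Hom T Q' X'"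
      have "hom0 T Q' (sho T Q)" using P_hom0[of 0 1 Q' Q] Q' Q Q1 by simp
      then have "w \<cdot> h = mzero T Q' (sho T Q)" by (rule hom0D) (use h w in simp_all)
      then obtain h' where h': "h' \<in> Hom T Q' X" "h = v \<cdot> h'"
        using dist_lift[OF rotate[OF d] v w h] by blast
      obtain g where g: "g \<in> Hom T Q' Q" "h' = f \<cdot> g" using a[OF Q'] h'(1) by blast
      have vf: "v \<cdot> f = mzero T Q X'" using dist_comp_0[OF d] v f by simp
      have "h = (v \<cdot> f) \<cdot> g" using h' g f v by simp
      then show "h = mzero T Q' X'" unfolding vf using g v tgt_obj[of v] by auto
    qed
    then show ?thesis using True by simp
  qed
  then have "X' \<in> right_perp 1" using tri_obj[OF t] by (simp add: right_perp_def)
  then show ?thesis using that Q t by blast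
qed

text \<open>Shifting to level 0 is forced, as (P1) provides approximations only there.\<close>

lemma left_truncation_step:
  assumes "X \<in> left_perp l"
  obtains X' Q where "Q \<in> P" "X' \<in> left_perp (l - 1)" "tri T X' X (sh l Q)"
proof -
  have X: "X \<in> obj T" using assms by (simp add: left_perp_def)
  have "sh (- l) X \<in> left_perp 0" using left_perp_sh[OF X, of "- l" l] assms by simp
  then obtain X' Q where *: "Q \<in> P" "X' \<in> left_perp (- 1)" "tri T X' (sh (- l) X) Q"
    by (rule left_truncation_step_0)
  have "sh l X' \<in> left_perp (l - 1)"
    using left_perp_sh[of X' l "- 1"] * tri_obj[OF *(3)] by simp
  moreover have "tri T (sh l X') X (sh l Q)" using tri_sh[OF *(3), of l] X by (simp add: sh_add)
  ultimately show ?thesis using that *(1) by blast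
qed

lemma right_truncation_step:
  assumes "X \<in> right_perp l"
  obtains X' Q where "Q \<in> P" "X' \<in> right_perp (l + 1)" "tri T (sh l Q) X X'"
proof -
  have X: "X \<in> obj T" using assms by (simp add: right_perp_def)
  have "sh (- l) X \<in> right_perp 0" using right_perp_sh[OF X, of "- l" l] assms by simp
  then obtain X' Q where *: "Q \<in> P" "X' \<in> right_perp 1" "tri T Q (sh (- l) X) X'"
    by (rule right_truncation_step_0)
  have "sh l X' \<in> right_perp (l + 1)"
    using right_perp_sh[of X' l 1] * tri_obj[OF *(3)] by (simp add: add.commute)
  moreover have "tri T (sh l Q) X (sh l X')" using tri_sh[OF *(3), of l] X by (simp add: sh_add)
  ultimately show ?thesis using that *(1) by blast
qed

text \<open>The \<open>n\<close> steps split off the shifts \<open>l, l - 1, ..., l - n + 1\<close>,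
  whence the half-open interval. Each octahedron puts the new, lower shift in front of the pieces
  already split off.\<close>

lemma left_truncation:
  assumes "X \<in> left_perp l"
  shows "\<exists>X' C. X' \<in> left_perp (l - int n) \<and> C \<in> ext T (shs T P {l - int n<..l}) \<and> tri T X' X C"
proof (induction n)
  case 0
  obtain Z where "zero_object T Z" using zero_object_exists by auto
  moreover have "X \<in> obj T" using assms by (simp add: left_perp_def)
  ultimately show ?case using assms tri_zero_right[of X Z] by (auto intro: ext_zero)
next
  case (Suc n)
  then obtain X' C where X': "X' \<in> left_perp (l - int n)" "C \<in> ext T (shs T P {l - int n<..l})"
    "tri T X' X C" by blast
  obtain X'' Q where X'': "Q \<in> P" "X'' \<in> left_perp (l - int n - 1)" "tri T X'' X' (sh (l - int n) Q)"
    using left_truncation_step[OF X'(1)] .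
  obtain V where V: "tri T X'' X V" "tri T (sh (l - int n) Q) V C"
    using tri_oct1[OF X'(3) X''(3)] .
  have a: "C \<in> ext T (shs T P {l - int (Suc n)<..l})"
    by (rule subsetD[OF ext_mono[OF shs_mono] X'(2)]) auto
  have b: "sh (l - int n) Q \<in> ext T (shs T P {l - int (Suc n)<..l})"
    by (rule ext_base) (use X''(1) in \<open>auto simp: shs_def\<close>)
  have "V \<in> ext T (shs T P {l - int (Suc n)<..l})" by (rule ext_step[OF b a V(2)])
  moreover have "X'' \<in> left_perp (l - int (Suc n))" using X''(2) by (simp add: algebra_simps)
  ultimately show ?case using V(1) by blast
qed

lemma right_truncation:
  assumes "X \<in> right_perp l"
  shows "\<exists>X' C. X' \<in> right_perp (l + int n) \<and> C \<in> ext T (shs T P {l..<l + int n}) \<and> tri T C X X'"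
proof (induction n)
  case 0
  obtain Z where "zero_object T Z" using zero_object_exists by auto
  moreover have "X \<in> obj T" using assms by (simp add: right_perp_def)
  ultimately show ?case using assms tri_zero_left[of X Z] by (auto intro: ext_zero)
next
  case (Suc n)
  then obtain X' C where X': "X' \<in> right_perp (l + int n)" "C \<in> ext T (shs T P {l..<l + int n})"
    "tri T C X X'" by blast
  obtain X'' Q where X'': "Q \<in> P" "X'' \<in> right_perp (l + int n + 1)" "tri T (sh (l + int n) Q) X' X''"
    using right_truncation_step[OF X'(1)] .
  obtain V where V: "tri T C V (sh (l + int n) Q)" "tri T V X X''"
    using tri_oct2[OF X'(3) X''(3)] .
  have a: "C \<in> ext T (shs T P {l..<l + int (Suc n)})"
    by (rule subsetD[OF ext_mono[OF shs_mono] X'(2)]) auto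
  have b: "sh (l + int n) Q \<in> ext T (shs T P {l..<l + int (Suc n)})"
    by (rule ext_base) (use X''(1) in \<open>auto simp: shs_def\<close>)
  have "V \<in> ext T (shs T P {l..<l + int (Suc n)})" by (rule ext_step[OF a b V(1)])
  moreover have "X'' \<in> right_perp (l + int (Suc n))" using X''(2) by (simp add: algebra_simps)
  ultimately show ?case using V(2) by blast
qed

lemma ext_thick: assumes "C \<in> ext T (shs T P I)" shows "C \<in> thick T P"
proof (rule triangulated_ext[OF N_triangulated _ assms])
  show "shs T P I \<subseteq> thick T P"
    using thick_superset[of P] triangulated_sh[OF N_triangulated] P_obj by (auto simp: shs_def)
qed

lemma ext_hom0_right_perp:
  assumes "C \<in> ext T (shs T P I)" "\<And>i. i \<in> I \<Longrightarrow> i < l" "Y \<in> right_perp l" shows "hom0 T C Y"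
  by (rule ext_hom0_left[OF assms(1)]) (use assms(2,3) in \<open>auto simp: right_perp_def shs_def\<close>)

lemma ext_hom0_left_perp:
  assumes "C \<in> ext T (shs T P I)" "\<And>i. i \<in> I \<Longrightarrow> i > l" "Y \<in> left_perp l" shows "hom0 T Y C"
  by (rule ext_hom0_right[OF assms(1)]) (use assms(2,3) in \<open>auto simp: left_perp_def shs_def\<close>)

text \<open>One bound \<open>m\<close> serves all test objects \<open>V\<close> simultaneously. The
  objects admitting some bound form a thick subcategory: a shift moves the bound, and a cone takes
  the smaller of two.\<close>

lemma thick_hom0_bounded:
  assumes "C \<in> thick T P" shows "\<exists>m. \<forall>V \<in> left_perp m. hom0 T V C"
proof -
  define G where "G = {C \<in> obj T. \<exists>m. \<forall>V \<in> left_perp m. hom0 T V C}"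
  have mono: "V \<in> left_perp m'" if "V \<in> left_perp m" "m \<le> m'" for V m m'
    using that by (auto simp: left_perp_def)
  have shift: "sh k X \<in> G" if X: "X \<in> G" for X k
  proof -
    obtain m where m: "X \<in> obj T" "\<And>V. V \<in> left_perp m \<Longrightarrow> hom0 T V X" using X by (auto simp: G_def)
    have "hom0 T V (sh k X)" if V: "V \<in> left_perp (m + k)" for V
    proof -
      have o: "V \<in> obj T" using V by (simp add: left_perp_def)
      have "sh (- k) V \<in> left_perp m" using left_perp_sh[OF o, of "- k" "m + k"] V by simp
      then show ?thesis using m hom0_shift_right[OF o m(1)] by simp
    qed
    then show ?thesis using m(1) by (auto simp: G_def)
  qed
  have "thick T P \<subseteq> G"
  proof (rule thick_least)
    show "P \<subseteq> G"
    proof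
      fix Q assume Q: "Q \<in> P"
      \<comment> \<open>Level -1, because the strict inequality in \<open>left_perp\<close> must
        include degree 0.\<close>
      have "hom0 T V Q" if "V \<in> left_perp (-1)" for V
        using that Q unfolding left_perp_def by (auto dest!: spec[of _ 0])
      then show "Q \<in> G" using Q P_obj by (auto simp: G_def)
    qed
    show "summand_closed T G"
      unfolding summand_closed_def G_def using direct_sum_retract hom0_retract_right by blast
    show "triangulated_subcategory T G"
    proof (rule triangulatedI)
      show "G \<subseteq> obj T" by (auto simp: G_def)
      obtain Z where Z: "zero_object T Z" using zero_object_exists by auto
      have "Z \<in> G" using zero_objectD[OF Z] by (auto simp: G_def left_perp_def)
      then show "G \<noteq> {}" by auto
      show "Y \<in> G" if "isomorphic T X Y" "X \<in> G" for X Y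
        using that isomorphic_obj isomorphic_sym isomorphic_retract hom0_retract_right
        unfolding G_def by blast
      show "sho T X \<in> G \<longleftrightarrow> X \<in> G" if X: "X \<in> obj T" for X
        using shift[of X 1] shift[of "sho T X" "- 1"] X by (auto simp: sh_sho)
      show "Z \<in> G" if t: "tri T X Y Z" "X \<in> G" "Y \<in> G" for X Y Z
      proof -
        have "sho T X \<in> G" using shift[of X 1] t by (auto simp: G_def)
        then obtain m1 where m1: "\<And>V. V \<in> left_perp m1 \<Longrightarrow> hom0 T V (sho T X)" by (auto simp: G_def)
        obtain m2 where m2: "\<And>V. V \<in> left_perp m2 \<Longrightarrow> hom0 T V Y" using t by (auto simp: G_def)
        \<comment> \<open>The smaller level imposes the stronger condition on \<open>V\<close>, so
          both vanishing statements apply.\<close>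
        have "hom0 T V Z" if V: "V \<in> left_perp (min m1 m2)" for V
          using tri_hom0_right[OF tri_rotate[OF t(1)] m2[OF mono[OF V]] m1[OF mono[OF V]]] by simp
        then show ?thesis using tri_obj[OF t(1)] by (auto simp: G_def)
      qed
    qed
  qed
  then show ?thesis using assms by (auto simp: G_def)
qed

text \<open>Truncating \<open>C\<close> far enough kills the map from the truncation, so \<open>C\<close> is a retract of an iterated
  extension of non-positive shifts of \<open>P\<close>.\<close>

lemma thick_left_perp_hom0:
  assumes "C \<in> thick T P" "C \<in> left_perp 0" "Y \<in> right_perp 1"
  shows "hom0 T C Y"
proof -
  obtain m where m: "\<And>V. V \<in> left_perp m \<Longrightarrow> hom0 T V C" using thick_hom0_bounded[OF assms(1)] by blast
  \<comment> \<open>Chosen so that \<open>- int n \<le> m\<close>; for nonnegative \<open>m\<close>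
    no step is made.\<close>
  define n where "n = nat (- m)"
  obtain C' D where C': "C' \<in> left_perp (0 - int n)" "D \<in> ext T (shs T P {0 - int n<..0})" "tri T C' C D"
    using left_truncation[OF assms(2)] by blast
  have "C' \<in> left_perp m" using C'(1) by (auto simp: left_perp_def n_def)
  then have h: "hom0 T C' C" by (rule m)
  obtain u v w where d: "(u, v, w) \<in> dist T" "u \<in> Hom T C' C" "v \<in> Hom T C D" "w \<in> Hom T D (sho T C')"
    using C'(3) by (rule triE)
  have o: "C \<in> obj T" using assms(2) by (simp add: left_perp_def)
  have "u = mzero T C' C" by (rule hom0D[OF h]) (use d in simp_all)
  then have "idt T C \<cdot> u = mzero T C' C" using d o by simp
  then obtain p where p: "p \<in> Hom T D C" "idt T C = p \<cdot> v"
    using dist_extend[OF d(1-3) idt_hom[OF o]] by blast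
  have "retract T C D" by (rule retractI[OF d(3) p(1)]) (use p in simp)
  moreover have "hom0 T D Y" by (rule ext_hom0_right_perp[OF C'(2) _ assms(3)]) simp
  ultimately show ?thesis by (rule hom0_retract_left)
qed

text \<open>The map from \<open>X\<close> to the cone of \<open>s\<close> factors through the truncation \<open>C'\<close> of that cone, since the rest
  of the cone is built from positive shifts of \<open>P\<close>; the new denominator is the cocone of \<open>X \<rightarrow> C'\<close>.\<close>

lemma refine_denominator:
  assumes "X \<in> left_perp 0" "Y \<in> right_perp 1" "s \<in> W" "tgt T s = X"
  obtains r v w where "r \<in> arr T" "tgt T r = src T s" "s \<cdot> r \<in> W" "(s \<cdot> r, v, w) \<in> dist T"
    "hom0 T (tgt T v) Y" "hom0 T (sh (- 1) (tgt T v)) Y"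
proof -
  obtain C v w where C: "C \<in> thick T P" "(s, v, w) \<in> dist T" "v \<in> Hom T (tgt T s) C"
    "w \<in> Hom T C (sho T (src T s))" using assms(3) by (rule W_E)
  have Co: "C \<in> obj T" using C(3) by auto
  have Y: "Y \<in> obj T" using assms(2) by (simp add: right_perp_def)
  obtain l :: nat where l: "C \<in> left_perp (int l)" using left_perp_ex[OF Co] .
  \<comment> \<open>Starting at level \<open>l\<close>, exactly \<open>l\<close> steps reach level
    0. The pieces of \<open>D\<close> are the shifts from 1 to \<open>l\<close>, the positive ones,
    to which \<open>X\<close> has no nonzero map.\<close>
  obtain C' D where C': "C' \<in> left_perp (int l - int l)" "D \<in> ext T (shs T P {int l - int l<..int l})"
    "tri T C' C D" using left_truncation[OF l] by blast
  have C'0: "C' \<in> left_perp 0" using C'(1) by simp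
  have C'S: "C' \<in> thick T P"
    using triangulatedD(6)[OF N_triangulated C'(3) C(1) ext_thick[OF C'(2)]] .
  obtain c b e where d: "(c, b, e) \<in> dist T" "c \<in> Hom T C' C" "b \<in> Hom T C D" "e \<in> Hom T D (sho T C')"
    using C'(3) by (rule triE)
  have "hom0 T X D" by (rule ext_hom0_left_perp[OF C'(2) _ assms(1)]) simp
  then have "b \<cdot> v = mzero T X D" by (rule hom0D) (use C d assms(4) in simp_all)
  then obtain v' where v': "v' \<in> Hom T X C'" "v = c \<cdot> v'"
    using dist_lift[OF d(1-3), of v X] C(3) assms(4) by blast
  obtain t y where t: "(t, v', y) \<in> dist T" using tri_complete_left[OF v'(1)] .
  have tH: "t \<in> Hom T (src T t) X" using distD[OF t] v' by simp
  have "v \<cdot> t = c \<cdot> (v' \<cdot> t)" using v' d tH by simp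
  also have "v' \<cdot> t = mzero T (src T t) C'" using dist_comp_0[OF t] v' by simp
  finally have vt: "v \<cdot> t = mzero T (src T t) C" using d tH by simp
  have sH: "s \<in> Hom T (src T s) (tgt T s)" "t \<in> Hom T (src T t) (tgt T s)"
    using tH assms(3,4) by simp_all
  obtain r where r: "r \<in> Hom T (src T t) (src T s)" "t = s \<cdot> r"
    using dist_lift[OF C(2) sH(1) C(3) sH(2) vt] by blast
  \<comment> \<open>A shift by -1 lowers the level, so it keeps \<open>C'\<close> inside
    \<open>left_perp 0\<close>, and orthogonality to \<open>Y\<close> holds for the cone and for its
    shift alike.\<close>
  have C'm: "sh (- 1) C' \<in> thick T P" "sh (- 1) C' \<in> left_perp 0"
    using C'S triangulated_sh[OF N_triangulated] left_perp_sh[of C' "- 1" 0] C'0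
    by (auto simp: left_perp_def)
  have "t \<in> W" using W_I[OF t] C'S v' by simp
  then show ?thesis
    using that[of r v' y] r t v' thick_left_perp_hom0[OF C'S C'0 assms(2)]
      thick_left_perp_hom0[OF C'm assms(2)] by simp
qed

text \<open>If \<open>Hom\<close> vanishes in \<open>T\<close>: the numerator of a refined roof
  vanishes on the cone shifted by -1, so it extends along the denominator to a map from
  \<open>X\<close> to \<open>Y\<close>, which is zero. Conversely, a map killed by an arrow of
  \<open>W\<close> factors through the cone of a refined denominator, from which there are only zero
  maps to \<open>Y\<close>.\<close>

lemma hom0_U_iff:
  assumes "X \<in> left_perp 0" "Y \<in> right_perp 1"
  shows "hom0 U X Y \<longleftrightarrow> hom0 T X Y"
proof
  have o: "X \<in> obj T" "Y \<in> obj T" using assms by (auto simp: left_perp_def right_perp_def)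
  assume h: "hom0 T X Y"
  show "hom0 U X Y" unfolding hom0_def
  proof
    fix A assume "A \<in> Hom U X Y"
    then obtain s f where s: "s \<in> W" "f \<in> arr T" "src T s = src T f" "tgt T s = X" "tgt T f = Y" "A = frac s f"
      by (rule Hom_U_E)
    obtain r v w where r: "r \<in> arr T" "tgt T r = src T s" "s \<cdot> r \<in> W" "(s \<cdot> r, v, w) \<in> dist T"
      "hom0 T (tgt T v) Y" "hom0 T (sh (- 1) (tgt T v)) Y"
      using refine_denominator[OF assms s(1,4)] .
    note D = distD[OF r(4)]
    obtain x where x: "x \<in> arr T" "sha T x = mneg T w" "tgt T x = src T (s \<cdot> r)" "sho T (src T x) = tgt T v"
      "(x, s \<cdot> r, v) \<in> dist T" using unrotate[OF r(4)] .
    have sx: "src T x = sh (- 1) (tgt T v)"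
      using sh_sho[of "src T x" "- 1"] x by simp
    have xH: "x \<in> Hom T (src T x) (src T r)" "s \<cdot> r \<in> Hom T (src T r) X" "f \<cdot> r \<in> Hom T (src T r) Y"
      using x s r by simp_all
    have "(f \<cdot> r) \<cdot> x = mzero T (src T x) Y"
      by (rule hom0D[OF r(6)[folded sx]]) (use xH s r in simp_all)
    then obtain g where g: "g \<in> Hom T X Y" "f \<cdot> r = g \<cdot> (s \<cdot> r)"
      using dist_extend[OF x(5) xH] by blast
    have "g = mzero T X Y" by (rule hom0D[OF h]) (use g in simp_all)
    then have "f \<cdot> r = mzero T (src T r) Y" using g(2) xH(2) o by simp
    moreover have "A = frac (s \<cdot> r) (f \<cdot> r)"
      unfolding s(6) by (rule frac_refine) (use s r in simp_all)
    ultimately show "A = mzero U X Y" using frac_0[OF r(3), of "src T r" Y] s r o by simp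
  qed
next
  have o: "X \<in> obj T" "Y \<in> obj T" using assms by (auto simp: left_perp_def right_perp_def)
  assume h: "hom0 U X Y"
  show "hom0 T X Y" unfolding hom0_def
  proof
    fix g assume g: "g \<in> Hom T X Y"
    have "proj g = mzero U X Y" by (rule U.hom0D[OF h]) (use g in simp_all)
    then obtain y where y: "y \<in> W" "tgt T y = X" and gy: "g \<cdot> y = mzero T (src T y) Y"
      by (rule proj_eq_0D[OF g])
    obtain r v w where r: "r \<in> arr T" "tgt T r = src T y" "y \<cdot> r \<in> W" "(y \<cdot> r, v, w) \<in> dist T"
      "hom0 T (tgt T v) Y" "hom0 T (sh (- 1) (tgt T v)) Y"
      using refine_denominator[OF assms y] .
    note D = distD[OF r(4)]
    have "g \<cdot> (y \<cdot> r) = (g \<cdot> y) \<cdot> r" using g y r by simp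
    then have gr: "g \<cdot> (y \<cdot> r) = mzero T (src T r) Y" unfolding gy using y(1) r o by simp
    obtain k where k: "k \<in> Hom T (tgt T v) Y" "g = k \<cdot> v"
      using dist_extend[OF r(4) _ _ g gr, of "tgt T v"] D y r by auto
    have "k = mzero T (tgt T v) Y" by (rule hom0D[OF r(5)]) (use k in simp_all)
    then show "g = mzero T X Y" using k D y r o by simp
  qed
qed

end

section \<open>Isomorphisms, thick subcategories and hulls in the quotient\<close>

context verdier_quotient
begin

lemma shift_U: "shift U i X = sh i X"
  by (simp add: shift_def)

lemma W_isomorphic: assumes "s \<in> W" shows "isomorphic U (src T s) (tgt T s)"
proof (rule U.isomorphicI)
  define Z where "Z = src T s"
  have Z: "Z \<in> obj T" "src T s = Z" using assms by (simp_all add: Z_def)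
  have p: "proj s = frac (idt T Z) s" by (simp add: proj_def Z_def)
  have "proj s \<bullet> frac s (idt T Z) = frac (s \<cdot> idt T Z) (s \<cdot> idt T Z)"
    unfolding p by (rule comp_frac) (use assms Z in simp_all)
  then show "proj s \<bullet> frac s (idt T (src T s)) = idt U (tgt T s)"
    using frac_idt[OF assms] assms Z by simp
  have "frac s (idt T Z) \<bullet> proj s = frac (idt T Z \<cdot> idt T Z) (idt T Z \<cdot> idt T Z)"
    unfolding p by (rule comp_frac) (use assms Z in simp_all)
  then show "frac s (idt T (src T s)) \<bullet> proj s = idt U (src T s)"
    using frac_idt[of "idt T Z"] Z by simp
qed (use assms in simp_all)

lemma tri_isomorphic_right: assumes "tri T X Y C" "C \<in> N" shows "isomorphic U X Y"
proof -
  obtain u v w where d: "(u, v, w) \<in> dist T" "u \<in> Hom T X Y" "v \<in> Hom T Y C"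
    using assms(1) by (rule triE)
  then show ?thesis using W_isomorphic[OF W_I[OF d(1)]] assms by simp
qed

lemma tri_isomorphic_left: assumes "tri T C X Y" "C \<in> N" shows "isomorphic U X Y"
  by (rule tri_isomorphic_right[OF tri_rotate[OF assms(1)]])
    (use assms triangulatedD(1,3)[OF N_triangulated] in auto)

text \<open>The zero arrow \<open>m\<close> from a zero object to \<open>C\<close> has cone
  \<open>C\<close>, so it is inverted. The identity of \<open>C\<close> is then the fraction with
  numerator and denominator \<open>m\<close>, which is zero.\<close>

lemma zero_object_U: assumes "C \<in> N" shows "zero_object U C"
proof -
  have C: "C \<in> obj T" using assms triangulatedD(1)[OF N_triangulated] by auto
  obtain Z where Z: "zero_object T Z" "(mzero T Z C, idt T C, mzero T C (sho T Z)) \<in> dist T"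
    using dist_zero_left[OF C] .
  define m where "m = mzero T Z C"
  have m: "m \<in> W" "src T m = Z" "tgt T m = C"
    using W_I[OF Z(2)] assms C zero_objectD(1)[OF Z(1)] by (simp_all add: m_def)
  have "frac m m = mzero U C C" using frac_0[OF m(1,2) C] m by (simp add: m_def)
  then have "idt U C = mzero U C C" using frac_idt[OF m(1)] m by simp
  then show ?thesis using C by (intro U.zero_objectI) simp_all
qed

lemma zero_object_T_U: "zero_object T Z \<Longrightarrow> zero_object U Z"
  using zero_object_U triangulatedD(8)[OF N_triangulated] by blast

lemma isomorphic_T_U: assumes "isomorphic T X Y" shows "isomorphic U X Y"
proof -
  obtain f g where f: "f \<in> Hom T X Y" "g \<in> Hom T Y X" "g \<cdot> f = idt T X" "f \<cdot> g = idt T Y"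
    using assms by (rule isomorphicE)
  show ?thesis
    by (rule U.isomorphicI[of "proj f" _ _ "proj g"])
      (use f proj_comp[OF f(1,2)] proj_comp[OF f(2,1)] in simp_all)
qed

lemma dist_T_U: assumes "(u, v, w) \<in> dist T" shows "(proj u, proj v, proj w) \<in> dist U"
proof -
  note D = distD[OF assms]
  have i: "is_iso U (idt U X)" if "X \<in> obj T" for X
    by (rule is_isoI[of _ _ X X "idt U X"]) (use that U.comp_idt_right[of "idt U X" X] in auto)
  have c: "idt U (tgt T f) \<bullet> proj f = proj f" "proj f \<bullet> idt U (src T f) = proj f"
    if "f \<in> arr T" for f
    using comp_U_idt[OF proj_Hom[of f "src T f" "tgt T f"]] that by simp_all
  have s: "sha U (idt U X) = idt U (sho T X)" if "X \<in> obj T" for X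
  proof -
    have "sha U (frac (idt T X) (idt T X)) = frac (sha T (idt T X)) (sha T (idt T X))"
      by (rule sha_frac) (use that in simp_all)
    then show ?thesis using that by (simp add: proj_def)
  qed
  have "triangle U (proj u, proj v, proj w)" using D by simp
  moreover have "triangle_mor U (idt U (src T u)) (idt U (tgt T u)) (idt U (tgt T v))
      (proj u, proj v, proj w) (proj u, proj v, proj w)"
    using D c[of u] c[of v] c[of w] s[of "src T u"]
    by (simp del: U_fields(3,6) add: U.idt_arr U.src_idt U.tgt_idt flip: U_fields(2))
  ultimately have "triangle_iso U (proj u, proj v, proj w) (proj u, proj v, proj w)"
    unfolding triangle_iso_def using i[of "src T u"] i[of "tgt T u"] i[of "tgt T v"] D(1,2)
    by (metis src_obj tgt_obj)
  then show ?thesis using assms unfolding dist_U_iff by blast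
qed

lemma dist_U_T:
  assumes "(u, v, w) \<in> dist U"
  obtains X Y Z where "tri T X Y Z" "isomorphic U X (src U u)" "isomorphic U Y (tgt U u)"
    "isomorphic U Z (tgt U v)"
proof -
  obtain u0 v0 w0 where d: "(u0, v0, w0) \<in> dist T" and
    "triangle_iso U (proj u0, proj v0, proj w0) (u, v, w)"
    using assms dist_U_iff by blast
  then obtain a b c where i: "is_iso U a" "is_iso U b" "is_iso U c"
    and m: "triangle_mor U a b c (proj u0, proj v0, proj w0) (u, v, w)"
    unfolding triangle_iso_def by blast
  note D = distD[OF d]
  have "a \<in> Hom U (src T u0) (src U u)" "b \<in> Hom U (tgt T u0) (tgt U u)" "c \<in> Hom U (tgt T v0) (tgt U v)"
    using m D by simp_all
  then show ?thesis using that[OF triI[OF d]] i unfolding isomorphic_def by blast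
qed

text \<open>The identity of the target factors through the cone, so the target is a retract of an
  object of \<open>N\<close>; closure of \<open>N\<close> under summands enters here.\<close>

lemma W_of_0: assumes "t \<in> W" "t = mzero T (src T t) (tgt T t)" shows "tgt T t \<in> N"
proof -
  obtain C v w where C: "C \<in> N" "(t, v, w) \<in> dist T" "v \<in> Hom T (tgt T t) C" using assms(1) by (rule W_E)
  define Y where "Y = tgt T t"
  have Y: "Y \<in> obj T" "t \<in> Hom T (src T t) Y" using assms(1) by (simp_all add: Y_def)
  have "idt T Y \<cdot> t = mzero T (src T t) Y" using assms(2) Y by (simp add: Y_def)
  then obtain h where h: "h \<in> Hom T C Y" "idt T Y = h \<cdot> v"
    using dist_extend[OF C(2) Y(2) C(3)[folded Y_def] idt_hom[OF Y(1)]] by blast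
  have "retract T Y C" by (rule retractI[OF C(3)[folded Y_def] h(1)]) (use h(2) in simp)
  then show ?thesis using summand_closed_retract[OF N_summand_closed] C(1) by (simp add: Y_def)
qed

lemma comp_U_0:
  assumes "A \<in> Hom U X Y"
  shows "V \<in> obj T \<Longrightarrow> A \<bullet> mzero U V X = mzero U V Y"
    "V \<in> obj T \<Longrightarrow> mzero U Y V \<bullet> A = mzero U X V"
proof -
  have A: "A \<in> arr U" "src U A = X" "tgt U A = Y" using assms by simp_all
  show "V \<in> obj T \<Longrightarrow> A \<bullet> mzero U V X = mzero U V Y"
    using U.comp_0_right[OF _ A(1,2), of V] A(3) by (metis U_fields(1))
  show "V \<in> obj T \<Longrightarrow> mzero U Y V \<bullet> A = mzero U X V"
    using U.comp_0_left[OF _ A(1,3), of V] A(2) by (metis U_fields(1))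
qed

text \<open>Saturation of \<open>W\<close>, proved by hand with the calculus of fractions. The maps
  \<open>v\<close> into and \<open>x\<close> out of the cone (for \<open>x\<close> shifted by -1,
  called \<open>C\<close>) become zero in \<open>U\<close>, hence are killed by arrows
  \<open>p\<close> and \<open>t\<close> of \<open>W\<close>. From these an arrow of \<open>W\<close>
  into \<open>C\<close> is made that is zero, and \<open>W_of_0\<close> applies.\<close>

lemma W_if_proj_iso:
  assumes f: "f \<in> Hom T Z Y" and g: "g \<in> Hom U Y Z" "g \<bullet> proj f = idt U Z" "proj f \<bullet> g = idt U Y"
  shows "f \<in> W"
proof -
  obtain v w where d: "(f, v, w) \<in> dist T" using dist_complete[of f] f by auto
  obtain x where x: "x \<in> arr T" "sha T x = mneg T w" "tgt T x = src T f" "sho T (src T x) = tgt T v"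
    "(x, f, v) \<in> dist T" using unrotate[OF d] .
  obtain y where y: "y \<in> arr T" "sha T y = mneg T v" "tgt T y = src T x" "sho T (src T y) = tgt T f"
    "(y, x, f) \<in> dist T" using unrotate[OF x(5)] .
  note D = distD[OF d]
  define C where "C = src T x"
  define Y' where "Y' = src T y"
  have H: "x \<in> Hom T C Z" "y \<in> Hom T Y' C" "v \<in> Hom T Y (tgt T v)"
    using x y f D by (simp_all add: C_def Y'_def)
  have o: "C \<in> obj T" "Y' \<in> obj T" "Z \<in> obj T" "Y \<in> obj T" using H f by auto
  have vf: "v \<cdot> f = mzero T Z (tgt T v)" "f \<cdot> x = mzero T C Y"
    using dist_comp_0[OF d] dist_comp_0[OF x(5)] f x by (simp_all add: C_def)
  have "proj v = proj v \<bullet> (proj f \<bullet> g)"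
    unfolding g(3) using comp_U_idt(1)[OF proj_Hom[OF H(3)]] by simp
  also have "\<dots> = proj (v \<cdot> f) \<bullet> g"
    using comp_U_assoc[OF g(1) proj_Hom[OF f] proj_Hom[OF H(3)]] proj_comp[OF f H(3)] by simp
  also have "\<dots> = mzero U Z (tgt T v) \<bullet> g" unfolding vf by simp
  also have "\<dots> = mzero U Y (tgt T v)"
    by (rule comp_U_0(2)[OF g(1)]) (use D in simp)
  finally obtain p where p: "p \<in> W" "tgt T p = Y" "v \<cdot> p = mzero T (src T p) (tgt T v)"
    using proj_eq_0D[OF H(3)] by blast
  have "proj x = (g \<bullet> proj f) \<bullet> proj x"
    unfolding g(2) using comp_U_idt(2)[OF proj_Hom[OF H(1)]] by simp
  also have "\<dots> = g \<bullet> proj (f \<cdot> x)"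
    using comp_U_assoc[OF proj_Hom[OF H(1)] proj_Hom[OF f] g(1)] proj_comp[OF H(1) f] by simp
  also have "\<dots> = g \<bullet> mzero U C Y" unfolding vf by simp
  also have "\<dots> = mzero U C Z"
    by (rule comp_U_0(1)[OF g(1) o(1)])
  finally obtain t where t: "t \<in> W" "tgt T t = C" "x \<cdot> t = mzero T (src T t) Z"
    using proj_eq_0D[OF H(1)] by blast
  have tH: "t \<in> Hom T (src T t) C" using t by simp
  obtain k where k: "k \<in> Hom T (src T t) Y'" "t = y \<cdot> k"
    using dist_lift[OF y(5) H(2,1) tH t(3)] by blast
  obtain p' where p': "p' \<in> arr T" "p = sha T p'" using sha_full'[of p] p by auto
  have sY: "sho T Y' = Y" using y(4) f by (simp add: Y'_def)
  have p'Y: "tgt T p' = Y'" using sho_inj[of "tgt T p'" Y'] p' p(2) sY o by simp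
  have p'W: "p' \<in> W" using W_sha[OF p'(1)] p p' by simp
  have "sha T (y \<cdot> p') = mneg T (v \<cdot> p)"
    using y(2) p p' p'Y H by simp
  also have "\<dots> = sha T (mzero T (src T p') C)"
    unfolding p(3) using p' H o x(4) D by (simp add: C_def)
  finally have yp: "y \<cdot> p' = mzero T (src T p') C"
    using sha_faithful[of "y \<cdot> p'" "mzero T (src T p') C"] H p' p'Y o by simp
  \<comment> \<open>With \<open>t = y \<cdot> k\<close> and \<open>y \<cdot> p' = 0\<close>, the Ore
    square for \<open>k\<close> and \<open>p'\<close> gives
    \<open>t \<cdot> e = y \<cdot> p' \<cdot> k' = 0\<close>.\<close>
  obtain e k' where e: "e \<in> W" "k' \<in> arr T" "tgt T e = src T k" "src T k' = src T e"
    "tgt T k' = src T p'" "k \<cdot> e = p' \<cdot> k'"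
    by (rule ore[of k p']) (use k p'W p'Y in simp_all)
  have "t \<cdot> e = y \<cdot> (k \<cdot> e)" unfolding k(2) using k(1) H e by simp
  also have "\<dots> = (y \<cdot> p') \<cdot> k'" unfolding e(6) using H p' p'Y e by simp
  also have "\<dots> = mzero T (src T e) C" unfolding yp using e p' o by simp
  finally have te: "t \<cdot> e = mzero T (src T e) C" .
  have teW: "t \<cdot> e \<in> W" by (rule W_comp) (use t e k in simp_all)
  have te': "src T (t \<cdot> e) = src T e" "tgt T (t \<cdot> e) = C" using t(1,2) e(1,3) k(1) by simp_all
  have "tgt T (t \<cdot> e) \<in> N" by (rule W_of_0[OF teW]) (unfold te', rule te)
  then have "C \<in> N" unfolding te' .
  then have "tgt T v \<in> N"
    using triangulatedD(3)[OF N_triangulated o(1)] x(4) by (simp add: C_def)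
  then show ?thesis by (rule W_I[OF d])
qed

text \<open>For an isomorphism written as a roof \<open>(s, f)\<close> the projection of
  \<open>f\<close> is invertible too, with inverse \<open>g \<bullet> B\<close>, where
  \<open>g\<close> is the inverse of the projection of \<open>s\<close>; saturation then puts
  \<open>f\<close> into \<open>W\<close>.\<close>

lemma isomorphic_U_roof:
  assumes "isomorphic U X Y"
  obtains s f where "s \<in> W" "f \<in> W" "src T s = src T f" "tgt T s = X" "tgt T f = Y"
proof -
  obtain A B where A: "A \<in> Hom U X Y" and B: "B \<in> Hom U Y X" and BA: "B \<bullet> A = idt U X"
    and AB: "A \<bullet> B = idt U Y"
    using assms by (rule U.isomorphicE)
  obtain s f where s: "s \<in> W" "f \<in> arr T" "src T s = src T f" "tgt T s = X" "tgt T f = Y" "A = frac s f"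
    using A by (rule Hom_U_E)
  define Z where "Z = src T s"
  have Z: "Z \<in> obj T" "src T s = Z" using s by (simp_all add: Z_def)
  have sH: "s \<in> Hom T Z X" "f \<in> Hom T Z Y" using s Z by simp_all
  define g where "g = frac s (idt T Z)"
  have g: "g \<in> Hom U X Z" using s Z by (simp add: g_def)
  have ps: "proj s = frac (idt T Z) s" "proj f = frac (idt T Z) f" using s Z by (simp_all add: proj_def)
  have Ag: "A = proj f \<bullet> g"
  proof -
    have "proj f \<bullet> g = frac (s \<cdot> idt T Z) (f \<cdot> idt T Z)"
      unfolding ps g_def by (rule comp_frac) (use s Z in simp_all)
    then show ?thesis using s Z by simp
  qed
  have sg: "proj s \<bullet> g = idt U X"
  proof -
    have "proj s \<bullet> g = frac (s \<cdot> idt T Z) (s \<cdot> idt T Z)"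
      unfolding ps g_def by (rule comp_frac) (use s Z in simp_all)
    then show ?thesis using frac_idt[OF s(1)] s Z by simp
  qed
  have gs: "g \<bullet> proj s = idt U Z"
  proof -
    have "g \<bullet> proj s = frac (idt T Z \<cdot> idt T Z) (idt T Z \<cdot> idt T Z)"
      unfolding ps g_def by (rule comp_frac) (use s Z in simp_all)
    then show ?thesis using frac_idt[of "idt T Z"] Z by simp
  qed
  have gB: "g \<bullet> B \<in> Hom U Y Z" by (rule comp_U_Hom[OF B g])
  have pf: "proj f \<in> Hom U Z Y" "proj s \<in> Hom U Z X" using proj_Hom sH by blast+
  have 1: "proj f \<bullet> (g \<bullet> B) = idt U Y"
    using comp_U_assoc[OF B g pf(1)] AB Ag by simp
  have As: "A \<bullet> proj s = proj f"
    using comp_U_assoc[OF pf(2) g pf(1)] comp_U_idt(1)[OF pf(1)] Ag gs by metis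
  have "(g \<bullet> B) \<bullet> proj f = (g \<bullet> B) \<bullet> (A \<bullet> proj s)" unfolding As ..
  also have "\<dots> = ((g \<bullet> B) \<bullet> A) \<bullet> proj s" by (rule comp_U_assoc[OF pf(2) A gB])
  also have "(g \<bullet> B) \<bullet> A = g"
    using comp_U_assoc[OF A B g] BA comp_U_idt(1)[OF g] by metis
  finally have 2: "(g \<bullet> B) \<bullet> proj f = idt U Z" using gs by metis
  have "f \<in> W" by (rule W_if_proj_iso[OF sH(2) gB 2 1])
  then show ?thesis using that[OF s(1)] s by blast
qed

text \<open>Both legs of the roof have cones in \<open>N\<close>, so membership passes from
  \<open>X\<close> to the top of the roof and on to \<open>Y\<close>.\<close>

lemma isomorphic_U_mem:
  assumes M: "triangulated_subcategory T M" "N \<subseteq> M" and "isomorphic U X Y" "X \<in> M" shows "Y \<in> M"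
proof -
  obtain s f where s: "s \<in> W" "f \<in> W" "src T s = src T f" "tgt T s = X" "tgt T f = Y"
    using assms(3) by (rule isomorphic_U_roof)
  obtain C v w where C: "C \<in> N" "(s, v, w) \<in> dist T" "v \<in> Hom T (tgt T s) C" using s(1) by (rule W_E)
  obtain D l i where D: "D \<in> N" "(f, l, i) \<in> dist T" "l \<in> Hom T (tgt T f) D" using s(2) by (rule W_E)
  have "src T s \<in> M" using triangulatedD(6)[OF M(1) triI[OF C(2)]] C M(2) s assms(4) by auto
  then show ?thesis using triangulatedD(5)[OF M(1) triI[OF D(2)]] D M(2) s by auto
qed

text \<open>\<open>M\<close> is stable under isomorphisms of \<open>U\<close>, so triangles and
  direct sums of \<open>U\<close> may be replaced by isomorphic ones coming from
  \<open>T\<close>.\<close>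

lemma thick_T_U:
  assumes "triangulated_subcategory T M" "summand_closed T M" "N \<subseteq> M"
  shows "triangulated_subcategory U M" "summand_closed U M"
proof -
  note iso = isomorphic_U_mem[OF assms(1,3)]
  have M: "M \<subseteq> obj T" using triangulatedD(1)[OF assms(1)] .
  have "tgt U v \<in> M" if d: "(u, v, w) \<in> dist U" "src U u \<in> M" "tgt U u \<in> M" for u v w
  proof -
    obtain X Y Z where X: "tri T X Y Z" "isomorphic U X (src U u)" "isomorphic U Y (tgt U u)"
      "isomorphic U Z (tgt U v)" using d(1) by (rule dist_U_T)
    have "X \<in> M" "Y \<in> M" using iso U.isomorphic_sym X(2,3) d(2,3) by blast+
    then have "Z \<in> M" by (rule triangulatedD(4)[OF assms(1) X(1)])
    then show ?thesis using iso X(4) by blast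
  qed
  then show "triangulated_subcategory U M"
    using iso M assms(1) unfolding triangulated_subcategory_def iso_closed_def by auto
  show "summand_closed U M"
    unfolding summand_closed_def
  proof (intro ballI impI)
    fix S X Y assume S: "S \<in> M" "X \<in> obj U" "Y \<in> obj U" "direct_sum U X Y S"
    obtain S0 where S0: "direct_sum T X Y S0" using direct_sum_exists[of X Y] S by auto
    have "isomorphic U S S0" by (rule U.direct_sum_unique[OF S(4) proj_direct_sum[OF S0]])
    then have "S0 \<in> M" using iso S(1) by blast
    then show "X \<in> M" using assms(2) S S0 unfolding summand_closed_def by simp blast
  qed
qed

lemma thick_U_T:
  assumes "triangulated_subcategory U M" "summand_closed U M"
  shows "triangulated_subcategory T M" "summand_closed T M"
proof -
  show "triangulated_subcategory T M"
  proof (rule triangulatedI)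
    show "M \<subseteq> obj T" "M \<noteq> {}" using assms(1) by (auto simp: triangulated_subcategory_def)
    show "Y \<in> M" if "isomorphic T X Y" "X \<in> M" for X Y
      using assms(1) isomorphic_T_U[OF that(1)] that isomorphic_obj[OF that(1)]
      by (auto simp: triangulated_subcategory_def iso_closed_def)
    show "sho T X \<in> M \<longleftrightarrow> X \<in> M" if "X \<in> obj T" for X
      using assms(1) that by (auto simp: triangulated_subcategory_def)
    show "Z \<in> M" if t: "tri T X Y Z" "X \<in> M" "Y \<in> M" for X Y Z
    proof -
      obtain u v w where d: "(u, v, w) \<in> dist T" "u \<in> Hom T X Y" "v \<in> Hom T Y Z" "w \<in> Hom T Z (sho T X)"
        using t(1) by (rule triE)
      have "\<forall>(u, v, w) \<in> dist U. src U u \<in> M \<and> tgt U u \<in> M \<longrightarrow> tgt U v \<in> M"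
        using assms(1) by (auto simp: triangulated_subcategory_def)
      from bspec[OF this dist_T_U[OF d(1)]] show ?thesis using d t by simp
    qed
  qed
  show "summand_closed T M"
    using assms(2) proj_direct_sum unfolding summand_closed_def U_fields by blast
qed

text \<open>\<open>thick T M\<close> contains \<open>N\<close> and is therefore thick in
  \<open>U\<close> as well; conversely every thick subcategory of \<open>U\<close> is thick in
  \<open>T\<close>.\<close>

lemma thick_U_eq: assumes "N \<subseteq> thick T M" "M \<subseteq> obj T" shows "thick U M = thick T M"
proof
  show "thick U M \<subseteq> thick T M"
    using thick_T_U[OF thick_triangulated[OF assms(2)] thick_summand_closed assms(1)] thick_superset[of M]
    unfolding thick_def[of U] by blast
  show "thick T M \<subseteq> thick U M"
    using thick_U_T unfolding thick_def by blast
qed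

text \<open>Only an inclusion: the hull in \<open>U\<close> also has all objects of
  \<open>N\<close>, which are zero there.\<close>

lemma add_hull_T_U: assumes "M \<subseteq> obj T" shows "add_hull T M \<subseteq> add_hull U M"
proof (rule add_hull_least)
  show "M \<subseteq> add_hull U M" by (rule U.add_hull_superset)
  show "add_hull U M \<subseteq> obj T" using U.add_hull_obj[of M] assms by simp
  show "iso_closed T (add_hull U M)"
    using U.add_hull_iso isomorphic_T_U unfolding iso_closed_def by blast
  show "sum_closed T (add_hull U M)"
    using U.add_hull_closed(2)[of M] zero_object_T_U proj_direct_sum unfolding sum_closed_def U_fields by blast
  show "summand_closed T (add_hull U M)"
    using U.add_hull_closed(3)[of M] proj_direct_sum unfolding summand_closed_def U_fields by blast
qed

end

section \<open>The bijection and the orders\<close>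

lemma silt_class_eq_iff:
  assumes "silting K M" "silting K M'"
  shows "silt_class K M = silt_class K M' \<longleftrightarrow> add_hull K M = add_hull K M'"
  using assms unfolding silt_class_def silting_equiv_def by auto

text \<open>The order asks for some pair of representatives. Equivalent ones have the same additive
  hull and vanishing extends to hulls, so any pair decides.\<close>

lemma silt_ge_iff:
  assumes "shift_additive_category K" "silting K M" "silting K M'"
  shows "(silt_class K M, silt_class K M') \<in> silt_ge K \<longleftrightarrow> (\<forall>i>0. hom_vanish K M (shift K i ` M'))"
proof
  interpret K: shift_additive_category K by fact
  assume "(silt_class K M, silt_class K M') \<in> silt_ge K"
  then obtain N N' where N: "N \<in> silt_class K M" "N' \<in> silt_class K M'"
    and v: "\<And>i. i > 0 \<Longrightarrow> hom_vanish K N (shift K i ` N')" unfolding silt_ge_def by blast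
  have s: "silting K N" "silting K N'" "add_hull K M = add_hull K N" "add_hull K M' = add_hull K N'"
    using N by (auto simp: silt_class_def silting_equiv_def)
  then have "N \<subseteq> obj K" "N' \<subseteq> obj K" by (auto simp: silting_def presilting_def)
  then show "\<forall>i>0. hom_vanish K M (shift K i ` M')"
    using K.hom_vanish_add_hull[OF _ _ v] K.add_hull_superset[of M] K.add_hull_superset[of M'] s(3,4)
    by simp
next
  assume "\<forall>i>0. hom_vanish K M (shift K i ` M')"
  moreover have "M \<in> silt_class K M" "M' \<in> silt_class K M'"
    using assms(2,3) by (auto simp: silt_class_def silting_equiv_def)
  ultimately show "(silt_class K M, silt_class K M') \<in> silt_ge K"
    using assms(2,3) unfolding silt_ge_def silt_def by blast
qed

lemma partial_order_on_bij:
  assumes r: "partial_order_on A r" and f: "bij_betw f A B" and s: "s \<subseteq> B \<times> B"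
    and iff: "\<And>x y. \<lbrakk>x \<in> A; y \<in> A\<rbrakk> \<Longrightarrow> (x, y) \<in> r \<longleftrightarrow> (f x, f y) \<in> s"
  shows "partial_order_on B s"
proof -
  have B: "B = f ` A" using f by (simp add: bij_betw_def)
  have s': "s = map_prod f f ` r"
  proof
    show "s \<subseteq> map_prod f f ` r"
    proof
      fix p assume p: "p \<in> s"
      then obtain x y where "x \<in> A" "y \<in> A" "p = (f x, f y)" using s B by blast
      then show "p \<in> map_prod f f ` r" using iff p by force
    qed
    show "map_prod f f ` r \<subseteq> s"
      using r iff by (auto simp: partial_order_on_def preorder_on_def refl_on_def)
  qed
  have inj: "\<And>x y. \<lbrakk>x \<in> A; y \<in> A; f x = f y\<rbrakk> \<Longrightarrow> x = y" using f by (auto simp: bij_betw_def inj_on_def)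
  have rA: "r \<subseteq> A \<times> A" "refl_on A r" "trans r" "antisym r"
    using r by (auto simp: partial_order_on_def preorder_on_def)
  have "refl_on B s" using rA(2) iff unfolding B refl_on_def by auto
  moreover have "trans s"
  proof (rule transI)
    fix x y z assume "(x, y) \<in> s" "(y, z) \<in> s"
    then obtain a b b' c where *: "(a, b) \<in> r" "(b', c) \<in> r" "x = f a" "y = f b" "y = f b'" "z = f c"
      unfolding s' by auto
    then have "b = b'" using inj rA(1) by blast
    then show "(x, z) \<in> s" using * transD[OF rA(3)] unfolding s' by force
  qed
  moreover have "antisym s"
  proof (rule antisymI)
    fix x y assume "(x, y) \<in> s" "(y, x) \<in> s"
    then obtain a b a' b' where *: "(a, b) \<in> r" "(b', a') \<in> r" "x = f a" "y = f b" "y = f b'" "x = f a'"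
      unfolding s' by auto
    then have "b = b'" "a = a'" using inj rA(1) by blast+
    then show "x = y" using * antisymD[OF rA(4)] by auto
  qed
  ultimately show ?thesis using s by (simp add: partial_order_on_def preorder_on_def)
qed

context triangulated_category
begin

text \<open>Stated for any set of classes so that it applies to \<open>silt_over T P\<close> with
  the restricted relation.\<close>

lemma silt_ge_partial_order:
  assumes "A \<subseteq> silt T" shows "partial_order_on A (silt_ge T \<inter> A \<times> A)"
proof -
  have K: "shift_additive_category T" by unfold_locales
  have rep: "\<exists>M. silting T M \<and> C = silt_class T M" if "C \<in> A" for C
    using that assms by (auto simp: silt_def)
  have h: "hom_vanish T M (sh i ` M') \<longleftrightarrow> (\<forall>X\<in>M. \<forall>Y\<in>M'. hom0 T X (sh i Y))"
    if "silting T M" "silting T M'" for M M' i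
    using that by (intro hom_vanish_shift_iff) (auto simp: silting_def presilting_def)
  have ge: "(silt_class T M, silt_class T M') \<in> silt_ge T
      \<longleftrightarrow> (\<forall>i>0. \<forall>X\<in>M. \<forall>Y\<in>M'. hom0 T X (sh i Y))"
    if "silting T M" "silting T M'" for M M'
    using silt_ge_iff[OF K that] h[OF that] by simp
  have o: "M \<subseteq> obj T" if "silting T M" for M using that by (simp add: silting_def presilting_def)
  have "refl_on A (silt_ge T \<inter> A \<times> A)"
  proof (rule refl_onI)
    fix C assume C: "C \<in> A"
    then obtain M where M: "silting T M" "C = silt_class T M" using rep by blast
    then have "(C, C) \<in> silt_ge T" using ge[OF M(1) M(1)] presiltingD[of M] by (auto simp: silting_def)
    then show "(C, C) \<in> silt_ge T \<inter> A \<times> A" using C by blast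
  qed
  moreover have "trans (silt_ge T \<inter> A \<times> A)"
  proof (rule transI)
    fix C D E assume *: "(C, D) \<in> silt_ge T \<inter> A \<times> A" "(D, E) \<in> silt_ge T \<inter> A \<times> A"
    then obtain L M N where r: "silting T L" "C = silt_class T L" "silting T M" "D = silt_class T M"
      "silting T N" "E = silt_class T N" using rep by (meson IntD2 SigmaD1 SigmaD2)
    have "(C, E) \<in> silt_ge T"
      using * silting_ge_trans[OF o[OF r(1)] r(3) o[OF r(5)]] r(1,3,5) unfolding r ge[OF r(1,5)]
      by (simp add: ge)
    then show "(C, E) \<in> silt_ge T \<inter> A \<times> A" using * by blast
  qed
  moreover have "antisym (silt_ge T \<inter> A \<times> A)"
  proof (rule antisymI)
    fix C D assume *: "(C, D) \<in> silt_ge T \<inter> A \<times> A" "(D, C) \<in> silt_ge T \<inter> A \<times> A"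
    then obtain M N where r: "silting T M" "C = silt_class T M" "silting T N" "D = silt_class T N"
      using rep by (meson IntD2 SigmaD1 SigmaD2)
    have g: "\<And>i X Y. \<lbrakk>i > 0; X \<in> M; Y \<in> N\<rbrakk> \<Longrightarrow> hom0 T X (sh i Y)"
      "\<And>i X Y. \<lbrakk>i > 0; X \<in> N; Y \<in> M\<rbrakk> \<Longrightarrow> hom0 T X (sh i Y)"
      using * ge[OF r(1,3)] ge[OF r(3,1)] unfolding r by blast+
    have "add_hull T M = add_hull T N"
      using add_hull_subset[OF o[OF r(1)] silting_ge_antisym[OF r(1) o[OF r(3)] g]]
        add_hull_subset[OF o[OF r(3)] silting_ge_antisym[OF r(3) o[OF r(1)] g(2,1)]] by blast
    then show "C = D" using silt_class_eq_iff[OF r(1,3)] r by simp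
  qed
  ultimately show ?thesis by (auto simp: partial_order_on_def preorder_on_def)
qed

end

context silting_reduction
begin

lemma silting_perp:
  assumes "presilting T M" "P \<subseteq> M" shows "M \<subseteq> left_perp 0 \<inter> right_perp 0"
proof
  fix X assume X: "X \<in> M"
  then have o: "X \<in> obj T" using presilting_obj[OF assms(1)] by auto
  have "hom0 T (sh j Q) X" if "j < 0" "Q \<in> P" for j Q
    using presiltingD[OF assms(1), of "- j" Q X] that X assms(2) P_obj o hom0_shift_right[of Q X "- j"]
    by auto
  then show "X \<in> left_perp 0 \<inter> right_perp 0"
    using presiltingD[OF assms(1) _ X] assms(2) o by (auto simp: left_perp_def right_perp_def)
qed

lemma hom_vanish_U_iff:
  assumes "A \<subseteq> left_perp 0 \<inter> right_perp 0" "B \<subseteq> left_perp 0 \<inter> right_perp 0" "i > 0"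
  shows "hom_vanish U A (shift U i ` B) \<longleftrightarrow> hom_vanish T A (sh i ` B)"
proof -
  have o: "A \<subseteq> obj T" "B \<subseteq> obj T" using assms by (auto simp: left_perp_def)
  have "hom0 U X (sh i Y) \<longleftrightarrow> hom0 T X (sh i Y)" if "X \<in> A" "Y \<in> B" for X Y
  proof (rule hom0_U_iff)
    have Y: "Y \<in> obj T" "Y \<in> right_perp 0" using that assms o by auto
    \<comment> \<open>Since \<open>i \<ge> 1\<close>, \<open>right_perp i\<close> is contained in
      \<open>right_perp 1\<close>, the level at which Hom in \<open>T\<close> and in
      \<open>U\<close> can be compared.\<close>
    then have "sh i Y \<in> right_perp (0 + i)" using right_perp_sh by blast
    then show "sh i Y \<in> right_perp 1" using assms(3) by (auto simp: right_perp_def)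
  qed (use that assms in auto)
  moreover have "sh i ` B \<subseteq> obj T" using o by auto
  moreover have "shift U i ` B = sh i ` B" by (simp add: shift_U)
  ultimately show ?thesis
    using U.hom_vanish_iff[of A "sh i ` B"] hom_vanish_iff[of A "sh i ` B"] o(1) by simp
qed

lemma silting_U:
  assumes "silting T M" "P \<subseteq> M" shows "silting U M"
proof -
  have p: "presilting T M" "thick T M = obj T" "M \<subseteq> obj T" using assms by (auto simp: silting_def presilting_def)
  have "presilting U M"
    using p hom_vanish_U_iff[OF silting_perp[OF p(1) assms(2)] silting_perp[OF p(1) assms(2)]]
    by (simp add: presilting_def)
  moreover have "thick T P \<subseteq> thick T M"
    by (rule thick_least)
      (use assms(2) thick_superset[of M] thick_triangulated[OF p(3)] thick_summand_closed in auto)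
  then have "thick U M = obj U" using thick_U_eq[of M] p by simp
  ultimately show ?thesis by (simp add: silting_def)
qed

text \<open>A left and then a right truncation, both to level 0, change \<open>X\<close> only by
  objects of \<open>thick T P\<close>. The point is that the second does not undo what the first
  achieved.\<close>

lemma perp_representative:
  assumes "X \<in> obj T" obtains X' where "X' \<in> left_perp 0 \<inter> right_perp 0" "isomorphic U X X'"
proof -
  obtain n where n: "X \<in> left_perp (int n)" using left_perp_ex[OF assms] .
  obtain X1 C where X1: "X1 \<in> left_perp (int n - int n)" "C \<in> ext T (shs T P {int n - int n<..int n})"
    "tri T X1 X C" using left_truncation[OF n] by blast
  have X1o: "X1 \<in> obj T" using X1(1) by (simp add: left_perp_def)
  obtain m where m: "X1 \<in> right_perp (- int m)" using right_perp_ex[OF X1o] .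
  obtain X2 D where X2: "X2 \<in> right_perp (- int m + int m)"
    "D \<in> ext T (shs T P {- int m..<- int m + int m})" "tri T D X1 X2" using right_truncation[OF m] by blast
  have X2o: "X2 \<in> obj T" "D \<in> obj T" using tri_obj[OF X2(3)] by auto
  \<comment> \<open>\<open>X2\<close> is an extension with terms \<open>X1\<close> and
    \<open>D[1]\<close>. The pieces of \<open>D\<close> are negative shifts of \<open>P\<close>,
    those of \<open>D[1]\<close> nonpositive ones, so neither term has a nonzero map to
    \<open>P[j]\<close> with \<open>j > 0\<close>.\<close>
  have "hom0 T X2 (sh j Q)" if j: "j > 0" and Q: "Q \<in> P" for j Q
  proof -
    have "hom0 T D (sh (j - 1) Q)"
      by (rule ext_hom0_right_perp[OF X2(2), of 0])
        (use j Q P_right_perp[OF Q] right_perp_sh[of Q "j - 1" 0] P_obj in \<open>auto simp: right_perp_def\<close>)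
    then have "hom0 T (sho T D) (sh j Q)"
      using hom0_shift(1)[of D Q 1 j] X2o Q P_obj by auto
    moreover have "hom0 T X1 (sh j Q)" using X1(1) j Q by (simp add: left_perp_def)
    ultimately show ?thesis using tri_hom0_left[OF tri_rotate[OF X2(3)]] by blast
  qed
  then have "X2 \<in> left_perp 0 \<inter> right_perp 0" using X2(1) X2o by (simp add: left_perp_def)
  moreover have "isomorphic U X1 X" by (rule tri_isomorphic_right[OF X1(3) ext_thick[OF X1(2)]])
  moreover have "isomorphic U X1 X2" by (rule tri_isomorphic_left[OF X2(3) ext_thick[OF X2(2)]])
  ultimately show ?thesis using that U.isomorphic_sym U.isomorphic_trans by blast
qed

lemma silting_lift:
  assumes "silting U N"
  obtains M where "silting T M" "P \<subseteq> M" "add_hull U M = add_hull U N"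
proof -
  have N: "presilting U N" "N \<subseteq> obj U" "thick U N = obj U" using assms by (auto simp: silting_def presilting_def)
  \<comment> \<open>The whole hull is intersected with \<open>Z\<close>, and not \<open>N\<close>
    itself: representatives of objects of \<open>N\<close> are isomorphic to them only in
    \<open>U\<close>, and \<open>P\<close>, being zero in \<open>U\<close>, is included as
    well.\<close>
  define M where "M = {X \<in> left_perp 0 \<inter> right_perp 0. X \<in> add_hull U N}"
  have M: "M \<subseteq> left_perp 0 \<inter> right_perp 0" "M \<subseteq> add_hull U N" "M \<subseteq> obj T"
    by (auto simp: M_def left_perp_def)
  have rep: "\<exists>X' \<in> M. isomorphic U X X'" if "X \<in> N" for X
  proof -
    have X: "X \<in> obj T" "X \<in> add_hull U N" using that N U.add_hull_superset[of N] by auto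
    obtain X' where X': "X' \<in> left_perp 0 \<inter> right_perp 0" "isomorphic U X X'"
      using perp_representative[OF X(1)] .
    then show ?thesis using U.add_hull_iso[OF X(2)] by (auto simp: M_def)
  qed
  have P: "P \<subseteq> M"
  proof
    fix Q assume Q: "Q \<in> P"
    then have "zero_object U Q" using zero_object_U thick_superset[of P] by blast
    then have "Q \<in> add_hull U N" using U.add_hull_closed(2)[of N] by (auto simp: sum_closed_def)
    then show "Q \<in> M" using P_left_perp[OF Q] P_right_perp[OF Q] by (simp add: M_def)
  qed
  have "hom_vanish T M (sh i ` M)" if i: "i > 0" for i
  proof -
    have "hom_vanish U N (shift U i ` N)" using N(1) i by (simp add: presilting_def)
    then have "hom_vanish U M (shift U i ` M)" by (rule U.hom_vanish_add_hull[OF N(2,2) _ M(2,2)])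
    then show ?thesis using hom_vanish_U_iff[OF M(1,1) i] by simp
  qed
  then have ps: "presilting T M" using M(3) by (simp add: presilting_def)
  \<comment> \<open>A thick \<open>L\<close> containing \<open>M\<close> contains
    \<open>thick T P\<close>, hence is stable under isomorphisms of \<open>U\<close> and contains
    \<open>N\<close> through its representatives. As \<open>L\<close> is thick in \<open>U\<close>
    too, it contains everything.\<close>
  have "obj T \<subseteq> L" if L: "M \<subseteq> L" "triangulated_subcategory T L" "summand_closed T L" for L
  proof -
    have PL: "thick T P \<subseteq> L" by (rule thick_least) (use P L in auto)
    have "N \<subseteq> L"
      using rep isomorphic_U_mem[OF L(2) PL] U.isomorphic_sym L(1) by blast
    then have "thick U N \<subseteq> L" using thick_T_U[OF L(2,3) PL] unfolding thick_def by blast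
    then show ?thesis using N(3) by simp
  qed
  then have "obj T \<subseteq> thick T M" unfolding thick_def by blast
  then have "thick T M = obj T" using triangulatedD(1)[OF thick_triangulated[OF M(3)]] by blast
  then have s: "silting T M" using ps by (simp add: silting_def)
  have "N \<subseteq> add_hull U M"
  proof
    fix X assume "X \<in> N"
    then obtain X' where "X' \<in> M" "isomorphic U X X'" using rep by blast
    then show "X \<in> add_hull U M"
      using U.add_hull_iso[of X' M X] U.isomorphic_sym[of X X'] U.add_hull_superset[of M] by blast
  qed
  then have "add_hull U M = add_hull U N"
    using U.add_hull_subset[OF _ M(2)] U.add_hull_subset[of M N] N(2) M(3) by simp
  then show ?thesis using that s P by blast
qed

lemma add_hull_U_cong:
  assumes "silting T M" "silting T M'" "add_hull T M = add_hull T M'"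
  shows "add_hull U M = add_hull U M'"
proof -
  have o: "M \<subseteq> obj T" "M' \<subseteq> obj T" using assms by (auto simp: silting_def presilting_def)
  have "M \<subseteq> add_hull U M'" "M' \<subseteq> add_hull U M"
    using add_hull_superset[of M] add_hull_superset[of M'] add_hull_T_U[OF o(1)] add_hull_T_U[OF o(2)]
      assms(3) by blast+
  then show ?thesis using U.add_hull_subset[of M M'] U.add_hull_subset[of M' M] o by simp
qed

lemma silt_ge_U_iff:
  assumes "silting T M" "P \<subseteq> M" "silting T M'" "P \<subseteq> M'"
  shows "(silt_class T M, silt_class T M') \<in> silt_ge T \<longleftrightarrow> (silt_class U M, silt_class U M') \<in> silt_ge U"
proof -
  have K: "shift_additive_category T" "shift_additive_category U" by unfold_locales
  have "M \<subseteq> left_perp 0 \<inter> right_perp 0" "M' \<subseteq> left_perp 0 \<inter> right_perp 0"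
    using silting_perp assms by (auto simp: silting_def)
  then show ?thesis
    using silt_ge_iff[OF K(1) assms(1,3)] silt_ge_iff[OF K(2) silting_U[OF assms(1,2)] silting_U[OF assms(3,4)]]
      hom_vanish_U_iff[of M M'] by simp
qed

theorem silting_reduction_iso:
  "\<exists>\<Phi>. (\<forall>M. silting T M \<and> P \<subseteq> M \<longrightarrow> silting U M \<and> \<Phi> (silt_class T M) = silt_class U M) \<and>
     poset_isomorphism (silt_over T P) (silt_ge T \<inter> silt_over T P \<times> silt_over T P)
       (silt U) (silt_ge U) \<Phi>"
proof -
  \<comment> \<open>A class over \<open>P\<close> may have members that do not contain
    \<open>P\<close>, whereas \<open>silting_U\<close> requires \<open>P \<subseteq> M\<close>; the
    choice is restricted accordingly.\<close>
  define \<Phi> where "\<Phi> C = silt_class U (SOME M. silting T M \<and> P \<subseteq> M \<and> silt_class T M = C)" for C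
  have \<Phi>: "\<Phi> (silt_class T M) = silt_class U M" if M: "silting T M" "P \<subseteq> M" for M
  proof -
    define M0 where "M0 = (SOME M'. silting T M' \<and> P \<subseteq> M' \<and> silt_class T M' = silt_class T M)"
    have M0: "silting T M0 \<and> P \<subseteq> M0 \<and> silt_class T M0 = silt_class T M"
      unfolding M0_def by (rule someI[of _ M]) (use M in simp)
    then have "add_hull U M0 = add_hull U M"
      using add_hull_U_cong silt_class_eq_iff[of T M0 M] M by blast
    then show ?thesis
      using silt_class_eq_iff[of U M0 M] silting_U M0 M unfolding \<Phi>_def M0_def[symmetric] by blast
  qed
  have over: "\<exists>M. silting T M \<and> P \<subseteq> M \<and> C = silt_class T M" if "C \<in> silt_over T P" for C
    using that by (auto simp: silt_over_def)
  have iff: "(C, D) \<in> silt_ge T \<longleftrightarrow> (\<Phi> C, \<Phi> D) \<in> silt_ge U"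
    if "C \<in> silt_over T P" "D \<in> silt_over T P" for C D
    using over[OF that(1)] over[OF that(2)] silt_ge_U_iff \<Phi> by auto
  have sub: "silt_over T P \<subseteq> silt T" by (auto simp: silt_over_def silt_def)
  have po: "partial_order_on (silt_over T P) (silt_ge T \<inter> silt_over T P \<times> silt_over T P)"
    by (rule silt_ge_partial_order[OF sub])
  have bij: "bij_betw \<Phi> (silt_over T P) (silt U)"
  proof (rule bij_betw_imageI)
    show "inj_on \<Phi> (silt_over T P)"
    proof (rule inj_onI)
      fix C D assume *: "C \<in> silt_over T P" "D \<in> silt_over T P" "\<Phi> C = \<Phi> D"
      have K: "shift_additive_category U" by unfold_locales
      \<comment> \<open>Antisymmetry in \<open>U\<close> is not yet at hand. Reflexivity, which is
        the presilting condition, is enough: with \<open>\<Phi> C = \<Phi> D\<close> it is reflected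
        to both comparisons of \<open>C\<close> and \<open>D\<close> in \<open>T\<close>.\<close>
      have "(\<Phi> C, \<Phi> C) \<in> silt_ge U"
      proof -
        obtain M where M: "silting T M" "P \<subseteq> M" "C = silt_class T M" using over[OF *(1)] by blast
        have "presilting U M" using silting_U[OF M(1,2)] by (simp add: silting_def)
        then show ?thesis
          unfolding M(3) \<Phi>[OF M(1,2)] silt_ge_iff[OF K silting_U[OF M(1,2)] silting_U[OF M(1,2)]]
          by (simp add: presilting_def)
      qed
      then have "(C, D) \<in> silt_ge T" "(D, C) \<in> silt_ge T" using iff * by auto
      then show "C = D" using po * by (auto simp: partial_order_on_def antisym_def)
    qed
    show "\<Phi> ` silt_over T P = silt U"
    proof (intro equalityI subsetI)
      fix D assume "D \<in> \<Phi> ` silt_over T P"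
      then obtain M where M: "silting T M" "P \<subseteq> M" "D = \<Phi> (silt_class T M)" using over by blast
      then show "D \<in> silt U" using \<Phi>[OF M(1,2)] silting_U[OF M(1,2)] by (simp add: silt_def)
    next
      fix D assume "D \<in> silt U"
      then obtain N where N: "silting U N" "D = silt_class U N" by (auto simp: silt_def)
      obtain M where M: "silting T M" "P \<subseteq> M" "add_hull U M = add_hull U N" using silting_lift[OF N(1)] .
      have "D = \<Phi> (silt_class T M)"
        using \<Phi>[OF M(1,2)] silt_class_eq_iff[OF silting_U[OF M(1,2)] N(1)] M(3) N(2) by simp
      then show "D \<in> \<Phi> ` silt_over T P" using M by (auto simp: silt_over_def)
    qed
  qed
  have "silt_ge U \<subseteq> silt U \<times> silt U" by (auto simp: silt_ge_def)
  then have "partial_order_on (silt U) (silt_ge U)"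
    by (rule partial_order_on_bij[OF po bij]) (use iff in auto)
  then have "poset_isomorphism (silt_over T P) (silt_ge T \<inter> silt_over T P \<times> silt_over T P)
       (silt U) (silt_ge U) \<Phi>"
    unfolding poset_isomorphism_def using po bij iff by auto
  then show ?thesis using \<Phi> silting_U by blast
qed

end

theorem corollary3p8:
  fixes T :: "('o, 'a) tri_cat" and P :: "'o set"
    and U :: "('o, 'a roof set) tri_cat" and \<rho> :: "'o \<Rightarrow> 'o"
  assumes "triangulated_category T"
    and "presilting T P" and "P = add_hull T P"
    and "P1 T P" and "P2 T P"
    and "U = triangle_quotient T (thick T P)" and "\<rho> = proj_obj T (thick T P)"
  shows "\<exists>\<Phi>. (\<forall>M. silting T M \<and> P \<subseteq> M \<longrightarrow>
               silting U (\<rho> ` M) \<and> \<Phi> (silt_class T M) = silt_class U (\<rho> ` M)) \<and>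
             poset_isomorphism (silt_over T P) (silt_ge T \<inter> silt_over T P \<times> silt_over T P)
                               (silt U) (silt_ge U) \<Phi>"
proof -
  interpret silting_reduction T P
    using assms(1,2,4,5) by (simp add: silting_reduction_def silting_reduction_axioms_def)
  have "\<rho> ` M = M" for M by (simp add: assms(7) proj_obj_def)
  then show ?thesis using silting_reduction_iso unfolding assms(6) by simp
qed

end
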